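(* The group $\mathrm{PC}_{\mathbf{Proj}}(\mathbf{P}^1)$ has no infinite subgroup with Kazhdan's Property T.
   Context: $\mathbf{P}^1=\mathbf{R}\cup\{\infty\}$ denotes the real projective line, with its usual topology (a circle) and the action of $\mathrm{PGL}_2(\mathbf{R})$ by homographies $x\mapsto\frac{ax+b}{cx+d}$. $\mathrm{PC}(\mathbf{P}^1)$ is the group of piecewise continuous self-transformations of $\mathbf{P}^1$: its elements are represented by maps $f:\mathbf{P}^1\to\mathbf{P}^1$, continuous outside a finite subset, for which there exists another such map $g:\mathbf{P}^1\to\mathbf{P}^1$ such that $f\circ g$ and $g\circ f$ coincide with the identity outside a finite subset; two such maps are identified if they coincide outside a finite subset. The group law is composition. $\mathrm{PC}_{\mathbf{Proj}}(\mathbf{P}^1)$ is the subgroup of $\mathrm{PC}(\mathbf{P}^1)$ of those elements represented by a map $f$ such that for all but finitely many $x\in\mathbf{P}^1$ there exist a neighborhood $V$ of $x$ and $g\in\mathrm{PGL}_2(\mathbf{R})$ such that $f(x')=g(x')$ for all $x'\in V$. Subgroups are regarded as discrete groups. Kazhdan's Property T (for countable discrete groups; discrete groups with Property T are countable) is used in the following form: a countable discrete group $\Gamma$ has Property T if for every measure space $(E,\mathcal{A},\mu)$ with a measure-preserving $\Gamma$-action and every measurable subset $X\subset E$ such that $\mu(X\triangle\gamma X)<\infty$ for every $\gamma\in\Gamma$, there exists a $\Gamma$-invariant measurable subset $X'\subset E$ such that $\mu(X\triangle X')<\infty$. *)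

theory Defs
  imports "HOL-Analysis.Analysis" "HOL-Algebra.Group_Action"
begin

section \<open>The real projective line\<close>

text \<open>The point at infinity is \<^term>\<open>None\<close>.\<close>

type_synonym proj_line = "real option"

definition P1 :: "proj_line topology"
  where "P1 = Alexandroff_compactification euclideanreal"

fun homography :: "real \<Rightarrow> real \<Rightarrow> real \<Rightarrow> real \<Rightarrow> proj_line \<Rightarrow> proj_line"
  where
    "homography a b c d (Some x) =
       (if c * x + d = 0 then None else Some ((a * x + b) / (c * x + d)))"
  | "homography a b c d None = (if c = 0 then None else Some (a / c))"

text \<open>The action on the projective line is faithful, so the projective linear group is
  identified with its group of homographies.\<close>

definition PGL2 :: "(proj_line \<Rightarrow> proj_line) set"
  where "PGL2 = {homography a b c d | a b c d. a * d - b * c \<noteq> 0}"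


section \<open>Piecewise continuous and piecewise projective transformations\<close>

text \<open>Here \<^term>\<open>\<forall>\<^sub>\<infinity>x. Q x\<close> means that \<^term>\<open>Q\<close> holds outside a finite set. As finite subsets
  of the line are closed, being continuous at every point off a finite set \<^term>\<open>F\<close> is the same as
  having a continuous restriction to the complement of \<^term>\<open>F\<close>.\<close>

definition cofin_continuous :: "(proj_line \<Rightarrow> proj_line) \<Rightarrow> bool"
  where "cofin_continuous f \<longleftrightarrow> (\<forall>\<^sub>\<infinity>x. topcontinuous_at P1 P1 f x)"

definition PC_map :: "(proj_line \<Rightarrow> proj_line) \<Rightarrow> bool"
  where "PC_map f \<longleftrightarrow> cofin_continuous f \<and>
    (\<exists>g. cofin_continuous g \<and> (\<forall>\<^sub>\<infinity>x. f (g x) = x) \<and> (\<forall>\<^sub>\<infinity>x. g (f x) = x))"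

definition PC_rel :: "((proj_line \<Rightarrow> proj_line) \<times> (proj_line \<Rightarrow> proj_line)) set"
  where "PC_rel = {(f, g). PC_map f \<and> PC_map g \<and> (\<forall>\<^sub>\<infinity>x. f x = g x)}"

definition PC :: "(proj_line \<Rightarrow> proj_line) set monoid"
  where "PC = \<lparr>carrier = Collect PC_map // PC_rel,
               mult = (\<lambda>X Y. \<Union>f\<in>X. \<Union>g\<in>Y. PC_rel `` {f \<circ> g}),
               one = PC_rel `` {id}\<rparr>"

definition piecewise_projective :: "(proj_line \<Rightarrow> proj_line) \<Rightarrow> bool"
  where "piecewise_projective f \<longleftrightarrow>
    (\<forall>\<^sub>\<infinity>x. \<exists>V. openin P1 V \<and> x \<in> V \<and> (\<exists>g\<in>PGL2. \<forall>x'\<in>V. f x' = g x'))"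

definition PC_Proj :: "(proj_line \<Rightarrow> proj_line) set monoid"
  where "PC_Proj = PC\<lparr>carrier := {X \<in> carrier PC. \<exists>f\<in>X. piecewise_projective f}\<rparr>"


section \<open>Property T\<close>

definition measure_preserving_action ::
    "('g, 'm) monoid_scheme \<Rightarrow> 'e measure \<Rightarrow> ('g \<Rightarrow> 'e \<Rightarrow> 'e) \<Rightarrow> bool"
  where "measure_preserving_action G M \<phi> \<longleftrightarrow> group_action G (space M) \<phi> \<and>
    (\<forall>g\<in>carrier G. \<forall>A\<in>sets M. \<phi> g ` A \<in> sets M \<and> emeasure M (\<phi> g ` A) = emeasure M A)"

text \<open>The measure spaces range over all those whose points have type \<^typ>\<open>'e\<close>.\<close>

definition commensurated_near_invariant :: "'e itself \<Rightarrow> ('g, 'm) monoid_scheme \<Rightarrow> bool"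
  where "commensurated_near_invariant (_ :: 'e itself) G \<longleftrightarrow>
    (\<forall>(M :: 'e measure) \<phi> X.
       measure_preserving_action G M \<phi> \<and> X \<in> sets M \<and>
       (\<forall>g\<in>carrier G. emeasure M (sym_diff X (\<phi> g ` X)) < \<infinity>) \<longrightarrow>
       (\<exists>X'\<in>sets M. (\<forall>g\<in>carrier G. \<phi> g ` X' = X') \<and> emeasure M (sym_diff X X') < \<infinity>))"

text \<open>Kazhdan's Property T of a countable discrete group, in terms of commensurated subsets of
  measure spaces with a measure-preserving action (Robertson--Steger, Cherix--Martin--Valette).

  A definition cannot quantify over the type of points of the measure space. Testing on
  measure spaces whose points are sets of group elements suffices: this is
  \<open>property_T_all_measure_spaces\<close> below, which allows an arbitrary type of points.\<close>

definition property_T :: "('g, 'm) monoid_scheme \<Rightarrow> bool"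
  where "property_T G \<longleftrightarrow> group G \<and> countable (carrier G) \<and>
    commensurated_near_invariant TYPE('g set) G"

lemma measure_preserving_actionD:
  assumes "measure_preserving_action G M \<phi>"
  shows "group_action G (space M) \<phi>"
    and "\<And>g A. \<lbrakk>g \<in> carrier G; A \<in> sets M\<rbrakk> \<Longrightarrow> \<phi> g ` A \<in> sets M"
    and "\<And>g A. \<lbrakk>g \<in> carrier G; A \<in> sets M\<rbrakk> \<Longrightarrow> emeasure M (\<phi> g ` A) = emeasure M A"
  using assms unfolding measure_preserving_action_def by auto

lemma commensurated_near_invariantD:
  fixes M :: "'e measure"
  assumes "commensurated_near_invariant TYPE('e) G" "measure_preserving_action G M \<phi>" "X \<in> sets M"
    and "\<forall>g\<in>carrier G. emeasure M (sym_diff X (\<phi> g ` X)) < \<infinity>"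
  shows "\<exists>X'\<in>sets M. (\<forall>g\<in>carrier G. \<phi> g ` X' = X') \<and> emeasure M (sym_diff X X') < \<infinity>"
  using assms(1)[unfolded commensurated_near_invariant_def, rule_format, of M \<phi> X] assms(2-4)
  by simp

proposition property_T_all_measure_spaces:
  fixes G :: "('g, 'm) monoid_scheme" (structure)
  assumes T: "property_T G"
  shows "commensurated_near_invariant TYPE('e) G"
  unfolding commensurated_near_invariant_def
proof (intro allI impI, elim conjE)
  fix M :: "'e measure" and \<phi> X
  assume act: "measure_preserving_action G M \<phi>" and X: "X \<in> sets M"
    and fin: "\<forall>g\<in>carrier G. emeasure M (sym_diff X (\<phi> g ` X)) < \<infinity>"
  note mp = measure_preserving_actionD[OF act]
  interpret group_action G "space M" \<phi> by (fact mp(1))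
  interpret group G using T by (simp add: property_T_def)
  let ?C = "carrier G"
  let ?P = "Pow ?C"
  have Xs: "X \<subseteq> space M" using X sets.sets_into_space by blast
  have inv_act: "\<phi> (inv h) (\<phi> h e) = e" "\<phi> h (\<phi> (inv h) e) = e"
    if "h \<in> ?C" "e \<in> space M" for h e
    using that by (metis composition_rule inv_closed l_inv r_inv id_eq_one restrict_apply')+
  have mem: "\<phi> h e \<in> space M" if "h \<in> ?C" "e \<in> space M" for h e
    using that surj_prop by blast
  have in_img: "\<phi> h e \<in> \<phi> h ` A \<longleftrightarrow> e \<in> A" if "h \<in> ?C" "e \<in> space M" "A \<subseteq> space M" for h e A
    using that inj_prop[OF that(1)] by (meson inj_on_image_mem_iff)
  define T where "T e = {g \<in> ?C. e \<in> \<phi> g ` X}" for e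
  define c where "c g = {A \<in> ?P. g \<in> A}" for g
  define K where "K = sigma ?P (c ` ?C)"
  have cP: "c ` ?C \<subseteq> Pow ?P" by (auto simp: c_def)
  have spK: "space K = ?P" by (simp add: K_def cP)
  have stK: "sets K = sigma_sets ?P (c ` ?C)" by (simp add: K_def cP)
  have TP: "T e \<in> ?P" for e by (auto simp: T_def)
  have Tm: "T \<in> measurable M K"
    unfolding K_def
  proof (rule measurable_measure_of[OF cP])
    show "T \<in> space M \<rightarrow> ?P" using TP by auto
    fix B assume "B \<in> c ` ?C"
    then obtain g where g: "g \<in> ?C" "B = c g" by auto
    have "T -` B \<inter> space M = \<phi> g ` X"
      using g TP Xs mem by (auto simp: c_def T_def)
    then show "T -` B \<inter> space M \<in> sets M" using mp(2)[OF g(1) X] by simp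
  qed
  define N where "N = distr M K T"
  have spN: "space N = ?P" and stN: "sets N = sets K" by (simp_all add: N_def spK)
  have emN: "emeasure N B = emeasure M (T -` B \<inter> space M)" if "B \<in> sets K" for B
    using that Tm by (simp add: N_def emeasure_distr)
  define \<psi> where "\<psi> h = restrict ((`) (\<lambda>g. h \<otimes>\<^bsub>G\<^esub> g)) ?P" for h
  have psi_mem: "\<psi> h A \<in> ?P" if "h \<in> ?C" "A \<in> ?P" for h A
    using that by (auto simp: \<psi>_def)
  have psi_one: "\<psi> \<one>\<^bsub>G\<^esub> A = A" if "A \<in> ?P" for A
  proof -
    have "(\<lambda>g. \<one>\<^bsub>G\<^esub> \<otimes>\<^bsub>G\<^esub> g) ` A = (\<lambda>g. g) ` A"
      using that by (intro image_cong) auto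
    then show ?thesis using that by (simp add: \<psi>_def)
  qed
  have psi_mult: "\<psi> (h \<otimes>\<^bsub>G\<^esub> k) A = \<psi> h (\<psi> k A)" if "h \<in> ?C" "k \<in> ?C" "A \<in> ?P" for h k A
  proof -
    have "(\<lambda>g. (h \<otimes>\<^bsub>G\<^esub> k) \<otimes>\<^bsub>G\<^esub> g) ` A = (\<lambda>g. h \<otimes>\<^bsub>G\<^esub> (k \<otimes>\<^bsub>G\<^esub> g)) ` A"
      using that by (intro image_cong) (auto simp: m_assoc)
    moreover have "(\<lambda>g. k \<otimes>\<^bsub>G\<^esub> g) ` A \<in> ?P" using that by auto
    ultimately show ?thesis using that by (simp add: \<psi>_def image_image)
  qed
  have psi_inv: "\<psi> (inv h) (\<psi> h A) = A" "\<psi> h (\<psi> (inv h) A) = A" if "h \<in> ?C" "A \<in> ?P" for h A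
    using that psi_mult psi_one by (metis inv_closed l_inv r_inv)+
  have psi_bij: "bij_betw (\<psi> h) ?P ?P" if "h \<in> ?C" for h
    by (rule bij_betw_byWitness[where f' = "\<psi> (inv h)"])
      (use that in \<open>simp_all add: psi_inv psi_mem image_subset_iff del: Pow_iff\<close>)
  have psi_Bij: "\<psi> h \<in> Bij ?P" if "h \<in> ?C" for h
    using psi_bij[OF that] by (simp add: Bij_def \<psi>_def)
  have psi_act: "group_action G ?P \<psi>"
    unfolding group_action_def group_hom_def group_hom_axioms_def
  proof (intro conjI is_group group_BijGroup)
    show "\<psi> \<in> hom G (BijGroup ?P)"
    proof (rule homI)
      fix h k assume hk: "h \<in> ?C" "k \<in> ?C"
      have "\<psi> (h \<otimes>\<^bsub>G\<^esub> k) = compose ?P (\<psi> h) (\<psi> k)"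
      proof
        fix A show "\<psi> (h \<otimes>\<^bsub>G\<^esub> k) A = compose ?P (\<psi> h) (\<psi> k) A"
          using psi_mult[OF hk, of A] by (cases "A \<in> ?P") (auto simp: compose_def \<psi>_def)
      qed
      then show "\<psi> (h \<otimes>\<^bsub>G\<^esub> k) = \<psi> h \<otimes>\<^bsub>BijGroup ?P\<^esub> \<psi> k"
        using psi_Bij hk by (simp add: BijGroup_def)
    qed (simp add: BijGroup_def psi_Bij)
  qed
  have psi_img: "\<psi> h ` B = \<psi> (inv h) -` B \<inter> ?P" if "h \<in> ?C" "B \<subseteq> ?P" for h B
  proof (intro Set.set_eqI iffI)
    fix A assume "A \<in> \<psi> h ` B"
    then obtain D where D: "D \<in> B" "A = \<psi> h D" by blast
    then have "D \<in> ?P" using that by blast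
    then show "A \<in> \<psi> (inv h) -` B \<inter> ?P"
      using D psi_inv(1)[OF that(1)] psi_mem[OF that(1)] by (simp del: Pow_iff)
  next
    fix A assume "A \<in> \<psi> (inv h) -` B \<inter> ?P"
    then show "A \<in> \<psi> h ` B"
      using that psi_inv(2)[of h A] by (metis IntE image_eqI vimageE)
  qed
  have psi_mem_iff: "g \<in> \<psi> h A \<longleftrightarrow> inv h \<otimes>\<^bsub>G\<^esub> g \<in> A" if "h \<in> ?C" "A \<in> ?P" "g \<in> ?C" for g h A
  proof
    note hA = that
    assume "g \<in> \<psi> h A"
    then obtain a where a: "a \<in> A" "g = h \<otimes>\<^bsub>G\<^esub> a"
      using hA by (auto simp: \<psi>_def)
    then have "inv h \<otimes>\<^bsub>G\<^esub> g = a" using that by (auto simp: m_assoc[symmetric])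
    then show "inv h \<otimes>\<^bsub>G\<^esub> g \<in> A" using a by simp
  next
    assume "inv h \<otimes>\<^bsub>G\<^esub> g \<in> A"
    moreover have "g = h \<otimes>\<^bsub>G\<^esub> (inv h \<otimes>\<^bsub>G\<^esub> g)" using that by (simp add: m_assoc[symmetric])
    ultimately show "g \<in> \<psi> h A" using that by (auto simp: \<psi>_def)
  qed
  have psi_meas: "\<psi> h \<in> measurable K K" if "h \<in> ?C" for h
    unfolding K_def
  proof (rule measurable_measure_of[OF cP], unfold K_def[symmetric] spK)
    show "\<psi> h \<in> ?P \<rightarrow> ?P" using psi_mem that by blast
    fix B assume "B \<in> c ` ?C"
    then obtain g where g: "g \<in> ?C" "B = c g" by auto
    have "\<psi> h -` B \<inter> ?P = c (inv h \<otimes>\<^bsub>G\<^esub> g)"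
      using g that psi_mem[OF that] psi_mem_iff[OF that _ g(1)] by (auto simp: c_def)
    then show "\<psi> h -` B \<inter> ?P \<in> sets K"
      using g that unfolding stK by (auto intro: sigma_sets.Basic)
  qed
  have equivar: "T (\<phi> h e) = \<psi> h (T e)" if "h \<in> ?C" "e \<in> space M" for h e
  proof (intro Set.set_eqI iffI)
    have *: "\<phi> h e \<in> \<phi> g ` X \<longleftrightarrow> e \<in> \<phi> (inv h \<otimes>\<^bsub>G\<^esub> g) ` X" if g: "g \<in> ?C" for g
    proof -
      have k: "inv h \<otimes>\<^bsub>G\<^esub> g \<in> ?C" using g \<open>h \<in> ?C\<close> by simp
      have "\<phi> g ` X = \<phi> (h \<otimes>\<^bsub>G\<^esub> (inv h \<otimes>\<^bsub>G\<^esub> g)) ` X"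
        using g \<open>h \<in> ?C\<close> by (simp add: m_assoc[symmetric])
      also have "\<dots> = \<phi> h ` \<phi> (inv h \<otimes>\<^bsub>G\<^esub> g) ` X"
        unfolding image_image using \<open>h \<in> ?C\<close> k Xs
        by (intro image_cong) (auto intro!: composition_rule)
      finally have eq: "\<phi> g ` X = \<phi> h ` \<phi> (inv h \<otimes>\<^bsub>G\<^esub> g) ` X" .
      have "\<phi> (inv h \<otimes>\<^bsub>G\<^esub> g) ` X \<subseteq> space M" using mem[OF k] Xs by auto
      then show ?thesis unfolding eq using in_img \<open>h \<in> ?C\<close> \<open>e \<in> space M\<close> by simp
    qed
    have iff: "g \<in> T (\<phi> h e) \<longleftrightarrow> g \<in> \<psi> h (T e)" if g: "g \<in> ?C" for g
      using psi_mem_iff[OF \<open>h \<in> ?C\<close> TP g, of e] *[OF g] g \<open>h \<in> ?C\<close> by (simp add: T_def)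
    fix g
    {
      assume a: "g \<in> T (\<phi> h e)"
      then have "g \<in> ?C" by (simp add: T_def)
      then show "g \<in> \<psi> h (T e)" using iff a by simp
    next
      assume a: "g \<in> \<psi> h (T e)"
      then have "g \<in> ?C" using psi_mem[OF that(1) TP] by blast
      then show "g \<in> T (\<phi> h e)" using iff a by simp
    }
  qed
  have pull: "T -` (\<psi> h ` B) \<inter> space M = \<phi> h ` (T -` B \<inter> space M)" if h: "h \<in> ?C" and B: "B \<subseteq> ?P" for h B
  proof (intro Set.set_eqI iffI)
    fix e assume e: "e \<in> T -` (\<psi> h ` B) \<inter> space M"
    then have "\<psi> (inv h) (T e) \<in> B" using psi_img[OF h B] by auto
    then have "T (\<phi> (inv h) e) \<in> B" using equivar h e by simp
    then show "e \<in> \<phi> h ` (T -` B \<inter> space M)"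
      using inv_act(2)[OF h] mem[of "inv h" e] h e
      by (metis IntD2 IntI image_eqI inv_closed vimageI)
  next
    fix e assume "e \<in> \<phi> h ` (T -` B \<inter> space M)"
    then show "e \<in> T -` (\<psi> h ` B) \<inter> space M"
      using equivar mem h by auto
  qed
  have setsP: "B \<subseteq> ?P" if "B \<in> sets K" for B
    using that sets.sets_into_space spK by metis
  have psi_sets: "\<psi> h ` B \<in> sets K" if "h \<in> ?C" "B \<in> sets K" for h B
    using psi_img[OF that(1) setsP[OF that(2)]] measurable_sets[OF psi_meas that(2), of "inv h"] that
    by (simp add: spK)
  have act': "measure_preserving_action G N \<psi>"
    unfolding measure_preserving_action_def spN stN
  proof (intro conjI ballI psi_act psi_sets)
    fix h B assume h: "h \<in> ?C" and B: "B \<in> sets K"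
    show "emeasure N (\<psi> h ` B) = emeasure N B"
      unfolding emN[OF psi_sets[OF h B]] emN[OF B] pull[OF h setsP[OF B]]
      using mp(3)[OF h] measurable_sets[OF Tm B] by simp
  qed
  define Y where "Y = c \<one>\<^bsub>G\<^esub>"
  have Y: "Y \<in> sets K" unfolding Y_def stK by (auto intro: sigma_sets.Basic)
  have "\<phi> \<one>\<^bsub>G\<^esub> ` X = (\<lambda>x. x) ` X"
    using Xs by (intro image_cong) (auto simp flip: id_eq_one)
  then have TY: "T -` Y \<inter> space M = X"
    using Xs TP by (auto simp: Y_def c_def T_def)
  have sd: "T -` (sym_diff A B) \<inter> space M = sym_diff (T -` A \<inter> space M) (T -` B \<inter> space M)" for A B
    by blast
  have finN: "\<forall>g\<in>?C. emeasure N (sym_diff Y (\<psi> g ` Y)) < \<infinity>"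
  proof
    fix g assume g: "g \<in> ?C"
    have "sym_diff Y (\<psi> g ` Y) \<in> sets K" using Y psi_sets[OF g Y] by auto
    moreover have "T -` (sym_diff Y (\<psi> g ` Y)) \<inter> space M = sym_diff X (\<phi> g ` X)"
      unfolding sd pull[OF g setsP[OF Y]] TY by (rule refl)
    ultimately show "emeasure N (sym_diff Y (\<psi> g ` Y)) < \<infinity>" using fin g by (simp add: emN)
  qed
  have "commensurated_near_invariant TYPE('g set) G" using T by (simp add: property_T_def)
  then have "\<exists>X'\<in>sets N. (\<forall>g\<in>?C. \<psi> g ` X' = X') \<and> emeasure N (sym_diff Y X') < \<infinity>"
    by (rule commensurated_near_invariantD[OF _ act' _ finN]) (simp add: stN Y)
  then obtain Y' where Y': "Y' \<in> sets K" "\<forall>g\<in>?C. \<psi> g ` Y' = Y'" "emeasure N (sym_diff Y Y') < \<infinity>"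
    unfolding stN by blast
  let ?X' = "T -` Y' \<inter> space M"
  have "?X' \<in> sets M" using measurable_sets[OF Tm Y'(1)] .
  moreover have "\<forall>g\<in>?C. \<phi> g ` ?X' = ?X'" using pull[OF _ setsP[OF Y'(1)]] Y'(2) by auto
  moreover have "emeasure M (sym_diff X ?X') < \<infinity>"
  proof -
    have "sym_diff Y Y' \<in> sets K" using Y Y' by auto
    moreover have "T -` (sym_diff Y Y') \<inter> space M = sym_diff X ?X'" unfolding sd TY by (rule refl)
    ultimately show ?thesis using Y'(3) by (simp add: emN)
  qed
  ultimately show "\<exists>X'\<in>sets M. (\<forall>g\<in>?C. \<phi> g ` X' = X') \<and> emeasure M (sym_diff X X') < \<infinity>"
    by blast
qed


section \<open>The transformations form groups\<close>

lemma topspace_P1 [simp]: "topspace P1 = UNIV"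
  by (simp add: P1_def UNIV_option_conv)

lemma Hausdorff_P1: "Hausdorff_space P1"
  by (simp add: P1_def Hausdorff_space_Alexandroff_compactification
      Hausdorff_space_euclidean locally_compact_space_euclidean)

lemma cofin_open:
  assumes "\<forall>\<^sub>\<infinity>x. Q x"
  shows "\<forall>\<^sub>\<infinity>x. \<exists>V. openin P1 V \<and> x \<in> V \<and> (\<forall>y\<in>V. Q y)"
proof -
  have "finite {x. \<not> Q x}" using assms by (simp add: eventually_cofinite)
  then have "closedin P1 {x. \<not> Q x}"
    using Hausdorff_P1 by (metis Hausdorff_imp_t1_space subset_UNIV t1_space_closedin_finite topspace_P1)
  then have "openin P1 {x. Q x}" by (auto simp: closedin_def Compl_eq_Diff_UNIV[symmetric] Collect_neg_eq[symmetric])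
  with assms show ?thesis by (auto elim!: eventually_mono)
qed

lemma cofin_comp:
  assumes "\<forall>\<^sub>\<infinity>x. g (f x) = x" and "\<forall>\<^sub>\<infinity>y. Q y"
  shows "\<forall>\<^sub>\<infinity>x. Q (f x)"
proof -
  have "{x. \<not> Q (f x)} \<subseteq> {x. g (f x) \<noteq> x} \<union> g ` {y. \<not> Q y}" by force
  then show ?thesis using assms unfolding eventually_cofinite
    by (metis (no_types, lifting) finite_UnI finite_imageI finite_subset)
qed

lemma topcontinuous_at_comp:
  assumes "topcontinuous_at P1 P1 f x" "topcontinuous_at P1 P1 g (f x)"
  shows "topcontinuous_at P1 P1 (g \<circ> f) x"
  unfolding topcontinuous_at_def
proof (intro conjI allI impI; simp?)
  fix V assume "openin P1 V \<and> g (f x) \<in> V"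
  then obtain U where U: "openin P1 U" "f x \<in> U" "\<forall>y\<in>U. g y \<in> V"
    using assms(2) unfolding topcontinuous_at_def by blast
  then obtain W where "openin P1 W" "x \<in> W" "\<forall>y\<in>W. f y \<in> U"
    using assms(1) unfolding topcontinuous_at_def by blast
  with U show "\<exists>U. openin P1 U \<and> x \<in> U \<and> (\<forall>y\<in>U. g (f y) \<in> V)" by blast
qed

lemma cofin_continuous_comp:
  assumes "cofin_continuous f" "cofin_continuous g" "\<forall>\<^sub>\<infinity>x. k (f x) = x"
  shows "cofin_continuous (g \<circ> f)"
  using assms(1) cofin_comp[of k f, OF assms(3) assms(2)[unfolded cofin_continuous_def]]
  unfolding cofin_continuous_def
  by eventually_elim (rule topcontinuous_at_comp)

lemma PC_map_comp:
  assumes "PC_map f" "PC_map g"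
  shows "PC_map (f \<circ> g)"
proof -
  obtain f' where f': "cofin_continuous f'" "\<forall>\<^sub>\<infinity>x. f (f' x) = x" "\<forall>\<^sub>\<infinity>x. f' (f x) = x"
    using assms by (auto simp: PC_map_def)
  obtain g' where g': "cofin_continuous g'" "\<forall>\<^sub>\<infinity>x. g (g' x) = x" "\<forall>\<^sub>\<infinity>x. g' (g x) = x"
    using assms by (auto simp: PC_map_def)
  have "\<forall>\<^sub>\<infinity>x. (f \<circ> g) ((g' \<circ> f') x) = x"
    using cofin_comp[of f f', OF f'(2) g'(2)] f'(2) by eventually_elim simp
  moreover have "\<forall>\<^sub>\<infinity>x. (g' \<circ> f') ((f \<circ> g) x) = x"
    using cofin_comp[of g' g, OF g'(3) f'(3)] g'(3) by eventually_elim simp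
  moreover have "cofin_continuous (f \<circ> g)"
    using assms cofin_continuous_comp g'(3) by (auto simp: PC_map_def)
  moreover have "cofin_continuous (g' \<circ> f')"
    using f' g' cofin_continuous_comp by blast
  ultimately show ?thesis unfolding PC_map_def by blast
qed

lemma PC_map_id: "PC_map id"
proof -
  have "cofin_continuous id"
    unfolding cofin_continuous_def topcontinuous_at_def by (intro always_eventually) auto
  then show ?thesis unfolding PC_map_def by (intro conjI exI[of _ id]) auto
qed

lemma PC_inverse:
  assumes "PC_map f"
  obtains g where "PC_map g" "\<forall>\<^sub>\<infinity>x. f (g x) = x" "\<forall>\<^sub>\<infinity>x. g (f x) = x"
  using assms unfolding PC_map_def by blast

lemma equiv_PC_rel: "equiv (Collect PC_map) PC_rel"
proof (rule equivI)
  show "PC_rel \<subseteq> Collect PC_map \<times> Collect PC_map" by (auto simp: PC_rel_def)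
  show "refl_on (Collect PC_map) PC_rel" by (auto simp: refl_on_def PC_rel_def)
  show "sym PC_rel" by (auto simp: sym_def PC_rel_def eq_commute)
  show "trans PC_rel"
    by (auto simp: trans_def PC_rel_def elim: eventually_elim2)
qed

lemma congruent2_comp: "congruent2 PC_rel PC_rel (\<lambda>f g. PC_rel `` {f \<circ> g})"
proof (rule congruent2I')
  fix f f' g g' assume 1: "(f, f') \<in> PC_rel" and 2: "(g, g') \<in> PC_rel"
  obtain k where k: "\<forall>\<^sub>\<infinity>x. k (g x) = x"
    using 2 PC_inverse unfolding PC_rel_def by blast
  have "\<forall>\<^sub>\<infinity>x. f (g x) = f' (g x)"
    using cofin_comp[of k g "\<lambda>y. f y = f' y", OF k] 1 by (simp add: PC_rel_def)
  moreover have "\<forall>\<^sub>\<infinity>x. g x = g' x" using 2 by (simp add: PC_rel_def)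
  ultimately have "\<forall>\<^sub>\<infinity>x. (f \<circ> g) x = (f' \<circ> g') x" by eventually_elim simp
  then have "(f \<circ> g, f' \<circ> g') \<in> PC_rel"
    using 1 2 PC_map_comp by (auto simp: PC_rel_def)
  then show "PC_rel `` {f \<circ> g} = PC_rel `` {f' \<circ> g'}"
    by (rule equiv_class_eq[OF equiv_PC_rel])
qed

lemma carrier_PC: "X \<in> carrier PC \<longleftrightarrow> (\<exists>f. PC_map f \<and> X = PC_rel `` {f})"
  by (auto simp: PC_def quotient_def)

lemma PC_mult: "PC_map f \<Longrightarrow> PC_map g \<Longrightarrow>
    PC_rel `` {f} \<otimes>\<^bsub>PC\<^esub> PC_rel `` {g} = PC_rel `` {f \<circ> g}"
  using UN_equiv_class2[OF equiv_PC_rel equiv_PC_rel congruent2_comp] by (simp add: PC_def)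

lemma PC_one: "\<one>\<^bsub>PC\<^esub> = PC_rel `` {id}"
  by (simp add: PC_def)

lemma PC_class_eqI:
  "PC_map f \<Longrightarrow> PC_map g \<Longrightarrow> \<forall>\<^sub>\<infinity>x. f x = g x \<Longrightarrow> PC_rel `` {f} = PC_rel `` {g}"
  by (intro equiv_class_eq[OF equiv_PC_rel]) (simp add: PC_rel_def)

lemma group_PC: "group PC"
proof (rule groupI)
  show "\<one>\<^bsub>PC\<^esub> \<in> carrier PC" using PC_map_id by (auto simp: carrier_PC PC_one)
next
  fix X Y assume "X \<in> carrier PC" "Y \<in> carrier PC"
  then obtain f g where "PC_map f" "X = PC_rel `` {f}" "PC_map g" "Y = PC_rel `` {g}"
    by (auto simp: carrier_PC)
  then show "X \<otimes>\<^bsub>PC\<^esub> Y \<in> carrier PC"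
    unfolding carrier_PC by (intro exI[of _ "f \<circ> g"]) (simp add: PC_mult PC_map_comp)
next
  fix X Y Z assume "X \<in> carrier PC" "Y \<in> carrier PC" "Z \<in> carrier PC"
  then show "X \<otimes>\<^bsub>PC\<^esub> Y \<otimes>\<^bsub>PC\<^esub> Z = X \<otimes>\<^bsub>PC\<^esub> (Y \<otimes>\<^bsub>PC\<^esub> Z)"
    by (auto simp: carrier_PC PC_mult PC_map_comp o_assoc)
next
  fix X assume "X \<in> carrier PC"
  then show "\<one>\<^bsub>PC\<^esub> \<otimes>\<^bsub>PC\<^esub> X = X" by (auto simp: carrier_PC PC_mult PC_one PC_map_id)
next
  fix X assume "X \<in> carrier PC"
  then obtain f where f: "PC_map f" "X = PC_rel `` {f}" by (auto simp: carrier_PC)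
  obtain g where g: "PC_map g" "\<forall>\<^sub>\<infinity>x. g (f x) = x" using PC_inverse[OF f(1)] by blast
  have "PC_rel `` {g \<circ> f} = PC_rel `` {id}"
    using f g by (intro PC_class_eqI PC_map_comp PC_map_id) auto
  then show "\<exists>Y\<in>carrier PC. Y \<otimes>\<^bsub>PC\<^esub> X = \<one>\<^bsub>PC\<^esub>"
    using f g by (intro bexI[of _ "PC_rel `` {g}"]) (auto simp: PC_mult PC_one carrier_PC)
qed

lemma homography_comp:
  assumes "a * d - b * c \<noteq> 0" "a' * d' - b' * c' \<noteq> 0"
  shows "homography a b c d (homography a' b' c' d' x) =
    homography (a * a' + b * c') (a * b' + b * d') (c * a' + d * c') (c * b' + d * d') x"
proof (cases x)
  case None
  show ?thesis
  proof (cases "c' = 0")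
    case True
    then have "a' \<noteq> 0" using assms(2) by auto
    then show ?thesis using None True by simp
  next
    case False
    then have "c * (a' / c') + d = (c * a' + d * c') / c'" "a * (a' / c') + b = (a * a' + b * c') / c'"
      by (simp_all add: add_divide_distrib)
    then show ?thesis using None False by simp
  qed
next
  case (Some y)
  show ?thesis
  proof (cases "c' * y + d' = 0")
    case True
    then have d': "d' = - (c' * y)" by simp
    have "a' * d' - b' * c' = - c' * (a' * y + b')" by (simp add: d' algebra_simps)
    then have n: "a' * y + b' \<noteq> 0" "c' \<noteq> 0" using assms(2) by auto
    have e: "(c * a' + d * c') * y + (c * b' + d * d') = c * (a' * y + b')"
            "(a * a' + b * c') * y + (a * b' + b * d') = a * (a' * y + b')"
      by (simp_all add: d' algebra_simps)
    show ?thesis using Some True n e by auto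
  next
    case False
    have e: "(c * a' + d * c') * y + (c * b' + d * d') = c * (a' * y + b') + d * (c' * y + d')"
            "(a * a' + b * c') * y + (a * b' + b * d') = a * (a' * y + b') + b * (c' * y + d')"
      by (simp_all add: algebra_simps)
    let ?u = "a' * y + b'" and ?v = "c' * y + d'"
    have "s * (?u / ?v) + t = (s * ?u + t * ?v) / ?v" for s t
      using False by (metis add_divide_distrib nonzero_mult_div_cancel_right times_divide_eq_right)
    then show ?thesis using Some False e by simp
  qed
qed

lemma PGL2_comp:
  assumes "g \<in> PGL2" "h \<in> PGL2"
  shows "g \<circ> h \<in> PGL2"
proof -
  obtain a b c d where g: "g = homography a b c d" "a * d - b * c \<noteq> 0"
    using assms by (auto simp: PGL2_def)
  obtain a' b' c' d' where h: "h = homography a' b' c' d'" "a' * d' - b' * c' \<noteq> 0"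
    using assms by (auto simp: PGL2_def)
  have "(a * a' + b * c') * (c * b' + d * d') - (a * b' + b * d') * (c * a' + d * c')
      = (a * d - b * c) * (a' * d' - b' * c')" by (simp add: algebra_simps)
  then have "(a * a' + b * c') * (c * b' + d * d') - (a * b' + b * d') * (c * a' + d * c') \<noteq> 0"
    using g h by simp
  moreover have "g \<circ> h = homography (a * a' + b * c') (a * b' + b * d') (c * a' + d * c') (c * b' + d * d')"
    using homography_comp[OF g(2) h(2)] g h by auto
  ultimately show ?thesis unfolding PGL2_def by blast
qed

lemma homography_scalar: "s \<noteq> 0 \<Longrightarrow> homography s 0 0 s x = x"
  by (cases x) auto

lemma PGL2_id: "id \<in> PGL2"
proof -
  have "id = homography 1 0 0 1" using homography_scalar[of 1] by auto
  then show ?thesis unfolding PGL2_def by (intro CollectI exI[of _ 1] exI[of _ 0]) auto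
qed

lemma PGL2_inverse:
  assumes "g \<in> PGL2"
  obtains h where "h \<in> PGL2" "\<And>x. h (g x) = x"
proof -
  obtain a b c d where g: "g = homography a b c d" "a * d - b * c \<noteq> 0"
    using assms by (auto simp: PGL2_def)
  have n: "d * a - (- b) * (- c) \<noteq> 0" using g by (simp add: algebra_simps)
  have "homography d (- b) (- c) a (g x) = x" for x
  proof -
    have "homography d (- b) (- c) a (g x) =
        homography (a * d - b * c) 0 0 (a * d - b * c) x"
      unfolding g(1) homography_comp[OF n g(2)] by (simp add: algebra_simps)
    then show ?thesis using homography_scalar[OF g(2)] by simp
  qed
  moreover have "homography d (- b) (- c) a \<in> PGL2" unfolding PGL2_def using n by blast
  ultimately show thesis using that by blast
qed

lemma piecewise_projective_cong:
  assumes "\<forall>\<^sub>\<infinity>x. f x = f' x" "piecewise_projective f"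
  shows "piecewise_projective f'"
  using cofin_open[OF assms(1)] assms(2) unfolding piecewise_projective_def
proof eventually_elim
  case (elim x)
  then obtain V W g where "openin P1 V" "x \<in> V" "\<forall>y\<in>V. f y = f' y"
    "openin P1 W" "x \<in> W" "g \<in> PGL2" "\<forall>y\<in>W. f y = g y" by blast
  then show ?case by (intro exI[of _ "V \<inter> W"] conjI bexI[of _ g]) auto
qed

lemma piecewise_projective_comp:
  assumes "piecewise_projective f" "piecewise_projective g" "PC_map g"
  shows "piecewise_projective (f \<circ> g)"
proof -
  obtain k where k: "\<forall>\<^sub>\<infinity>x. k (g x) = x" using PC_inverse[OF assms(3)] by blast
  have c: "\<forall>\<^sub>\<infinity>x. topcontinuous_at P1 P1 g x"
    using assms(3) by (simp add: PC_map_def cofin_continuous_def)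
  show ?thesis
    using c cofin_comp[of k g, OF k assms(1)[unfolded piecewise_projective_def]] assms(2)
    unfolding piecewise_projective_def
  proof eventually_elim
    case (elim x)
    then obtain V p W q where V: "openin P1 V" "g x \<in> V" "p \<in> PGL2" "\<forall>y\<in>V. f y = p y"
      and W: "openin P1 W" "x \<in> W" "q \<in> PGL2" "\<forall>y\<in>W. g y = q y" by blast
    obtain U where "openin P1 U" "x \<in> U" "\<forall>y\<in>U. g y \<in> V"
      using elim(1) V unfolding topcontinuous_at_def by blast
    then show ?case using V W
      by (intro exI[of _ "U \<inter> W"] conjI bexI[OF _ PGL2_comp[OF V(3) W(3)]]) auto
  qed
qed

lemma piecewise_projective_inverse:
  assumes "piecewise_projective f" "PC_map g" "\<forall>\<^sub>\<infinity>x. f (g x) = x"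
  shows "piecewise_projective g"
proof -
  have c: "\<forall>\<^sub>\<infinity>x. topcontinuous_at P1 P1 g x"
    using assms(2) by (simp add: PC_map_def cofin_continuous_def)
  obtain k where k: "\<forall>\<^sub>\<infinity>x. k (g x) = x" using PC_inverse[OF assms(2)] by blast
  show ?thesis
    using c cofin_comp[of k g, OF k assms(1)[unfolded piecewise_projective_def]] cofin_open[OF assms(3)]
    unfolding piecewise_projective_def
  proof eventually_elim
    case (elim x)
    then obtain V p W where V: "openin P1 V" "g x \<in> V" "p \<in> PGL2" "\<forall>y\<in>V. f y = p y"
      and W: "openin P1 W" "x \<in> W" "\<forall>y\<in>W. f (g y) = y" by blast
    obtain U where U: "openin P1 U" "x \<in> U" "\<forall>y\<in>U. g y \<in> V"
      using elim(1) V unfolding topcontinuous_at_def by blast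
    obtain q where q: "q \<in> PGL2" "\<And>x. q (p x) = x" using PGL2_inverse[OF V(3)] by blast
    have "g y = q y" if "y \<in> U \<inter> W" for y
      using that U V W q by (metis IntE)
    then show ?case using U W q by (intro exI[of _ "U \<inter> W"] conjI bexI[OF _ q(1)]) auto
  qed
qed

lemma carrier_PC_Proj:
  "X \<in> carrier PC_Proj \<longleftrightarrow> (\<exists>f. PC_map f \<and> piecewise_projective f \<and> X = PC_rel `` {f})"
proof
  assume "X \<in> carrier PC_Proj"
  then obtain f h where "PC_map h" "X = PC_rel `` {h}" "f \<in> X" "piecewise_projective f"
    by (auto simp: PC_Proj_def carrier_PC)
  then show "\<exists>f. PC_map f \<and> piecewise_projective f \<and> X = PC_rel `` {f}"
    using equiv_class_eq[OF equiv_PC_rel, of h f] by (intro exI[of _ f]) (auto simp: PC_rel_def)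
next
  assume "\<exists>f. PC_map f \<and> piecewise_projective f \<and> X = PC_rel `` {f}"
  then show "X \<in> carrier PC_Proj"
    using equiv_class_self[OF equiv_PC_rel] by (auto simp: PC_Proj_def carrier_PC)
qed

lemma subgroup_PC_Proj: "subgroup (carrier PC_Proj) PC"
proof (rule group.subgroupI[OF group_PC])
  show "carrier PC_Proj \<subseteq> carrier PC" by (auto simp: PC_Proj_def)
  have "piecewise_projective id"
    unfolding piecewise_projective_def
    using openin_topspace[of P1]
    by (intro always_eventually allI exI[of _ UNIV] conjI bexI[OF _ PGL2_id]) auto
  then show "carrier PC_Proj \<noteq> {}" using PC_map_id carrier_PC_Proj by blast
next
  fix X assume "X \<in> carrier PC_Proj"
  then obtain f where f: "PC_map f" "piecewise_projective f" "X = PC_rel `` {f}"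
    by (auto simp: carrier_PC_Proj)
  obtain g where g: "PC_map g" "\<forall>\<^sub>\<infinity>x. f (g x) = x" "\<forall>\<^sub>\<infinity>x. g (f x) = x"
    using PC_inverse[OF f(1)] .
  have "PC_rel `` {g \<circ> f} = PC_rel `` {id}"
    using f g by (intro PC_class_eqI PC_map_comp PC_map_id) auto
  then have "inv\<^bsub>PC\<^esub> X = PC_rel `` {g}"
    using f g by (intro group.inv_equality[OF group_PC]) (auto simp: PC_mult PC_one carrier_PC)
  then show "inv\<^bsub>PC\<^esub> X \<in> carrier PC_Proj"
    using piecewise_projective_inverse[OF f(2) g(1,2)] g by (auto simp: carrier_PC_Proj)
next
  fix X Y assume "X \<in> carrier PC_Proj" "Y \<in> carrier PC_Proj"
  then show "X \<otimes>\<^bsub>PC\<^esub> Y \<in> carrier PC_Proj"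
    using piecewise_projective_comp PC_map_comp by (fastforce simp: carrier_PC_Proj PC_mult)
qed

lemma group_PC_Proj: "group PC_Proj"
  using subgroup.subgroup_is_group[OF subgroup_PC_Proj group_PC] by (simp add: PC_Proj_def)

end

theory Submission
  imports Defs "HOL-Algebra.Generated_Groups" "HOL-Real_Asymp.Real_Asymp"
begin

text \<open>Let \<open>\<Gamma>\<close> be a group of piecewise projective transformations with Property T. The idea is
  to change the way in which the projective line is glued together from intervals, so that
  \<open>\<Gamma>\<close> preserves the new projective structure, and then to show that a group with Property T
  acts on a one-dimensional projective manifold through a finite group.

  An element \<open>g\<close> of \<open>\<Gamma>\<close> permutes the one-sided points (sides) of the projective line, and next
  to a side \<open>p\<close> it agrees with one homography \<open>c g p\<close>. A gluing of sides is a triple \<open>(p, q, h)\<close>,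
  where \<open>h\<close> says how a projective chart continues from \<open>p\<close> to \<open>q\<close>. The standard
  gluings, of the two sides of one point by the identity, are moved to standard ones by \<open>g\<close> with
  finitely many exceptions, the breakpoints. By Property T for the counting measure, some
  \<open>\<Gamma>\<close>-invariant set of gluings differs from the standard one by a finite set; discarding
  ambiguous gluings leaves an invariant partial matching \<open>R\<close> of the sides
  (\<open>invariant_matching\<close>). So \<open>\<Gamma>\<close> acts by projective automorphisms on the manifold that
  \<open>R\<close> defines. Its components are obtained by cutting the line at the finitely many points where
  \<open>R\<close> is not standard and joining the intervals along \<open>R\<close> (\<open>unbranched_atlas\<close>). Each component is
  a chain or a cycle of intervals, so its holonomy group is generated by one homography
  \<open>\<tau>\<close> (\<open>holonomy_exists\<close>).

  The stabilizer of a component has finite index, so it has Property T as well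
  (\<open>property_T_stabilizer\<close>). In the charts of the component its elements are homographies
  \<open>\<delta> g p\<close> that normalize the holonomy group and that depend on \<open>p\<close> only modulo it. On a
  further subgroup of finite index all these homographies commute:
  if \<open>\<tau>\<close> is not the identity, because the normalizer of a nontrivial cyclic subgroup of the
  projective linear group has an abelian subgroup of finite index
  (\<open>finite_orbit_nontrivial_holonomy\<close>); if it is, because \<open>\<delta>\<close> is then a
  homomorphism, Property T forbids hyperbolic elements in its image
  (\<open>property_T_no_hyperbolic\<close>: the half-planes of the hyperbolic plane form a measure space in which
  those that contain a given point are commensurated), and a group of orientation-preserving
  homographies without hyperbolic elements is abelian (\<open>no_hyperbolic_commute\<close>).

  Commuting chart expressions let the orbit of a germ grow only polynomially with the word
  length, and Property T makes such orbits finite, because they contain Foelner sets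
  (\<open>property_T_finite_orbit_of_commuting_cocycle\<close>). So the orbit of one germ in each component is
  finite. An element fixing a germ in each of the finitely many components is the identity, hence
  \<open>\<Gamma>\<close> is finite.\<close>

section \<open>Actions of groups with Property T\<close>

lemma property_TD: "property_T G \<Longrightarrow> group G" "property_T G \<Longrightarrow> countable (carrier G)"
  by (simp_all add: property_T_def)

text \<open>Unlike \<^term>\<open>group_action\<close>, this does not constrain the values of the action outside of
  \<open>S\<close>, so that actions can be given by formulas.\<close>

definition acts_on :: "('g, 'm) monoid_scheme \<Rightarrow> 'e set \<Rightarrow> ('g \<Rightarrow> 'e \<Rightarrow> 'e) \<Rightarrow> bool"
  where "acts_on G S act \<longleftrightarrow> (\<forall>g\<in>carrier G. \<forall>x\<in>S. act g x \<in> S) \<and> (\<forall>x\<in>S. act \<one>\<^bsub>G\<^esub> x = x) \<and>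
    (\<forall>g\<in>carrier G. \<forall>h\<in>carrier G. \<forall>x\<in>S. act (g \<otimes>\<^bsub>G\<^esub> h) x = act g (act h x))"

lemma acts_onI:
  assumes "\<And>g x. g \<in> carrier G \<Longrightarrow> x \<in> S \<Longrightarrow> act g x \<in> S"
    and "\<And>x. x \<in> S \<Longrightarrow> act \<one>\<^bsub>G\<^esub> x = x"
    and "\<And>g h x. g \<in> carrier G \<Longrightarrow> h \<in> carrier G \<Longrightarrow> x \<in> S \<Longrightarrow> act (g \<otimes>\<^bsub>G\<^esub> h) x = act g (act h x)"
  shows "acts_on G S act"
  using assms by (simp add: acts_on_def)

lemma acts_onD:
  assumes "acts_on G S act"
  shows "\<And>g x. g \<in> carrier G \<Longrightarrow> x \<in> S \<Longrightarrow> act g x \<in> S"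
    and "\<And>x. x \<in> S \<Longrightarrow> act \<one>\<^bsub>G\<^esub> x = x"
    and "\<And>g h x. g \<in> carrier G \<Longrightarrow> h \<in> carrier G \<Longrightarrow> x \<in> S \<Longrightarrow> act (g \<otimes>\<^bsub>G\<^esub> h) x = act g (act h x)"
  using assms by (simp_all add: acts_on_def)

lemma acts_on_inv:
  assumes "group G" "acts_on G S act" "g \<in> carrier G" "x \<in> S"
  shows "act (inv\<^bsub>G\<^esub> g) (act g x) = x" "act g (act (inv\<^bsub>G\<^esub> g) x) = x"
proof -
  interpret group G by fact
  show "act (inv\<^bsub>G\<^esub> g) (act g x) = x" "act g (act (inv\<^bsub>G\<^esub> g) x) = x"
    using acts_onD[OF assms(2)] assms(3,4) by (metis inv_closed l_inv r_inv)+
qed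

lemma acts_on_bij:
  assumes "group G" "acts_on G S act" "g \<in> carrier G"
  shows "bij_betw (act g) S S"
  by (rule bij_betw_byWitness[where f' = "act (inv\<^bsub>G\<^esub> g)"])
    (use assms acts_on_inv[OF assms(1,2)] acts_onD(1)[OF assms(2)] group.inv_closed[OF assms(1)] in auto)

lemma acts_on_inj:
  assumes "group G" "acts_on G S act" "g \<in> carrier G"
  shows "inj_on (act g) S"
  using acts_on_bij[OF assms] by (simp add: bij_betw_def)

lemma acts_on_image_inv:
  assumes "group G" "acts_on G S act" "g \<in> carrier G" "A \<subseteq> S"
  shows "act (inv\<^bsub>G\<^esub> g) ` act g ` A = A" "act g ` act (inv\<^bsub>G\<^esub> g) ` A = A"
  using acts_on_inv[OF assms(1-3)] assms(4) by (force simp: image_image)+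

lemma acts_on_image_mult:
  assumes "acts_on G S act" "g \<in> carrier G" "h \<in> carrier G" "A \<subseteq> S"
  shows "act (g \<otimes>\<^bsub>G\<^esub> h) ` A = act g ` act h ` A"
  using acts_onD(3)[OF assms(1-3)] assms(4) by (force simp: image_image)

lemma acts_on_image_one:
  assumes "acts_on G S act" "A \<subseteq> S"
  shows "act \<one>\<^bsub>G\<^esub> ` A = A"
proof -
  have "act \<one>\<^bsub>G\<^esub> ` A = (\<lambda>x. x) ` A" using acts_onD(2)[OF assms(1)] assms(2) by (intro image_cong) auto
  then show ?thesis by simp
qed

lemma acts_on_image_sym_diff:
  assumes "group G" "acts_on G S act" "g \<in> carrier G" "A \<subseteq> S" "B \<subseteq> S"
  shows "act g ` sym_diff A B = sym_diff (act g ` A) (act g ` B)"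
proof -
  note inj = acts_on_inj[OF assms(1-3)]
  have "act g ` (A - B) = act g ` A - act g ` B" "act g ` (B - A) = act g ` B - act g ` A"
    using assms(4,5) by (auto intro!: inj_on_image_set_diff[OF inj])
  then show ?thesis by (simp add: image_Un)
qed

lemma acts_on_subgroup:
  assumes "acts_on G S act" "subgroup H G"
  shows "acts_on (G\<lparr>carrier := H\<rparr>) S act"
  using assms unfolding acts_on_def by (auto simp: subgroup.mem_carrier)

lemma group_action_restrict:
  assumes "group G" "acts_on G S act"
  shows "group_action G S (\<lambda>g. restrict (act g) S)"
  unfolding group_action_def group_hom_def group_hom_axioms_def
proof (intro conjI assms(1) group_BijGroup)
  note D = acts_onD[OF assms(2)]
  interpret group G by fact
  have B: "restrict (act g) S \<in> Bij S" if "g \<in> carrier G" for g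
    using acts_on_bij[OF assms that] by (auto simp: Bij_def bij_betw_restrict_eq)
  show "(\<lambda>g. restrict (act g) S) \<in> hom G (BijGroup S)"
  proof (rule homI)
    fix g h assume gh: "g \<in> carrier G" "h \<in> carrier G"
    have "restrict (act (g \<otimes>\<^bsub>G\<^esub> h)) S = compose S (restrict (act g) S) (restrict (act h) S)"
      using gh D by (auto simp: compose_def restrict_def fun_eq_iff)
    then show "restrict (act (g \<otimes>\<^bsub>G\<^esub> h)) S = restrict (act g) S \<otimes>\<^bsub>BijGroup S\<^esub> restrict (act h) S"
      using B gh by (simp add: BijGroup_def)
  qed (simp add: BijGroup_def B)
qed

lemma property_T_invariant_set:
  fixes M :: "'e measure"
  assumes T: "property_T G" and act: "acts_on G (space M) act"
    and mp: "\<And>g A. g \<in> carrier G \<Longrightarrow> A \<in> sets M \<Longrightarrow> act g ` A \<in> sets M"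
            "\<And>g A. g \<in> carrier G \<Longrightarrow> A \<in> sets M \<Longrightarrow> emeasure M (act g ` A) = emeasure M A"
    and X: "X \<in> sets M"
    and fin: "\<And>g. g \<in> carrier G \<Longrightarrow> emeasure M (sym_diff X (act g ` X)) < \<infinity>"
  obtains Y where "Y \<in> sets M" "\<And>g. g \<in> carrier G \<Longrightarrow> act g ` Y = Y" "emeasure M (sym_diff X Y) < \<infinity>"
proof -
  let ?\<phi> = "\<lambda>g. restrict (act g) (space M)"
  have im: "?\<phi> g ` A = act g ` A" if "A \<in> sets M" for g A
    using sets.sets_into_space[OF that] by auto
  have "measure_preserving_action G M ?\<phi>"
    unfolding measure_preserving_action_def
    using group_action_restrict[OF property_TD(1)[OF T] act] mp im by auto
  from commensurated_near_invariantD[OF property_T_all_measure_spaces[OF T] this X]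
  obtain Y where "Y \<in> sets M" "\<forall>g\<in>carrier G. ?\<phi> g ` Y = Y" "emeasure M (sym_diff X Y) < \<infinity>"
    using fin im X by auto
  then show thesis using that im by auto
qed

text \<open>Property T for the counting measure. It is enough that \<open>act g ` X\<close> exceeds \<open>X\<close> by a finite
  set for each \<open>g\<close>: what \<open>X\<close> has in excess of \<open>act g ` X\<close> is the image of what the inverse
  of \<open>g\<close> adds to \<open>X\<close>.\<close>

lemma property_T_transfixes:
  assumes T: "property_T G" and act: "acts_on G S act" and X: "X \<subseteq> S"
    and fin: "\<And>g. g \<in> carrier G \<Longrightarrow> finite (act g ` X - X)"
  obtains Y where "Y \<subseteq> S" "\<And>g. g \<in> carrier G \<Longrightarrow> act g ` Y = Y" "finite (sym_diff X Y)"
proof -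
  interpret group G by (rule property_TD(1)[OF T])
  have fin2: "finite (sym_diff X (act g ` X))" if g: "g \<in> carrier G" for g
  proof -
    have "X - act g ` X \<subseteq> act g ` (act (inv\<^bsub>G\<^esub> g) ` X - X)"
      using acts_on_image_inv(2)[OF is_group act g X] by blast
    then have "finite (X - act g ` X)" using fin[OF inv_closed[OF g]] by (meson finite_imageI finite_subset)
    then show ?thesis using fin[OF g] by simp
  qed
  have sub: "act g ` A \<subseteq> S" if "g \<in> carrier G" "A \<subseteq> S" for g A
    using acts_onD(1)[OF act] that by blast
  obtain Y where "Y \<in> sets (count_space S)" "\<And>g. g \<in> carrier G \<Longrightarrow> act g ` Y = Y"
      "emeasure (count_space S) (sym_diff X Y) < \<infinity>"
  proof (rule property_T_invariant_set[OF T, of "count_space S" act X])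
    show "emeasure (count_space S) (act g ` A) = emeasure (count_space S) A"
      if "g \<in> carrier G" "A \<in> sets (count_space S)" for g A
      using that sub acts_on_inj[OF is_group act that(1)]
      by (simp add: emeasure_count_space inj_on_subset card_image finite_image_iff)
    show "emeasure (count_space S) (sym_diff X (act g ` X)) < \<infinity>" if "g \<in> carrier G" for g
      using fin2[OF that] sub[OF that X] X by (subst emeasure_count_space_finite) (auto simp: of_nat_less_top)
  qed (use act X sub in auto)
  moreover from this have "finite (sym_diff X Y)"
    using X by (subst (asm) emeasure_count_space) (auto split: if_splits simp: Un_subset_iff Diff_subset_conv)
  ultimately show thesis using that by auto
qed

text \<open>The group is the union of an increasing sequence of finitely generated subgroups \<open>K n\<close>.
  In the disjoint union of the coset spaces, the set of all the base points \<open>K n\<close> is commensurated,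
  since an element lies in \<open>K n\<close> for large \<open>n\<close>. An invariant set near it contains \<open>K n\<close>, hence all its
  translates, and no other coset, once \<open>n\<close> is large: then \<open>K n\<close> is the whole group.\<close>

lemma property_T_finitely_generated:
  assumes T: "property_T G"
  obtains S where "finite S" "S \<subseteq> carrier G" "generate G S = carrier G"
proof -
  interpret group G by (rule property_TD(1)[OF T])
  define e where "e = from_nat_into (carrier G)"
  have e: "range e = carrier G"
    unfolding e_def using property_TD(2)[OF T] by (intro range_from_nat_into) auto
  define K where "K n = generate G (e ` {..<n})" for n
  have eC: "e ` {..<n} \<subseteq> carrier G" for n using e by auto
  have K: "subgroup (K n) G" for n unfolding K_def using eC by (rule generate_is_subgroup)
  have Kmem: "e i \<in> K n" if "i < n" for i n unfolding K_def using that by (auto intro: generate.incl)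
  let ?S = "(UNIV :: nat set) \<times> Pow (carrier G)"
  let ?act = "\<lambda>g (n::nat, A). (n, (\<lambda>x. g \<otimes>\<^bsub>G\<^esub> x) ` A)"
  let ?X = "range (\<lambda>n. (n, K n))"
  have act: "acts_on G ?S ?act"
  proof (rule acts_onI)
    show "?act \<one>\<^bsub>G\<^esub> x = x" if "x \<in> ?S" for x
    proof (cases x)
      case (Pair n A)
      have "(\<lambda>x. \<one>\<^bsub>G\<^esub> \<otimes>\<^bsub>G\<^esub> x) ` A = (\<lambda>x. x) ` A" using that Pair by (intro image_cong) auto
      then show ?thesis by (simp add: Pair)
    qed
    show "?act (g \<otimes>\<^bsub>G\<^esub> h) x = ?act g (?act h x)" if "g \<in> carrier G" "h \<in> carrier G" "x \<in> ?S" for g h x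
    proof (cases x)
      case (Pair n A)
      have "(\<lambda>x. (g \<otimes>\<^bsub>G\<^esub> h) \<otimes>\<^bsub>G\<^esub> x) ` A = (\<lambda>x. g \<otimes>\<^bsub>G\<^esub> (h \<otimes>\<^bsub>G\<^esub> x)) ` A" 
        using that Pair by (intro image_cong) (auto simp: m_assoc)
      then show ?thesis by (simp add: Pair image_image)
    qed
  qed auto
  have XS: "?X \<subseteq> ?S" using K subgroup.subset by blast
  have coset: "(\<lambda>x. g \<otimes>\<^bsub>G\<^esub> x) ` K n = K n" if "g \<in> K n" for g n
  proof
    interpret Kn: subgroup "K n" G by (rule K)
    show "(\<lambda>x. g \<otimes>\<^bsub>G\<^esub> x) ` K n \<subseteq> K n" using that by auto
    show "K n \<subseteq> (\<lambda>x. g \<otimes>\<^bsub>G\<^esub> x) ` K n"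
    proof
      fix k assume "k \<in> K n"
      then have "k = g \<otimes>\<^bsub>G\<^esub> (inv\<^bsub>G\<^esub> g \<otimes>\<^bsub>G\<^esub> k)" "inv\<^bsub>G\<^esub> g \<otimes>\<^bsub>G\<^esub> k \<in> K n"
        using that by (simp_all flip: m_assoc)
      then show "k \<in> (\<lambda>x. g \<otimes>\<^bsub>G\<^esub> x) ` K n" by blast
    qed
  qed
  have fin: "finite (?act g ` ?X - ?X)" if "g \<in> carrier G" for g
  proof -
    obtain i where i: "g = e i" using \<open>g \<in> carrier G\<close> e by auto
    have "?act g ` ?X - ?X \<subseteq> (\<lambda>n. ?act g (n, K n)) ` {..i}"
    proof
      fix x assume x: "x \<in> ?act g ` ?X - ?X"
      then obtain n where n: "x = ?act g (n, K n)" by auto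
      have "n \<le> i"
      proof (rule ccontr)
        assume "\<not> n \<le> i"
        then have "x = (n, K n)" using n i coset[OF Kmem[of i n]] by simp
        then show False using x by auto
      qed
      then show "x \<in> (\<lambda>n. ?act g (n, K n)) ` {..i}" using n by blast
    qed
    then show ?thesis by (rule finite_subset) simp
  qed
  obtain Y where Y: "Y \<subseteq> ?S" "\<And>g. g \<in> carrier G \<Longrightarrow> ?act g ` Y = Y" "finite (sym_diff ?X Y)"
    using property_T_transfixes[OF T act XS fin] by blast
  obtain n where n: "n \<notin> fst ` (sym_diff ?X Y)"
    using Y(3) infinite_UNIV_nat by (metis ex_new_if_finite finite_imageI)
  have "(n, K n) \<in> Y" using n by force
  have "K n = carrier G"
  proof
    show "carrier G \<subseteq> K n"
    proof
      fix g assume g: "g \<in> carrier G"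
      then have "?act g (n, K n) \<in> Y" using Y(2)[OF g] \<open>(n, K n) \<in> Y\<close> by blast
      then have "?act g (n, K n) \<in> ?X" using n by force
      then have "(\<lambda>x. g \<otimes>\<^bsub>G\<^esub> x) ` K n = K n" by auto
      moreover have "g \<in> (\<lambda>x. g \<otimes>\<^bsub>G\<^esub> x) ` K n"
        using subgroup.one_closed[OF K] g by (metis image_eqI r_one)
      ultimately show "g \<in> K n" by simp
    qed
  qed (use K subgroup.subset in blast)
  then show thesis using that[of "e ` {..<n}"] eC by (simp add: K_def)
qed

section \<open>Inheritance by subgroups of finite index\<close>

definition slice :: "'w \<Rightarrow> ('w \<times> 'e) set \<Rightarrow> 'e set"
  where "slice w A = {e. (w, e) \<in> A}"

text \<open>The disjoint union of copies of a measure space. A product with a counting measure would need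
  \<open>M\<close> to be \<open>\<sigma>\<close>-finite.\<close>

definition copies :: "'w set \<Rightarrow> 'e measure \<Rightarrow> ('w \<times> 'e) measure"
  where "copies W M = measure_of (W \<times> space M)
     {A. A \<subseteq> W \<times> space M \<and> (\<forall>w\<in>W. slice w A \<in> sets M)} (\<lambda>A. \<Sum>w\<in>W. emeasure M (slice w A))"

lemma sigma_algebra_copies:
  "sigma_algebra (W \<times> space M) {A. A \<subseteq> W \<times> space M \<and> (\<forall>w\<in>W. slice w A \<in> sets M)}"
  unfolding sigma_algebra_iff2
proof (safe)
  fix w :: 'a show "slice w {} \<in> sets M" by (simp add: slice_def)
next
  fix A w assume "\<forall>w\<in>W. slice w A \<in> sets M" "w \<in> W"
  moreover have "slice w (W \<times> space M - A) = space M - slice w A" using \<open>w \<in> W\<close> by (auto simp: slice_def)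
  ultimately show "slice w (W \<times> space M - A) \<in> sets M" by auto
next
  fix A :: "nat \<Rightarrow> ('a \<times> 'b) set" and w
  assume A: "range A \<subseteq> {A. A \<subseteq> W \<times> space M \<and> (\<forall>w\<in>W. slice w A \<in> sets M)}" "w \<in> W"
  have "slice w (\<Union> (range A)) = (\<Union>i. slice w (A i))" by (auto simp: slice_def)
  then show "slice w (\<Union> (range A)) \<in> sets M" using A by (auto simp: image_subset_iff)
qed auto

lemma space_copies: "space (copies W M) = W \<times> space M"
  unfolding copies_def by (rule space_measure_of) auto

lemma sets_copies: "A \<in> sets (copies W M) \<longleftrightarrow> A \<subseteq> W \<times> space M \<and> (\<forall>w\<in>W. slice w A \<in> sets M)"
  unfolding copies_def
  by (subst sets_measure_of) (auto simp: sigma_algebra.sigma_sets_eq[OF sigma_algebra_copies])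

lemma emeasure_copies:
  assumes "A \<in> sets (copies W M)"
  shows "emeasure (copies W M) A = (\<Sum>w\<in>W. emeasure M (slice w A))"
proof (rule emeasure_measure_of[OF copies_def])
  show "countably_additive (sets (copies W M)) (\<lambda>A. \<Sum>w\<in>W. emeasure M (slice w A))"
  proof (rule countably_additiveI)
    fix A :: "nat \<Rightarrow> ('a \<times> 'b) set"
    assume A: "range A \<subseteq> sets (copies W M)" "disjoint_family A"
    have "(\<Sum>i. emeasure M (slice w (A i))) = emeasure M (slice w (\<Union> (range A)))" if "w \<in> W" for w
    proof -
      have "slice w (\<Union> (range A)) = (\<Union>i. slice w (A i))" by (auto simp: slice_def)
      moreover have "range (\<lambda>i. slice w (A i)) \<subseteq> sets M" using A(1) that by (auto simp: sets_copies)
      moreover have "disjoint_family (\<lambda>i. slice w (A i))"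
        using A(2) by (fastforce simp: disjoint_family_on_def slice_def)
      ultimately show ?thesis by (simp add: suminf_emeasure)
    qed
    then show "(\<Sum>i. \<Sum>w\<in>W. emeasure M (slice w (A i))) = (\<Sum>w\<in>W. emeasure M (slice w (\<Union> (range A))))"
      by (simp add: suminf_sum)
  qed
qed (use assms in \<open>auto simp: positive_def slice_def sets_copies\<close>)

text \<open>The stabilizer of a point with a finite orbit \<open>W\<close> is a general subgroup of finite index.
  An action of it on \<open>M\<close> induces one of the whole group on \<open>W\<close> copies of \<open>M\<close>, through the
  cocycle \<open>c g w\<close> of a transversal \<open>s\<close>. A commensurated set \<open>X\<close> gives the commensurated set of the
  copies of \<open>X\<close>, and an invariant set near that restricts to one near \<open>X\<close> in the copy
  of the base point.\<close>

proposition property_T_stabilizer: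
  fixes G :: "('g, 'm) monoid_scheme" (structure)
  assumes T: "property_T G" and act: "acts_on G Z act" and z: "z \<in> Z"
    and fin: "finite ((\<lambda>g. act g z) ` carrier G)"
  shows "property_T (G\<lparr>carrier := {g \<in> carrier G. act g z = z}\<rparr>)"
proof -
  interpret group G by (rule property_TD(1)[OF T])
  note D = acts_onD[OF act]
  define H where "H = {g \<in> carrier G. act g z = z}"
  define W where "W = (\<lambda>g. act g z) ` carrier G"
  let ?H = "G\<lparr>carrier := H\<rparr>"
  have sub: "subgroup H G"
    unfolding H_def using z D acts_on_inv[OF is_group act _ z]
    by (intro subgroupI) (auto, metis)
  interpret gH: group ?H by (rule subgroup.subgroup_is_group[OF sub is_group])
  have HC: "H \<subseteq> carrier G" by (auto simp: H_def)
  have fW: "finite W" using fin by (simp add: W_def)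
  have zW: "z \<in> W" unfolding W_def using D(2)[OF z] by (metis image_eqI one_closed)
  have WZ: "W \<subseteq> Z" using D(1) z by (auto simp: W_def)
  have aW: "act g w \<in> W" if "g \<in> carrier G" "w \<in> W" for g w
    using that D(3)[OF that(1) _ z] unfolding W_def by (auto simp: image_iff) (metis m_closed)
  have actW: "acts_on G W act" using D WZ aW by (intro acts_onI) auto
  \<comment> \<open>The transversal takes the value \<open>\<one>\<close> at the base point, where the induced action
    therefore restricts to the given one (see \<open>c_z\<close> below).\<close>
  define s where "s w = (if w = z then \<one> else SOME g. g \<in> carrier G \<and> act g z = w)" for w
  have s: "s w \<in> carrier G" "act (s w) z = w" if "w \<in> W" for w
  proof -
    have "\<exists>g. g \<in> carrier G \<and> act g z = w" using that by (auto simp: W_def)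
    from someI_ex[OF this] show "s w \<in> carrier G" "act (s w) z = w" using D(2)[OF z] by (auto simp: s_def)
  qed
  define c where "c g w = inv (s (act g w)) \<otimes> g \<otimes> s w" for g w
  have cH: "c g w \<in> H" if g: "g \<in> carrier G" and w: "w \<in> W" for g w
  proof -
    have "act (c g w) z = act (inv (s (act g w))) (act g (act (s w) z))"
      unfolding c_def using g w s aW z D by (simp add: m_assoc)
    also have "\<dots> = act (inv (s (act g w))) (act (s (act g w)) z)"
      using g w s aW by simp
    also have "\<dots> = z" using acts_on_inv(1)[OF is_group act s(1)[OF aW[OF g w]] z] .
    finally show ?thesis using g w s aW by (simp add: H_def c_def)
  qed
  have c_mult: "c (g \<otimes> h) w = c g (act h w) \<otimes> c h w" if "g \<in> carrier G" "h \<in> carrier G" "w \<in> W" for g h w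
  proof -
    have [simp]: "act (g \<otimes> h) w = act g (act h w)" using that WZ D(3) by auto
    have [simp]: "s (act h w) \<in> carrier G" "s (act g (act h w)) \<in> carrier G" "s w \<in> carrier G"
      using that s aW by auto
    have "s (act h w) \<otimes> (inv (s (act h w)) \<otimes> (h \<otimes> s w)) = h \<otimes> s w"
      using that by (simp flip: m_assoc)
    then show ?thesis unfolding c_def using that by (simp add: m_assoc)
  qed
  have c_one: "c \<one> w = \<one>" if "w \<in> W" for w
    using that D(2) WZ s by (auto simp: c_def)
  have c_z: "c h z = h" if "h \<in> H" for h
    using that HC by (auto simp: c_def s_def H_def)
  show ?thesis
    unfolding property_T_def H_def[symmetric]
  proof (intro conjI gH.is_group)
    show "countable (carrier ?H)" using property_TD(2)[OF T] HC by (auto intro: countable_subset)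
    show "commensurated_near_invariant TYPE('g set) ?H"
      unfolding commensurated_near_invariant_def
    proof (intro allI impI, elim conjE)
      fix M :: "'g set measure" and \<phi> X
      assume mpa: "measure_preserving_action ?H M \<phi>" and X: "X \<in> sets M"
        and finX: "\<forall>g\<in>carrier ?H. emeasure M (sym_diff X (\<phi> g ` X)) < \<infinity>"
      note mp = measure_preserving_actionD[OF mpa]
      interpret group_action ?H "space M" \<phi> by (fact mp(1))
      have \<phi>act: "acts_on ?H (space M) \<phi>"
      proof (rule acts_onI)
        show "\<phi> g x \<in> space M" if "g \<in> carrier ?H" "x \<in> space M" for g x
          using surj_prop[OF that(1)] that(2) by blast
        show "\<phi> \<one>\<^bsub>?H\<^esub> x = x" if "x \<in> space M" for x
          using id_eq_one that by (metis restrict_apply')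
        show "\<phi> (g \<otimes>\<^bsub>?H\<^esub> h) x = \<phi> g (\<phi> h x)" if "g \<in> carrier ?H" "h \<in> carrier ?H" "x \<in> space M" for g h x
          using composition_rule[OF that(3,1,2)] .
      qed
      note E = acts_onD[OF \<phi>act, simplified]
      let ?N = "copies W M"
      define ia where "ia g p = (act g (fst p), \<phi> (c g (fst p)) (snd p))" for g p
      have ia: "acts_on G (space ?N) ia"
      proof (rule acts_onI)
        show "ia g p \<in> space ?N" if "g \<in> carrier G" "p \<in> space ?N" for g p
          using that aW E(1) cH by (auto simp: ia_def space_copies)
        show "ia \<one> p = p" if "p \<in> space ?N" for p
          using that acts_onD(2)[OF actW] E(2) c_one by (auto simp: ia_def space_copies)
        show "ia (g \<otimes> h) p = ia g (ia h p)" if "g \<in> carrier G" "h \<in> carrier G" "p \<in> space ?N" for g h p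
          using that acts_onD(3)[OF actW] E(3) c_mult cH aW by (auto simp: ia_def space_copies)
      qed
      have sl: "slice (act g w) (ia g ` A) = \<phi> (c g w) ` slice w A"
        if "g \<in> carrier G" "w \<in> W" "A \<in> sets ?N" for g w A
      proof -
        have "w' = w" if "(w', e) \<in> A" "act g w' = act g w" for w' e
          using that acts_on_inj[OF is_group actW \<open>g \<in> carrier G\<close>] \<open>w \<in> W\<close> \<open>A \<in> sets ?N\<close>
          by (auto simp: sets_copies inj_on_def)
        then show ?thesis by (force simp: slice_def ia_def image_iff)
      qed
      have slM: "slice w A \<in> sets M" if "w \<in> W" "A \<in> sets ?N" for w A
        using that by (simp add: sets_copies)
      have bij: "bij_betw (act g) W W" if "g \<in> carrier G" for g
        using acts_on_bij[OF is_group actW that] .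
      have iaN: "ia g ` A \<in> sets ?N" if g: "g \<in> carrier G" and A: "A \<in> sets ?N" for g A
        unfolding sets_copies
      proof (intro conjI ballI)
        show "ia g ` A \<subseteq> W \<times> space M"
          using acts_onD(1)[OF ia g] sets.sets_into_space[OF A] unfolding space_copies by blast
        fix v assume "v \<in> W"
        then obtain w where w: "w \<in> W" "v = act g w" using bij[OF g] by (auto simp: bij_betw_def)
        then show "slice v (ia g ` A) \<in> sets M"
          using sl[OF g w(1) A] mp(2)[OF _ slM[OF w(1) A]] cH[OF g w(1)] by simp
      qed
      have emN: "emeasure ?N (ia g ` A) = emeasure ?N A" if g: "g \<in> carrier G" and A: "A \<in> sets ?N" for g A
      proof -
        have "emeasure ?N (ia g ` A) = (\<Sum>w\<in>W. emeasure M (slice (act g w) (ia g ` A)))"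
          unfolding emeasure_copies[OF iaN[OF g A]]
          by (rule sum.reindex_bij_betw[OF bij[OF g], symmetric])
        also have "\<dots> = (\<Sum>w\<in>W. emeasure M (slice w A))"
          using sl[OF g _ A] mp(3) slM[OF _ A] cH[OF g] by (intro sum.cong) auto
        finally show ?thesis by (simp add: emeasure_copies[OF A])
      qed
      have slice_prod: "slice w (W \<times> X) = X" if "w \<in> W" for w using that by (auto simp: slice_def)
      have XN: "W \<times> X \<in> sets ?N"
        using X sets.sets_into_space[OF X] slice_prod by (auto simp: sets_copies)
      have slice_sd: "slice w (sym_diff A B) = sym_diff (slice w A) (slice w B)" for w :: 'b and A B :: "('b \<times> 'g set) set"
        by (auto simp: slice_def)
      have "emeasure ?N (sym_diff (W \<times> X) (ia g ` (W \<times> X))) < \<infinity>" if g: "g \<in> carrier G" for g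
      proof -
        have sdN: "sym_diff (W \<times> X) (ia g ` (W \<times> X)) \<in> sets ?N" using XN iaN[OF g XN] by blast
        then have "emeasure ?N (sym_diff (W \<times> X) (ia g ` (W \<times> X)))
            = (\<Sum>w\<in>W. emeasure M (slice (act g w) (sym_diff (W \<times> X) (ia g ` (W \<times> X)))))"
          unfolding emeasure_copies[OF sdN]
          by (subst sum.reindex_bij_betw[OF bij[OF g], symmetric]) simp
        also have "\<dots> = (\<Sum>w\<in>W. emeasure M (sym_diff X (\<phi> (c g w) ` X)))"
          using sl[OF g _ XN] slice_prod aW[OF g] by (intro sum.cong) (simp_all add: slice_sd)
        also have "\<dots> < \<infinity>" using finX cH[OF g] fW by simp
        finally show ?thesis .
      qed
      from property_T_invariant_set[OF T ia iaN emN XN this]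
      obtain Y where Y: "Y \<in> sets ?N" "\<And>g. g \<in> carrier G \<Longrightarrow> ia g ` Y = Y"
        "emeasure ?N (sym_diff (W \<times> X) Y) < \<infinity>" by blast
      show "\<exists>X'\<in>sets M. (\<forall>g\<in>carrier ?H. \<phi> g ` X' = X') \<and> emeasure M (sym_diff X X') < \<infinity>"
      proof (intro bexI[of _ "slice z Y"] conjI ballI)
        fix h assume "h \<in> carrier ?H"
        then have h: "h \<in> H" "h \<in> carrier G" "act h z = z" by (auto simp: H_def)
        show "\<phi> h ` slice z Y = slice z Y"
          using sl[OF h(2) zW Y(1)] Y(2)[OF h(2)] h c_z by simp
      next
        have "sym_diff (W \<times> X) Y \<in> sets ?N" using XN Y(1) by blast
        then have "emeasure M (slice z (sym_diff (W \<times> X) Y)) < \<infinity>"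
          using Y(3) zW fW by (simp add: emeasure_copies)
        then show "emeasure M (sym_diff X (slice z Y)) < \<infinity>" using slice_prod[OF zW] by (simp add: slice_sd)
      qed (rule slM[OF zW Y(1)])
    qed
  qed
qed

lemma finite_orbit_via_stabilizer:
  fixes G (structure)
  assumes G: "group G" and a: "acts_on G Z act" "z \<in> Z" "finite ((\<lambda>g. act g z) ` carrier G)"
    and b: "acts_on G Y bct" "y \<in> Y" "finite ((\<lambda>g. bct g y) ` {g \<in> carrier G. act g z = z})"
  shows "finite ((\<lambda>g. bct g y) ` carrier G)"
proof -
  interpret group G by (rule G)
  define s where "s w = (SOME g. g \<in> carrier G \<and> act g z = w)" for w
  let ?B = "(\<lambda>g. bct g y) ` {g \<in> carrier G. act g z = z}"
  have "(\<lambda>g. bct g y) ` carrier G \<subseteq> (\<Union>w\<in>(\<lambda>g. act g z) ` carrier G. bct (s w) ` ?B)"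
  proof safe
    fix g assume g: "g \<in> carrier G"
    let ?s = "s (act g z)"
    have s: "?s \<in> carrier G" "act ?s z = act g z"
      using someI[of "\<lambda>h. h \<in> carrier G \<and> act h z = act g z" g] g by (auto simp: s_def)
    have "act (inv ?s \<otimes> g) z = act (inv ?s) (act ?s z)"
      using g s acts_onD(3)[OF a(1)] a(2) by simp
    then have "act (inv ?s \<otimes> g) z = z" using acts_on_inv(1)[OF G a(1) s(1) a(2)] by simp
    moreover have "bct g y = bct ?s (bct (inv ?s \<otimes> g) y)"
      using g s acts_onD(3)[OF b(1) s(1) _ b(2), of "inv ?s \<otimes> g"] by (simp flip: m_assoc)
    ultimately have "bct g y \<in> bct ?s ` ?B" using g s by auto
    then show "bct g y \<in> (\<Union>w\<in>(\<lambda>g. act g z) ` carrier G. bct (s w) ` ?B)" using g by blast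
  qed
  then show ?thesis using a(3) b(3) by (meson finite_UN_I finite_imageI finite_subset)
qed

section \<open>Orbits of polynomial growth\<close>

text \<open>The points that are reached from \<open>y\<close> by at most \<open>n\<close> steps, each step applying an element of
  \<open>S\<close>.\<close>

definition orbit_ball :: "('g \<Rightarrow> 'y \<Rightarrow> 'y) \<Rightarrow> 'g set \<Rightarrow> 'y \<Rightarrow> nat \<Rightarrow> 'y set"
  where "orbit_ball act S y n = ((\<lambda>B. B \<union> (\<Union>s\<in>S. act s ` B)) ^^ n) {y}"

lemma orbit_ball_0: "orbit_ball act S y 0 = {y}"
  by (simp add: orbit_ball_def)

lemma orbit_ball_Suc:
  "orbit_ball act S y (Suc n) = orbit_ball act S y n \<union> (\<Union>s\<in>S. act s ` orbit_ball act S y n)"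
  by (simp add: orbit_ball_def)

lemma finite_orbit_ball: "finite S \<Longrightarrow> finite (orbit_ball act S y n)"
  by (induction n) (auto simp: orbit_ball_0 orbit_ball_Suc)

lemma orbit_ball_ne: "orbit_ball act S y n \<noteq> {}"
  by (induction n) (auto simp: orbit_ball_0 orbit_ball_Suc)

text \<open>Otherwise the sequence would grow at least like \<open>(1 + \<epsilon>) ^ n\<close>.\<close>

lemma slow_step_of_polynomial_growth:
  fixes a :: "nat \<Rightarrow> nat" and \<epsilon> :: real
  assumes pos: "a 0 > 0" and bound: "\<And>n. a n \<le> C * (n + 1) ^ d" and \<epsilon>: "\<epsilon> > 0"
  shows "\<exists>n. a (Suc n) \<le> (1 + \<epsilon>) * a n"
proof (rule ccontr)
  assume "\<not> ?thesis"
  then have step: "a (Suc n) > (1 + \<epsilon>) * a n" for n by (meson not_le)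
  have grow: "(1 + \<epsilon>) ^ n \<le> a n" for n
  proof (induction n)
    case 0 then show ?case using pos by simp
  next
    case (Suc n)
    have "(1 + \<epsilon>) ^ Suc n \<le> (1 + \<epsilon>) * a n" using Suc \<epsilon> by simp
    then show ?case using step[of n] by linarith
  qed
  have "(\<lambda>n. real C * (real n + 1) ^ d / (1 + \<epsilon>) ^ n) \<longlonglongrightarrow> 0"
    using \<epsilon> by real_asymp
  then have "\<forall>\<^sub>F n in sequentially. real C * (real n + 1) ^ d / (1 + \<epsilon>) ^ n < 1"
    by (rule order_tendstoD) simp
  then obtain n where "real C * (real n + 1) ^ d / (1 + \<epsilon>) ^ n < 1"
    by (meson eventually_sequentially order_refl)
  then have "real C * (real n + 1) ^ d < (1 + \<epsilon>) ^ n" using \<epsilon> by (simp add: divide_less_eq)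
  moreover have "real (a n) \<le> real (C * (n + 1) ^ d)" using bound by (simp only: of_nat_le_iff)
  ultimately show False using grow[of n] by (simp add: algebra_simps)
qed

text \<open>Polynomial growth provides balls \<open>F m\<close> in the orbit \<open>Z\<close> that each generator moves in a
  proportion of at most \<open>2 / 2 ^ m\<close>. Take countably many copies of \<open>Z\<close>, and in copy \<open>m\<close> give each point the mass
  \<open>1 / card (F m)\<close>. The union \<open>X\<close> of the sets \<open>F m\<close> is then commensurated, by a geometric
  series. It is not near an invariant set: by transitivity an invariant set contains either no
  point of copy \<open>m\<close>, thereby missing mass 1 of \<open>X\<close>, or all of them, which is infinite mass if
  \<open>Z\<close> is infinite.\<close>

theorem property_T_finite_orbit_of_polynomial_growth:
  fixes G :: "('g, 'm) monoid_scheme" (structure)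
  assumes T: "property_T G" and act: "acts_on G Y act" and y: "y \<in> Y"
    and poly: "\<And>S. finite S \<Longrightarrow> S \<subseteq> carrier G \<Longrightarrow> \<exists>C d. \<forall>n. card (orbit_ball act S y n) \<le> C * (n + 1) ^ d"
  shows "finite ((\<lambda>g. act g y) ` carrier G)"
proof (rule ccontr)
  interpret group G by (rule property_TD(1)[OF T])
  note D = acts_onD[OF act]
  define Z where "Z = (\<lambda>g. act g y) ` carrier G"
  assume "infinite ((\<lambda>g. act g y) ` carrier G)"
  then have inf: "infinite Z" by (simp add: Z_def)
  have ZY: "Z \<subseteq> Y" using D(1) y by (auto simp: Z_def)
  have aZ: "act g z \<in> Z" if "g \<in> carrier G" "z \<in> Z" for g z
    using that D(3)[OF that(1) _ y] unfolding Z_def by (auto simp: image_iff) (metis m_closed)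
  have actZ: "acts_on G Z act" using D ZY aZ by (intro acts_onI) auto
  have trans: "\<exists>g\<in>carrier G. act g z = w" if zw: "z \<in> Z" "w \<in> Z" for z w
  proof -
    obtain g h where gh: "g \<in> carrier G" "h \<in> carrier G" "z = act g y" "w = act h y"
      using zw by (auto simp: Z_def)
    then have "act (h \<otimes> inv g) z = w"
      using D(3)[of h "inv g" z] acts_on_inv(1)[OF is_group act gh(1) y] ZY zw by auto
    then show ?thesis using gh by (intro bexI[of _ "h \<otimes> inv g"]) auto
  qed
  obtain S where S: "finite S" "S \<subseteq> carrier G" "generate G S = carrier G"
    using property_T_finitely_generated[OF T] .
  define B where "B = orbit_ball act S y"
  have fB: "finite (B n)" "B n \<noteq> {}" for n
    using finite_orbit_ball[OF S(1)] orbit_ball_ne by (simp_all add: B_def)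
  have BZ: "B n \<subseteq> Z" for n
  proof (induction n)
    case 0 then show ?case using D(2)[OF y] unfolding Z_def B_def orbit_ball_0 by (auto simp: image_iff) (metis one_closed)
  next
    case (Suc n) then show ?case using aZ S(2) by (auto simp: B_def orbit_ball_Suc)
  qed
  obtain C d where Cd: "card (B n) \<le> C * (n + 1) ^ d" for n
    using poly[OF S(1,2)] by (auto simp: B_def)
  have "\<exists>n. card (B (Suc n)) \<le> (1 + (1/2) ^ m) * card (B n)" for m
    using slow_step_of_polynomial_growth[of "\<lambda>n. card (B n)" C d "(1/2)^m"] Cd fB by (simp add: card_gt_0_iff)
  then obtain r where r: "card (B (Suc (r m))) \<le> (1 + (1/2) ^ m) * card (B (r m))" for m by metis
  define F where "F m = B (r m)" for m
  have F: "finite (F m)" "F m \<noteq> {}" "F m \<subseteq> Z" for m using fB BZ by (auto simp: F_def)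
  then have cF: "card (F m) > 0" for m by (simp add: card_gt_0_iff)
  define wt where "wt m = ennreal (1 / card (F m))" for m
  let ?E = "Z \<times> (UNIV :: nat set)"
  define M where "M = density (count_space ?E) (\<lambda>p. wt (snd p))"
  have spM: "space M = ?E" and stM: "A \<in> sets M \<longleftrightarrow> A \<subseteq> ?E" for A by (auto simp: M_def)
  have em: "emeasure M A = (\<integral>\<^sup>+p. wt (snd p) \<partial>count_space A)" if "A \<subseteq> ?E" for A
  proof -
    have "emeasure M A = (\<integral>\<^sup>+p. wt (snd p) * indicator A p \<partial>count_space ?E)"
      unfolding M_def using that by (subst emeasure_density) auto
    also have "\<dots> = (\<integral>\<^sup>+p. wt (snd p) \<partial>count_space A)"
      using that by (subst (1 2) nn_integral_count_space_indicator)
        (auto intro!: nn_integral_cong split: split_indicator)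
    finally show ?thesis .
  qed
  have em_row: "emeasure M (A \<times> {m}) = wt m * emeasure (count_space UNIV) A" if "A \<subseteq> Z" for A m
  proof -
    have "emeasure M (A \<times> {m}) = (\<integral>\<^sup>+p. wt m \<partial>count_space (A \<times> {m}))"
      using that by (subst em) (auto intro!: nn_integral_cong simp del: nn_integral_const)
    also have "\<dots> = wt m * emeasure (count_space (A \<times> {m})) (space (count_space (A \<times> {m})))"
      by (rule nn_integral_const)
    also have "emeasure (count_space (A \<times> {m})) (space (count_space (A \<times> {m}))) = emeasure (count_space UNIV) A"
      by (simp add: emeasure_count_space card_cartesian_product finite_cartesian_product_iff)
    finally show ?thesis .
  qed
  define ia where "ia g p = (act g (fst p), snd p :: nat)" for g p
  have ia: "acts_on G ?E ia"
    using acts_onD[OF actZ] by (intro acts_onI) (auto simp: ia_def)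
  have iaE: "ia g ` A \<subseteq> ?E" if "g \<in> carrier G" "A \<subseteq> ?E" for g A
    using that acts_onD(1)[OF ia] by blast
  have mp: "emeasure M (ia g ` A) = emeasure M A" if "g \<in> carrier G" "A \<subseteq> ?E" for g A
  proof -
    have "bij_betw (ia g) A (ia g ` A)"
      using acts_on_inj[OF is_group ia that(1)] that(2) by (simp add: bij_betw_def inj_on_subset)
    from nn_integral_bij_count_space[OF this, of "\<lambda>p. wt (snd p)"]
    show ?thesis using that iaE by (simp add: em ia_def)
  qed
  define X where "X = {p \<in> ?E. fst p \<in> F (snd p)}"
  have XE: "X \<subseteq> ?E" by (auto simp: X_def)
  define P where "P g \<longleftrightarrow> emeasure M (sym_diff X (ia g ` X)) < \<infinity>" for g
  have P_S: "P s" if s: "s \<in> S" for s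
  proof -
    have sG: "s \<in> carrier G" using S s by auto
    define A where "A m = sym_diff (F m) (act s ` F m)" for m
    have AZ: "A m \<subseteq> Z" for m using F(3) aZ[OF sG] by (auto simp: A_def)
    have inj: "inj_on (act s) (F m)" for m
      using acts_on_inj[OF is_group actZ sG] F(3) by (rule inj_on_subset)
    have "card (A m) \<le> 2 * (1/2)^m * card (F m)" for m
    proof -
      have "act s ` F m \<union> F m \<subseteq> B (Suc (r m))" using s by (auto simp: F_def B_def orbit_ball_Suc)
      then have "card (act s ` F m \<union> F m) \<le> (1 + (1/2)^m) * card (F m)"
        using r[of m] card_mono[OF fB(1)] unfolding F_def
        by (smt (verit, best) of_nat_le_iff)
      moreover have "card (act s ` F m) = card (F m)" by (rule card_image[OF inj])
      moreover have "card (act s ` F m \<union> F m) = card (F m) + card (act s ` F m - F m)"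
        "card (act s ` F m \<union> F m) = card (act s ` F m) + card (F m - act s ` F m)"
        using F(1)[of m] by (subst card_Un_disjoint[symmetric]; auto intro!: arg_cong[of _ _ card])+
      moreover have "card (A m) = card (F m - act s ` F m) + card (act s ` F m - F m)"
        unfolding A_def using F(1)[of m] by (subst card_Un_disjoint) auto
      ultimately show ?thesis by (simp add: algebra_simps)
    qed
    then have "1 / card (F m) * card (A m) \<le> 2 * (1/2)^m" for m
      using cF[of m] by (simp add: field_simps)
    then have row: "emeasure M (A m \<times> {m}) \<le> ennreal (2 * (1/2)^m)" for m
      unfolding em_row[OF AZ] wt_def using F(1)[of m]
      by (simp add: A_def emeasure_count_space ennreal_mult[symmetric] ennreal_of_nat_eq_real_of_nat)
    have "sym_diff X (ia s ` X) = (\<Union>m. A m \<times> {m})"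
      using F(3) aZ[OF sG] by (fastforce simp: X_def A_def ia_def image_iff)
    moreover have "range (\<lambda>m. A m \<times> {m}) \<subseteq> sets M" using AZ by (fastforce simp: stM)
    ultimately have "emeasure M (sym_diff X (ia s ` X)) \<le> (\<Sum>m. emeasure M (A m \<times> {m}))"
      using emeasure_subadditive_countably[of "\<lambda>m. A m \<times> {m}" M] by simp
    also have "\<dots> \<le> (\<Sum>m. ennreal (2 * (1/2)^m))" by (intro suminf_le row) auto
    also have "\<dots> = ennreal 4"
      using sums_mult[OF geometric_sums[of "1/2::real"], of 2] by (intro suminf_ennreal_eq) auto
    also have "\<dots> < \<infinity>" by simp
    finally show ?thesis by (simp add: P_def)
  qed
  have em_fin_sub: "emeasure M A' < \<infinity>" if "A' \<subseteq> A \<union> A''" "A \<subseteq> ?E" "A'' \<subseteq> ?E" "emeasure M A < \<infinity>" "emeasure M A'' < \<infinity>" for A A' A''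
  proof -
    have "emeasure M A' \<le> emeasure M (A \<union> A'')" using that by (intro emeasure_mono) (auto simp: stM)
    also have "\<dots> \<le> emeasure M A + emeasure M A''" using that by (intro emeasure_subadditive) (auto simp: stM)
    also have "\<dots> < \<infinity>" using that by simp
    finally show ?thesis .
  qed
  have P: "P g" if "g \<in> generate G S" for g
    using that
  proof (induction rule: generate.induct)
    case one
    have "ia \<one> ` X = X" by (rule acts_on_image_one[OF ia XE])
    then show ?case by (simp add: P_def)
  next
    case (incl s) then show ?case by (rule P_S)
  next
    case (inv s)
    then have s: "s \<in> carrier G" using S by auto
    have "sym_diff X (ia (inv s) ` X) = ia (inv s) ` sym_diff X (ia s ` X)"
      using acts_on_image_sym_diff[OF is_group ia inv_closed[OF s] XE iaE[OF s XE]]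
      by (simp add: acts_on_image_inv(1)[OF is_group ia s XE] Un_commute)
    moreover have "sym_diff X (ia s ` X) \<subseteq> ?E" using XE iaE[OF s XE] by blast
    ultimately show ?case using P_S[OF inv] mp[OF inv_closed[OF s]] by (simp add: P_def)
  next
    case (eng g h)
    then have gh: "g \<in> carrier G" "h \<in> carrier G" using S(3) by auto
    have sub: "sym_diff X (ia (g \<otimes> h) ` X) \<subseteq> sym_diff X (ia g ` X) \<union> ia g ` sym_diff X (ia h ` X)"
      unfolding acts_on_image_mult[OF ia gh XE] by blast
    have E: "sym_diff X (ia h ` X) \<subseteq> ?E" "sym_diff X (ia g ` X) \<subseteq> ?E" using XE iaE gh by blast+
    show ?case
      unfolding P_def
      using eng.IH mp[OF gh(1) E(1)] unfolding P_def
      by (intro em_fin_sub[OF sub E(2) iaE[OF gh(1) E(1)]]) simp_all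
  qed
  obtain X' where X': "X' \<in> sets M" "\<And>g. g \<in> carrier G \<Longrightarrow> ia g ` X' = X'" "emeasure M (sym_diff X X') < \<infinity>"
  proof (rule property_T_invariant_set[OF T, of M ia X])
    show "acts_on G (space M) ia" using ia by (simp add: spM)
    show "emeasure M (sym_diff X (ia g ` X)) < \<infinity>" if "g \<in> carrier G" for g
      using P that S(3) by (simp add: P_def)
  qed (use XE mp iaE in \<open>auto simp: stM\<close>)
  \<comment> \<open>By transitivity each row of the invariant set is empty or full; a full row differs from
    the finite Foelner set by infinitely many points of positive mass.\<close>
  have X'E: "X' \<subseteq> ?E" using X'(1) stM by auto
  have empty: "(z, m) \<notin> X'" for z m
  proof
    assume zm: "(z, m) \<in> X'"
    have "(w, m) \<in> X'" if w: "w \<in> Z" for w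
    proof -
      have "z \<in> Z" using zm X'E by auto
      then obtain g where "g \<in> carrier G" "act g z = w" using trans w by blast
      then show ?thesis using X'(2)[of g] zm by (force simp: ia_def)
    qed
    then have sub: "(Z - F m) \<times> {m} \<subseteq> sym_diff X X'" by (auto simp: X_def)
    have "emeasure M ((Z - F m) \<times> {m}) = \<infinity>"
      using inf F(1) cF[of m] by (subst em_row) (auto simp: emeasure_count_space wt_def ennreal_mult_top)
    moreover have "emeasure M ((Z - F m) \<times> {m}) \<le> emeasure M (sym_diff X X')"
      using sub XE X'E by (intro emeasure_mono) (auto simp: stM)
    ultimately show False using X'(3) by simp
  qed
  have "emeasure M (F m \<times> {m}) = 1" for m
    using F(1)[of m] F(3)[of m] cF[of m]
    by (subst em_row) (auto simp: emeasure_count_space wt_def ennreal_mult[symmetric] ennreal_of_nat_eq_real_of_nat)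
  then have "(\<Sum>m. emeasure M (F m \<times> {m})) = \<infinity>"
    using nn_integral_count_space_nat[of "\<lambda>_. 1 :: ennreal"] by simp
  moreover have "(\<Sum>m. emeasure M (F m \<times> {m})) = emeasure M (\<Union>m. F m \<times> {m})"
    using F(3) by (intro suminf_emeasure) (fastforce simp: stM, auto simp: disjoint_family_on_def)
  moreover have "emeasure M (\<Union>m. F m \<times> {m}) \<le> emeasure M (sym_diff X X')"
  proof (rule emeasure_mono)
    show "(\<Union>m. F m \<times> {m}) \<subseteq> sym_diff X X'" using F(3) empty by (fastforce simp: X_def)
    show "sym_diff X X' \<in> sets M" using XE X'E unfolding stM by blast
  qed
  ultimately show False using X'(3) by simp
qed

definition word_sums :: "'a::group_add set \<Rightarrow> nat \<Rightarrow> 'a set"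
  where "word_sums A n = orbit_ball (+) A 0 n"

text \<open>Sums of commuting elements only depend on the multiplicities of the summands.\<close>

lemma card_word_sums:
  fixes A :: "'a::group_add set"
  assumes "finite A" "\<And>a b. a \<in> A \<Longrightarrow> b \<in> A \<Longrightarrow> a + b = b + a"
  shows "card (word_sums A n) \<le> (n + 1) ^ card A"
  using assms
proof (induction arbitrary: n rule: finite_induct)
  case empty
  have "word_sums {} n = {0 :: 'a}"
    by (induction n) (auto simp: word_sums_def orbit_ball_0 orbit_ball_Suc)
  then show ?case by simp
next
  case (insert a A)
  let ?r = "\<lambda>i. (((+) a) ^^ i) 0"
  have com: "b + ?r i = ?r i + b" if "b \<in> A" for b i
  proof (induction i)
    case (Suc i)
    have "b + (a + ?r i) = a + (b + ?r i)" using insert.prems[of a b] that by (simp flip: add.assoc)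
    then show ?case using Suc by (simp add: add.assoc)
  qed simp
  have sub: "word_sums (insert a A) n \<subseteq> (\<Union>i\<in>{..n}. (+) (?r i) ` word_sums A n)" for n
  proof (induction n)
    case 0 then show ?case by (auto simp: word_sums_def orbit_ball_0)
  next
    case (Suc n)
    show ?case
    proof
      fix x assume "x \<in> word_sums (insert a A) (Suc n)"
      then obtain u where u: "u \<in> word_sums (insert a A) n" "x = u \<or> (\<exists>b\<in>insert a A. x = b + u)"
        by (auto simp: word_sums_def orbit_ball_Suc)
      obtain i w where i: "i \<le> n" "w \<in> word_sums A n" "u = ?r i + w" using Suc u(1) by blast
      have w: "w \<in> word_sums A (Suc n)" using i by (simp add: word_sums_def orbit_ball_Suc)
      consider "x = u" | "x = a + u" | b where "b \<in> A" "x = b + u" using u(2) by auto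
      then show "x \<in> (\<Union>i\<in>{..Suc n}. (+) (?r i) ` word_sums A (Suc n))"
      proof cases
        case 1 then show ?thesis using i w by (intro UN_I[of i]) auto
      next
        case 2 then show ?thesis using i w by (intro UN_I[of "Suc i"]) (auto simp: add.assoc)
      next
        case 3
        then have "x = ?r i + (b + w)" using i com by (simp flip: add.assoc)
        moreover have "b + w \<in> word_sums A (Suc n)" using i 3 by (auto simp: word_sums_def orbit_ball_Suc)
        ultimately show ?thesis using i by (intro UN_I[of i]) auto
      qed
    qed
  qed
  have fin: "finite (word_sums A n)" using insert.hyps by (simp add: word_sums_def finite_orbit_ball)
  have "card (word_sums (insert a A) n) \<le> (\<Sum>i\<in>{..n}. card ((+) (?r i) ` word_sums A n))"
    using sub[of n] fin by (intro order_trans[OF card_mono card_UN_le]) auto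
  also have "\<dots> \<le> (\<Sum>i\<in>{..n}. (n + 1) ^ card A)"
    using insert by (intro sum_mono order_trans[OF card_image_le[OF fin]]) auto
  finally show ?case using insert.hyps by simp
qed

text \<open>The map \<open>\<kappa>\<close> sends the ball of radius \<open>n\<close> around \<open>y\<close> to sums of at most \<open>n\<close> elements of a finite
  commuting set, of which there are polynomially many, and at most \<open>N\<close> points of the orbit
  have the same image.\<close>

corollary property_T_finite_orbit_of_commuting_cocycle:
  fixes G :: "('g, 'm) monoid_scheme" and \<kappa> :: "'y \<Rightarrow> 'a::group_add"
  assumes T: "property_T G" and act: "acts_on G Y act" and y: "y \<in> Y"
  defines "Z \<equiv> (\<lambda>g. act g y) ` carrier G"
  assumes \<kappa>: "\<And>g z. g \<in> carrier G \<Longrightarrow> z \<in> Z \<Longrightarrow> \<kappa> (act g z) = \<sigma> g z + \<kappa> z"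
    and fin: "\<And>g. g \<in> carrier G \<Longrightarrow> finite (\<sigma> g ` Z)"
    and com: "\<And>g h z w. g \<in> carrier G \<Longrightarrow> h \<in> carrier G \<Longrightarrow> z \<in> Z \<Longrightarrow> w \<in> Z \<Longrightarrow> \<sigma> g z + \<sigma> h w = \<sigma> h w + \<sigma> g z"
    and fib: "\<And>a. finite {z \<in> Z. \<kappa> z = a} \<and> card {z \<in> Z. \<kappa> z = a} \<le> N"
  shows "finite Z"
  unfolding Z_def
proof (rule property_T_finite_orbit_of_polynomial_growth[OF T act y])
  interpret group G by (rule property_TD(1)[OF T])
  note D = acts_onD[OF act]
  fix S assume S: "finite S" "S \<subseteq> carrier G"
  define A where "A = (\<Union>s\<in>S. \<sigma> s ` Z)"
  have fA: "finite A" using S fin by (auto simp: A_def)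
  have cA: "a + b = b + a" if "a \<in> A" "b \<in> A" for a b
    using that S(2) unfolding A_def by (auto intro!: com)
  have aZ: "act g z \<in> Z" if "g \<in> carrier G" "z \<in> Z" for g z
    using that D(3)[OF that(1) _ y] unfolding Z_def by (auto simp: image_iff) (metis m_closed)
  have yZ: "y \<in> Z" unfolding Z_def using D(2)[OF y] by (metis image_eqI one_closed)
  have sub: "orbit_ball act S y n \<subseteq> Z \<and> \<kappa> ` orbit_ball act S y n \<subseteq> (\<lambda>w. w + \<kappa> y) ` word_sums A n" for n
  proof (induction n)
    case 0 then show ?case using yZ by (auto simp: orbit_ball_0 word_sums_def)
  next
    case (Suc n)
    have "\<kappa> (act s z) \<in> (\<lambda>w. w + \<kappa> y) ` word_sums A (Suc n)" if "s \<in> S" "z \<in> orbit_ball act S y n" for s z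
    proof -
      have "\<kappa> z \<in> (\<lambda>w. w + \<kappa> y) ` word_sums A n" using Suc that(2) by blast
      then obtain w where w: "w \<in> word_sums A n" "\<kappa> z = w + \<kappa> y" by blast
      have z: "z \<in> Z" using Suc that(2) by blast
      have "s \<in> carrier G" using S(2) that(1) by blast
      from \<kappa>[OF this z] have "\<kappa> (act s z) = (\<sigma> s z + w) + \<kappa> y" by (simp add: w add.assoc)
      moreover have "\<sigma> s z \<in> A" using that(1) z by (auto simp: A_def)
      then have "\<sigma> s z + w \<in> word_sums A (Suc n)"
        using w(1) unfolding word_sums_def orbit_ball_Suc by blast
      ultimately show ?thesis by blast
    qed
    moreover have "word_sums A n \<subseteq> word_sums A (Suc n)" by (auto simp: word_sums_def orbit_ball_Suc)
    moreover have "act s z \<in> Z" if "s \<in> S" "z \<in> orbit_ball act S y n" for s z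
      using Suc S(2) aZ that by blast
    ultimately show ?case using Suc unfolding orbit_ball_Suc
      by (simp add: image_subset_iff image_Un subset_eq) blast
  qed
  have "card (orbit_ball act S y n) \<le> N * (n + 1) ^ card A" for n
  proof -
    let ?W = "(\<lambda>w. w + \<kappa> y) ` word_sums A n"
    have fW: "finite ?W" using fA by (simp add: word_sums_def finite_orbit_ball)
    have "orbit_ball act S y n \<subseteq> (\<Union>a\<in>?W. {z \<in> Z. \<kappa> z = a})" using sub[of n] by auto
    then have "card (orbit_ball act S y n) \<le> card (\<Union>a\<in>?W. {z \<in> Z. \<kappa> z = a})"
      using finite_UN_I[OF fW conjunct1[OF fib]] by (intro card_mono)
    also have "\<dots> \<le> (\<Sum>a\<in>?W. card {z \<in> Z. \<kappa> z = a})" by (rule card_UN_le[OF fW])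
    also have "\<dots> \<le> card ?W * N" using fib by (intro sum_bounded_above[THEN order_trans]) auto
    also have "\<dots> \<le> (n + 1) ^ card A * N"
      using card_word_sums[OF fA cA, of n] fA
      by (intro mult_right_mono order_trans[OF card_image_le]) (auto simp: word_sums_def finite_orbit_ball)
    finally show ?thesis by (simp add: mult.commute)
  qed
  then show "\<exists>C d. \<forall>n. card (orbit_ball act S y n) \<le> C * (n + 1) ^ d" by blast
qed

section \<open>The group of homographies\<close>

text \<open>The projective linear group becomes a type of class \<open>group_add\<close>, written additively though it is
  not commutative, so that the general laws of groups are available to the simplifier.\<close>

typedef pgl = PGL2 morphisms app of_map
  using PGL2_id by blast

instantiation pgl :: group_add
begin

definition "0 = of_map id"
definition "g + h = of_map (app g \<circ> app h)"
definition "- g = of_map (inv_into UNIV (app g))"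
definition "g - h = g + - (h :: pgl)"

instance
proof
  have inv: "inv_into UNIV (app g) \<in> PGL2 \<and> inv_into UNIV (app g) \<circ> app g = id" for g
  proof -
    obtain h where h: "h \<in> PGL2" "\<And>x. h (app g x) = x" using PGL2_inverse[OF app] by metis
    obtain k where k: "\<And>x. k (h x) = x" using PGL2_inverse[OF h(1)] by metis
    have "app g (h x) = x" for x using h(2) k by metis
    then have "inv_into UNIV (app g) = h" using h(2) by (intro Hilbert_Choice.inv_equality) auto
    then show ?thesis using h by auto
  qed
  fix g h k :: pgl
  show "g + h + k = g + (h + k)"
    by (simp add: plus_pgl_def of_map_inverse PGL2_comp app o_assoc)
  show "0 + g = g" by (simp add: plus_pgl_def zero_pgl_def of_map_inverse PGL2_id app_inverse)
  show "g + 0 = g" by (simp add: plus_pgl_def zero_pgl_def of_map_inverse PGL2_id app_inverse)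
  show "- g + g = 0"
    using inv[of g] by (simp add: plus_pgl_def zero_pgl_def uminus_pgl_def of_map_inverse)
  show "g + - h = g - h" by (simp add: minus_pgl_def)
qed

end

lemma app_zero [simp]: "app 0 x = x"
  by (simp add: zero_pgl_def of_map_inverse PGL2_id)

lemma app_plus: "app (g + h) x = app g (app h x)"
  by (simp add: plus_pgl_def of_map_inverse PGL2_comp app)

lemma app_uminus [simp]: "app (- g) (app g x) = x" "app g (app (- g) x) = x"
  by (simp_all flip: app_plus)

definition hom_pgl :: "real \<Rightarrow> real \<Rightarrow> real \<Rightarrow> real \<Rightarrow> pgl"
  where "hom_pgl a b c d = of_map (homography a b c d)"

lemma app_hom_pgl: "a * d - b * c \<noteq> 0 \<Longrightarrow> app (hom_pgl a b c d) = homography a b c d"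
  unfolding hom_pgl_def by (rule of_map_inverse) (auto simp: PGL2_def)

lemma hom_pgl_exists:
  obtains a b c d where "a * d - b * c \<noteq> 0" "g = hom_pgl a b c d"
proof -
  have "app g \<in> PGL2" by (rule app)
  then obtain a b c d where "app g = homography a b c d" "a * d - b * c \<noteq> 0" by (auto simp: PGL2_def)
  then show thesis using that[of a d b c] app_inverse[of g] by (simp add: hom_pgl_def)
qed

lemma hom_pgl_scale:
  assumes "k \<noteq> 0"
  shows "hom_pgl (k * a) (k * b) (k * c) (k * d) = hom_pgl a b c d"
proof -
  have "homography (k * a) (k * b) (k * c) (k * d) x = homography a b c d x" for x
  proof (cases x)
    case (Some y)
    have e: "k * u * y + k * v = k * (u * y + v)" for u v by (simp add: algebra_simps)
    show ?thesis using assms unfolding Some by (simp add: e)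
  qed (use assms in auto)
  then show ?thesis unfolding hom_pgl_def by presburger
qed

lemma hom_pgl_normalized:
  obtains a b c d where "\<bar>a * d - b * c\<bar> = 1" "g = hom_pgl a b c d"
proof -
  obtain a b c d where h: "a * d - b * c \<noteq> 0" "g = hom_pgl a b c d" by (rule hom_pgl_exists)
  define k where "k = 1 / sqrt \<bar>a * d - b * c\<bar>"
  have k: "k \<noteq> 0" "k^2 = 1 / \<bar>a * d - b * c\<bar>" using h(1) by (auto simp: k_def power_divide)
  have "(k * a) * (k * d) - (k * b) * (k * c) = k^2 * (a * d - b * c)" by (simp add: algebra_simps power2_eq_square)
  then have "\<bar>(k * a) * (k * d) - (k * b) * (k * c)\<bar> = 1" using h(1) by (simp add: k(2) abs_mult)
  then show thesis using that[of "k * a" "k * d" "k * b" "k * c"] h(2) hom_pgl_scale[OF k(1)] by simp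
qed

lemma hom_pgl_plus:
  assumes "a * d - b * c \<noteq> 0" "a' * d' - b' * c' \<noteq> 0"
  shows "hom_pgl a b c d + hom_pgl a' b' c' d' =
    hom_pgl (a * a' + b * c') (a * b' + b * d') (c * a' + d * c') (c * b' + d * d')"
  using homography_comp[OF assms] assms
  by (simp add: plus_pgl_def app_hom_pgl) (simp add: hom_pgl_def comp_def)

lemma det_mult_nonzero:
  fixes a :: real
  assumes "a * d - b * c \<noteq> 0" "a' * d' - b' * c' \<noteq> 0"
  shows "(a * a' + b * c') * (c * b' + d * d') - (a * b' + b * d') * (c * a' + d * c') \<noteq> 0"
proof -
  have "(a * a' + b * c') * (c * b' + d * d') - (a * b' + b * d') * (c * a' + d * c')
    = (a * d - b * c) * (a' * d' - b' * c')" by (simp add: algebra_simps)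
  then show ?thesis using assms by simp
qed

lemma hom_pgl_scalar: "k \<noteq> 0 \<Longrightarrow> hom_pgl k 0 0 k = 0"
proof -
  assume "k \<noteq> 0"
  then have "homography k 0 0 k = id" using homography_scalar by auto
  then show ?thesis by (simp add: hom_pgl_def zero_pgl_def)
qed

lemma hom_pgl_uminus:
  assumes "a * d - b * c \<noteq> 0"
  shows "- hom_pgl a b c d = hom_pgl d (- b) (- c) a"
proof -
  have "d * a - (- b) * (- c) \<noteq> 0" using assms by (simp add: mult.commute)
  then have "hom_pgl d (- b) (- c) a + hom_pgl a b c d = hom_pgl (a * d - b * c) 0 0 (a * d - b * c)"
    using assms by (subst hom_pgl_plus) (simp_all add: algebra_simps)
  then show ?thesis using hom_pgl_scalar[OF assms] by (metis add_eq_0_iff2)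
qed

text \<open>Fixed points are roots of a quadratic polynomial.\<close>

lemma homography_fixes_infinite:
  assumes inf: "infinite {y. homography a b c d (Some y) = Some y}"
  shows "b = 0 \<and> c = 0 \<and> a = d"
proof (rule ccontr)
  assume "\<not> ?thesis"
  then have "[:- b, d - a, c:] \<noteq> 0" by auto
  then have "finite {y. poly [:- b, d - a, c:] y = 0}" by (rule poly_roots_finite)
  moreover have "{y. homography a b c d (Some y) = Some y} \<subseteq> {y. poly [:- b, d - a, c:] y = 0}"
    by (auto simp: field_simps split: if_splits)
  ultimately show False using inf finite_subset by blast
qed

lemma pgl_eqI:
  assumes inf: "infinite {y. app g (Some y) = app h (Some y)}"
  shows "g = h"
proof -
  obtain a b c d where k: "a * d - b * c \<noteq> 0" "- h + g = hom_pgl a b c d" by (rule hom_pgl_exists)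
  have "{y. app g (Some y) = app h (Some y)} \<subseteq> {y. homography a b c d (Some y) = Some y}"
  proof clarify
    fix y assume "app g (Some y) = app h (Some y)"
    then have "app (- h + g) (Some y) = Some y" by (simp add: app_plus)
    then show "homography a b c d (Some y) = Some y" using k by (simp add: app_hom_pgl)
  qed
  then have "b = 0 \<and> c = 0 \<and> a = d" using inf homography_fixes_infinite finite_subset by blast
  then have "- h + g = 0" using k hom_pgl_scalar[of a] by auto
  then show ?thesis by (metis add_eq_0_iff2 minus_minus)
qed

lemma hom_pgl_eq_zero:
  assumes "a * d - b * c \<noteq> 0" "hom_pgl a b c d = 0"
  shows "b = 0" "c = 0" "a = d"
proof -
  have "homography a b c d (Some y) = Some y" for y
    by (simp add: assms(2) flip: app_hom_pgl[OF assms(1)])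
  then show "b = 0" "c = 0" "a = d"
    using homography_fixes_infinite[of a b c d] infinite_UNIV_char_0 by auto
qed

lemma hom_pgl_eqD:
  assumes "a * d - b * c \<noteq> 0" "a' * d' - b' * c' \<noteq> 0" "hom_pgl a b c d = hom_pgl a' b' c' d'"
  obtains k where "k \<noteq> 0" "a' = k * a" "b' = k * b" "c' = k * c" "d' = k * d"
proof -
  let ?D = "a * d - b * c"
  have D': "d * a - (- b) * (- c) \<noteq> 0" using assms(1) by (simp add: mult.commute)
  have "- hom_pgl a b c d + hom_pgl a' b' c' d' = 0" using assms(3) by simp
  then have z: "hom_pgl (d * a' - b * c') (d * b' - b * d') (a * c' - c * a') (a * d' - c * b') = 0"
    unfolding hom_pgl_uminus[OF assms(1)] hom_pgl_plus[OF D' assms(2)] by (simp add: algebra_simps)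
  have n: "(d * a' - b * c') * (a * d' - c * b') - (d * b' - b * d') * (a * c' - c * a') \<noteq> 0"
    using det_mult_nonzero[OF D' assms(2)] by (simp add: algebra_simps)
  note e = hom_pgl_eq_zero[OF n z]
  define k where "k = (d * a' - b * c') / ?D"
  have "?D * a' = a * (d * a' - b * c') + b * (a * c' - c * a')"
    "?D * b' = a * (d * b' - b * d') + b * (a * d' - c * b')"
    "?D * c' = c * (d * a' - b * c') + d * (a * c' - c * a')"
    "?D * d' = c * (d * b' - b * d') + d * (a * d' - c * b')" by (simp_all add: algebra_simps)
  then have "?D * a' = a * (d * a' - b * c')" "?D * b' = b * (d * a' - b * c')"
    "?D * c' = c * (d * a' - b * c')" "?D * d' = d * (d * a' - b * c')" unfolding e by simp_all
  then have "a' = k * a" "b' = k * b" "c' = k * c" "d' = k * d"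
    using assms(1) unfolding k_def by (simp_all add: field_simps)
  moreover have "k \<noteq> 0" using calculation assms(2) by auto
  ultimately show thesis using that by blast
qed

text \<open>The sign of the determinant is well-defined, as scalars contribute squares. It tells
  whether a homography preserves the orientation of the projective line.\<close>

definition pos_det :: "pgl \<Rightarrow> bool"
  where "pos_det g \<longleftrightarrow> (\<exists>a b c d. a * d - b * c > 0 \<and> g = hom_pgl a b c d)"

lemma pos_det_hom_pgl:
  assumes "a * d - b * c \<noteq> 0"
  shows "pos_det (hom_pgl a b c d) \<longleftrightarrow> a * d - b * c > 0"
proof
  assume "pos_det (hom_pgl a b c d)"
  then obtain a' b' c' d' where p: "a' * d' - b' * c' > 0" "hom_pgl a' b' c' d' = hom_pgl a b c d"
    by (auto simp: pos_det_def)
  obtain k where "k \<noteq> 0" "a = k * a'" "b = k * b'" "c = k * c'" "d = k * d'"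
    using hom_pgl_eqD[OF _ assms p(2)] p(1) by auto
  then have "a * d - b * c = k^2 * (a' * d' - b' * c')" by (simp add: algebra_simps power2_eq_square)
  then show "a * d - b * c > 0" using p(1) \<open>k \<noteq> 0\<close> by simp
qed (auto simp: pos_det_def)

lemma pos_det_plus: "pos_det (g + h) \<longleftrightarrow> (pos_det g \<longleftrightarrow> pos_det h)"
proof -
  obtain a b c d where g: "a * d - b * c \<noteq> 0" "g = hom_pgl a b c d" by (rule hom_pgl_exists)
  obtain a' b' c' d' where h: "a' * d' - b' * c' \<noteq> 0" "h = hom_pgl a' b' c' d'" by (rule hom_pgl_exists)
  have "(a * a' + b * c') * (c * b' + d * d') - (a * b' + b * d') * (c * a' + d * c')
    = (a * d - b * c) * (a' * d' - b' * c')" by (simp add: algebra_simps)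
  then show ?thesis
    unfolding g(2) h(2) hom_pgl_plus[OF g(1) h(1)] pos_det_hom_pgl[OF g(1)] pos_det_hom_pgl[OF h(1)]
      pos_det_hom_pgl[OF det_mult_nonzero[OF g(1) h(1)]]
    using g(1) h(1) by (simp add: zero_less_mult_iff) (metis linorder_neqE_linordered_idom order.asym)
qed

lemma pos_det_zero: "pos_det 0"
  using pos_det_plus[of 0 0] by simp

text \<open>Commuting matrices give commuting homographies, but not conversely: the matrices may also
  anticommute, like those of \<open>- x\<close> and \<open>1 / x\<close>. For homographies that commute, the sign is a
  homomorphism (\<open>mat_commute_plus\<close>), which is what cuts the centralizer of a homography
  down to an abelian subgroup of index at most two (\<open>mat_commute_trans\<close>).\<close>

definition mat_commute :: "pgl \<Rightarrow> pgl \<Rightarrow> bool"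
  where "mat_commute g h \<longleftrightarrow> (\<exists>a b c d a' b' c' d'. a * d - b * c \<noteq> 0 \<and> a' * d' - b' * c' \<noteq> 0 \<and>
    g = hom_pgl a b c d \<and> h = hom_pgl a' b' c' d' \<and>
    b * c' = b' * c \<and> a * b' + b * d' = a' * b + b' * d \<and> c * a' + d * c' = c' * a + d' * c)"

lemma mat_commute_hom_pgl:
  assumes "a * d - b * c \<noteq> 0" "a' * d' - b' * c' \<noteq> 0"
  shows "mat_commute (hom_pgl a b c d) (hom_pgl a' b' c' d') \<longleftrightarrow>
    b * c' = b' * c \<and> a * b' + b * d' = a' * b + b' * d \<and> c * a' + d * c' = c' * a + d' * c"
    (is "?L \<longleftrightarrow> ?R")
proof
  assume ?L
  then obtain p q r s p' q' r' s' where e: "p * s - q * r \<noteq> 0" "p' * s' - q' * r' \<noteq> 0"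
    "hom_pgl p q r s = hom_pgl a b c d" "hom_pgl p' q' r' s' = hom_pgl a' b' c' d'"
    and c: "q * r' = q' * r" "p * q' + q * s' = p' * q + q' * s" "r * p' + s * r' = r' * p + s' * r"
    unfolding mat_commute_def by metis
  obtain k where k: "a = k * p" "b = k * q" "c = k * r" "d = k * s"
    using hom_pgl_eqD[OF e(1) assms(1) e(3)] by metis
  obtain l where l: "a' = l * p'" "b' = l * q'" "c' = l * r'" "d' = l * s'"
    using hom_pgl_eqD[OF e(2) assms(2) e(4)] by metis
  have "b * c' = k * l * (q * r')" "b' * c = k * l * (q' * r)"
    "a * b' + b * d' = k * l * (p * q' + q * s')" "a' * b + b' * d = k * l * (p' * q + q' * s)"
    "c * a' + d * c' = k * l * (r * p' + s * r')" "c' * a + d' * c = k * l * (r' * p + s' * r)"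
    unfolding k l by (simp_all add: algebra_simps)
  then show ?R using c by simp
qed (use assms mat_commute_def in blast)

lemma mat_commute_imp_commute:
  assumes "mat_commute g h"
  shows "g + h = h + g"
proof -
  obtain a b c d a' b' c' d' where n: "a * d - b * c \<noteq> 0" "a' * d' - b' * c' \<noteq> 0"
    and gh: "g = hom_pgl a b c d" "h = hom_pgl a' b' c' d'"
    and e: "b * c' = b' * c" "a * b' + b * d' = a' * b + b' * d" "c * a' + d * c' = c' * a + d' * c"
    using assms unfolding mat_commute_def by metis
  show ?thesis unfolding gh hom_pgl_plus[OF n] hom_pgl_plus[OF n(2,1)]
    using e by (simp add: mult.commute add.commute)
qed

lemma mat_commute_refl: "mat_commute g g"
proof -
  obtain a b c d where "a * d - b * c \<noteq> 0" "g = hom_pgl a b c d" by (rule hom_pgl_exists)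
  then show ?thesis by (simp add: mat_commute_hom_pgl mult.commute add.commute)
qed

lemma mat_commute_zero: "mat_commute 0 h"
proof -
  obtain a b c d where "a * d - b * c \<noteq> 0" "h = hom_pgl a b c d" by (rule hom_pgl_exists)
  then show ?thesis using mat_commute_hom_pgl[of 1 1 0 0 a d b c] hom_pgl_scalar[of 1] by simp
qed

text \<open>Matrices whose homographies commute do so up to sign, by comparing determinants.\<close>

lemma commute_imp_mat_commute_up_to_sign:
  assumes n: "a * d - b * c \<noteq> 0" "a' * d' - b' * c' \<noteq> 0"
    and com: "hom_pgl a b c d + hom_pgl a' b' c' d' = hom_pgl a' b' c' d' + hom_pgl a b c d"
  obtains k where "k = 1 \<or> k = -1"
    "a * a' + b * c' = k * (a' * a + b' * c)" "a * b' + b * d' = k * (a' * b + b' * d)"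
    "c * a' + d * c' = k * (c' * a + d' * c)" "c * b' + d * d' = k * (c' * b + d' * d)"
proof -
  obtain k where k: "a * a' + b * c' = k * (a' * a + b' * c)" "a * b' + b * d' = k * (a' * b + b' * d)"
    "c * a' + d * c' = k * (c' * a + d' * c)" "c * b' + d * d' = k * (c' * b + d' * d)"
    using hom_pgl_eqD[OF det_mult_nonzero[OF n(2,1)] det_mult_nonzero[OF n]] com
    unfolding hom_pgl_plus[OF n] hom_pgl_plus[OF n(2,1)] by metis
  have "(a * d - b * c) * (a' * d' - b' * c')
     = (a * a' + b * c') * (c * b' + d * d') - (a * b' + b * d') * (c * a' + d * c')" by (simp add: algebra_simps)
  also have "\<dots> = k^2 * ((a' * a + b' * c) * (c' * b + d' * d) - (a' * b + b' * d) * (c' * a + d' * c))"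
    unfolding k by (simp add: algebra_simps power2_eq_square)
  also have "\<dots> = k^2 * ((a * d - b * c) * (a' * d' - b' * c'))" by (simp add: algebra_simps)
  finally have "k^2 = 1" using n by simp
  then show thesis using that k by (simp add: power2_eq_1_iff)
qed

text \<open>If \<open>A T = k T A\<close> and \<open>B T = l T B\<close> then \<open>A B T = k l T A B\<close>, and all factors are \<open>\<plusminus>1\<close>.\<close>

lemma mat_commute_plus:
  assumes "g + t = t + g" "h + t = t + h"
  shows "mat_commute (g + h) t \<longleftrightarrow> (mat_commute g t \<longleftrightarrow> mat_commute h t)"
proof -
  obtain a b c d where g: "a * d - b * c \<noteq> 0" "g = hom_pgl a b c d" by (rule hom_pgl_exists)
  obtain a' b' c' d' where h: "a' * d' - b' * c' \<noteq> 0" "h = hom_pgl a' b' c' d'" by (rule hom_pgl_exists)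
  obtain p q r s where t: "p * s - q * r \<noteq> 0" "t = hom_pgl p q r s" by (rule hom_pgl_exists)
  obtain k where k: "k = 1 \<or> k = -1"
    "a * p + b * r = k * (p * a + q * c)" "a * q + b * s = k * (p * b + q * d)"
    "c * p + d * r = k * (r * a + s * c)" "c * q + d * s = k * (r * b + s * d)"
    using commute_imp_mat_commute_up_to_sign[OF g(1) t(1)] assms(1) g t by metis
  obtain l where l: "l = 1 \<or> l = -1"
    "a' * p + b' * r = l * (p * a' + q * c')" "a' * q + b' * s = l * (p * b' + q * d')"
    "c' * p + d' * r = l * (r * a' + s * c')" "c' * q + d' * s = l * (r * b' + s * d')"
    using commute_imp_mat_commute_up_to_sign[OF h(1) t(1)] assms(2) h t by metis
  have sgn: "mat_commute (hom_pgl x y z w) t \<longleftrightarrow> m = 1"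
    if n: "x * w - y * z \<noteq> 0" and m: "m = 1 \<or> m = -1"
      "x * p + y * r = m * (p * x + q * z)" "x * q + y * s = m * (p * y + q * w)"
      "z * p + w * r = m * (r * x + s * z)" "z * q + w * s = m * (r * y + s * w)" for x y z w m
  proof
    assume "mat_commute (hom_pgl x y z w) t"
    then have e: "y * r = q * z" "x * q + y * s = p * y + q * w" "z * p + w * r = r * x + s * z"
      unfolding t(2) mat_commute_hom_pgl[OF n t(1)] by auto
    show "m = 1"
    proof (rule ccontr)
      assume "m \<noteq> 1"
      then have "m = -1" using m(1) by simp
      then have z: "p * x + q * z = 0" "p * y + q * w = 0" "r * x + s * z = 0" "r * y + s * w = 0"
        using m(2-5) e by (simp_all add: mult.commute add.commute)
      have "(p * x + q * z) * (r * y + s * w) - (p * y + q * w) * (r * x + s * z)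
        = (p * s - q * r) * (x * w - y * z)" by (simp add: algebra_simps)
      then show False using z n t(1) by simp
    qed
  next
    assume "m = 1"
    then show "mat_commute (hom_pgl x y z w) t"
      unfolding t(2) mat_commute_hom_pgl[OF n t(1)] using m by (simp add: mult.commute add.commute)
  qed
  have "(a * a' + b * c') * p + (a * b' + b * d') * r = a * (a' * p + b' * r) + b * (c' * p + d' * r)"
    "(a * a' + b * c') * q + (a * b' + b * d') * s = a * (a' * q + b' * s) + b * (c' * q + d' * s)"
    "(c * a' + d * c') * p + (c * b' + d * d') * r = c * (a' * p + b' * r) + d * (c' * p + d' * r)"
    "(c * a' + d * c') * q + (c * b' + d * d') * s = c * (a' * q + b' * s) + d * (c' * q + d' * s)"
    by (simp_all add: algebra_simps)
  moreover have "a * (l * (p * a' + q * c')) + b * (l * (r * a' + s * c')) = l * ((a * p + b * r) * a' + (a * q + b * s) * c')"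
    "a * (l * (p * b' + q * d')) + b * (l * (r * b' + s * d')) = l * ((a * p + b * r) * b' + (a * q + b * s) * d')"
    "c * (l * (p * a' + q * c')) + d * (l * (r * a' + s * c')) = l * ((c * p + d * r) * a' + (c * q + d * s) * c')"
    "c * (l * (p * b' + q * d')) + d * (l * (r * b' + s * d')) = l * ((c * p + d * r) * b' + (c * q + d * s) * d')"
    by (simp_all add: algebra_simps)
  ultimately have prod: 
    "(a * a' + b * c') * p + (a * b' + b * d') * r = k * l * (p * (a * a' + b * c') + q * (c * a' + d * c'))"
    "(a * a' + b * c') * q + (a * b' + b * d') * s = k * l * (p * (a * b' + b * d') + q * (c * b' + d * d'))"
    "(c * a' + d * c') * p + (c * b' + d * d') * r = k * l * (r * (a * a' + b * c') + s * (c * a' + d * c'))"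
    "(c * a' + d * c') * q + (c * b' + d * d') * s = k * l * (r * (a * b' + b * d') + s * (c * b' + d * d'))"
    unfolding l(2-5) k(2-5) by (simp_all add: algebra_simps)
  have "mat_commute (g + h) t \<longleftrightarrow> k * l = 1"
    unfolding g(2) h(2) hom_pgl_plus[OF g(1) h(1)]
    by (rule sgn[OF det_mult_nonzero[OF g(1) h(1)] _ prod]) (use k(1) l(1) in auto)
  moreover have "mat_commute g t \<longleftrightarrow> k = 1" "mat_commute h t \<longleftrightarrow> l = 1"
    unfolding g(2) h(2) using sgn[OF g(1) k] sgn[OF h(1) l] by auto
  ultimately show ?thesis using k(1) l(1) by auto
qed

text \<open>The matrices commuting with a non-scalar one differ from scalars by multiples of it.\<close>

lemma mat_commute_trans:
  assumes "mat_commute g t" "mat_commute h t" "t \<noteq> 0"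
  shows "g + h = h + g"
proof -
  obtain a b c d where g: "a * d - b * c \<noteq> 0" "g = hom_pgl a b c d" by (rule hom_pgl_exists)
  obtain a' b' c' d' where h: "a' * d' - b' * c' \<noteq> 0" "h = hom_pgl a' b' c' d'" by (rule hom_pgl_exists)
  obtain p q r s where t: "p * s - q * r \<noteq> 0" "t = hom_pgl p q r s" by (rule hom_pgl_exists)
  have e: "b * r = q * c" "b * (p - s) = q * (a - d)" "c * (p - s) = r * (a - d)"
    "b' * r = q * c'" "b' * (p - s) = q * (a' - d')" "c' * (p - s) = r * (a' - d')"
    using assms(1,2) unfolding g(2) h(2) t(2) mat_commute_hom_pgl[OF g(1) t(1)] mat_commute_hom_pgl[OF h(1) t(1)]
    by (auto simp: algebra_simps)
  have "\<not> (q = 0 \<and> r = 0 \<and> p = s)"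
    using assms(3) t hom_pgl_scalar[of s] by auto
  then have "q * q + r * r + (p - s) * (p - s) \<noteq> 0"
    by (smt (verit) zero_le_square mult_eq_0_iff)
  moreover have "(q * q + r * r + (p - s) * (p - s)) * (b * c' - b' * c) = 0"
    "(q * q + r * r + (p - s) * (p - s)) * (b * (a' - d') - b' * (a - d)) = 0"
    "(q * q + r * r + (p - s) * (p - s)) * (c * (a' - d') - c' * (a - d)) = 0"
    using e by algebra+
  ultimately have "b * c' = b' * c" "b * (a' - d') = b' * (a - d)" "c * (a' - d') = c' * (a - d)" by simp_all
  then have "mat_commute g h" unfolding g(2) h(2) mat_commute_hom_pgl[OF g(1) h(1)] by (simp add: algebra_simps)
  then show ?thesis by (rule mat_commute_imp_commute)
qed

definition hyperbolic :: "pgl \<Rightarrow> bool"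
  where "hyperbolic g \<longleftrightarrow> (\<exists>a b c d. a * d - b * c = 1 \<and> a + d > 2 \<and> g = hom_pgl a b c d)"

text \<open>The definition of \<^const>\<open>hyperbolic\<close> covers negative traces, because a matrix and its negative
  define the same homography.\<close>

lemma not_hyperbolic_trace:
  assumes "a * d - b * c = 1" "\<not> hyperbolic (hom_pgl a b c d)"
  shows "(a + d)^2 \<le> 4"
proof -
  have "hom_pgl (-a) (-b) (-c) (-d) = hom_pgl a b c d" using hom_pgl_scale[of "-1" a b c d] by simp
  moreover have "(-a) * (-d) - (-b) * (-c) = 1" using assms(1) by simp
  ultimately have "- a + - d \<le> 2" using assms(2) unfolding hyperbolic_def by (metis not_le)
  moreover have "a + d \<le> 2" using assms unfolding hyperbolic_def by (metis not_le)
  ultimately have "\<bar>a + d\<bar> \<le> \<bar>2\<bar>" by simp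
  then show ?thesis using power2_le_iff_abs_le[of 2 "a + d"] by simp
qed

text \<open>The traceless parts of two non-hyperbolic elements of the special linear group lie in the
  closed time cone of the quadratic form \<open>p\<^sup>2 + q r\<close>, so their commutator is space-like or zero.\<close>

lemma time_cone_bracket:
  fixes p q r p' q' r' :: real
  assumes "p^2 + q * r \<le> 0" "p'^2 + q' * r' \<le> 0"
    and br: "(q * r' - q' * r)^2 + 4 * (p * q' - p' * q) * (r * p' - r' * p) \<le> 0"
  shows "q * r' = q' * r" "p * q' = p' * q" "r * p' = r' * p"
proof -
  let ?l = "q * r' - q' * r" and ?m = "p * q' - p' * q" and ?n = "r * p' - r' * p"
  have "?l = 0 \<and> ?m = 0 \<and> ?n = 0"
  proof (cases "q = 0")
    case True
    then have p: "p = 0" using assms(1) by (simp add: power2_eq_square) (smt (verit) zero_le_square mult_eq_0_iff)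
    then have "q' * r = 0" using br True by (simp add: power2_eq_square) (smt (verit) zero_le_square mult_eq_0_iff)
    moreover have "p' = 0" if "q' = 0" using assms(2) that by (simp add: power2_eq_square) (smt (verit) zero_le_square mult_eq_0_iff)
    ultimately show ?thesis using True p by auto
  next
    case False
    have "q^2 * (?l^2 + 4 * ?m * ?n) = (q * ?l - 2 * p * ?m)^2 + 4 * (- (p^2 + q * r)) * ?m^2" by algebra
    moreover have "q^2 * (?l^2 + 4 * ?m * ?n) \<le> 0" using br by (simp add: mult_nonneg_nonpos)
    moreover have "4 * (- (p^2 + q * r)) * ?m^2 \<ge> 0" using assms(1) by (intro mult_nonneg_nonneg) auto
    ultimately have z: "(q * ?l - 2 * p * ?m)^2 = 0" "4 * (- (p^2 + q * r)) * ?m^2 = 0"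
      using zero_le_power2[of "q * ?l - 2 * p * ?m"] by linarith+
    then have ql: "q * ?l = 2 * p * ?m" by simp
    have "?m = 0"
    proof (rule ccontr)
      assume m: "?m \<noteq> 0"
      then have "p^2 + q * r = 0" using z(2) by simp
      then have "q' * (p^2 + q * r) = 0" by simp
      moreover have "q * (q * ?l - 2 * p * ?m) = 0" using ql by simp
      ultimately have "q^2 * (p'^2 + q' * r') - ?m^2 = 0" using \<open>p^2 + q * r = 0\<close> by algebra
      moreover have "q^2 * (p'^2 + q' * r') \<le> 0" using assms(2) by (simp add: mult_nonneg_nonpos)
      ultimately show False using m by (smt (verit) zero_less_power2)
    qed
    then have l: "?l = 0" using ql False by simp
    have "q * ?n = - (p * ?l) - r * ?m" by algebra
    then show ?thesis using \<open>?m = 0\<close> l False by simp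
  qed
  then show "q * r' = q' * r" "p * q' = p' * q" "r * p' = r' * p" by auto
qed

text \<open>For matrices \<open>A\<close>, \<open>B\<close> of determinant 1, the trace of the commutator is
  \<open>2 - det (A B - B A)\<close>. By \<open>time_cone_bracket\<close> this exceeds 2, so the commutator is hyperbolic,
  unless \<open>A\<close> and \<open>B\<close> commute.\<close>

lemma no_hyperbolic_commute:
  assumes "pos_det g" "pos_det h" "\<not> hyperbolic g" "\<not> hyperbolic h" "\<not> hyperbolic (g + h + - g + - h)"
  shows "g + h = h + g"
proof -
  have norm: "\<exists>a b c d. a * d - b * c = 1 \<and> x = hom_pgl a b c d" if "pos_det x" for x
  proof -
    obtain a b c d where "\<bar>a * d - b * c\<bar> = 1" "x = hom_pgl a b c d" by (rule hom_pgl_normalized)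
    moreover from this have "a * d - b * c > 0" using that pos_det_hom_pgl[of a d b c] by auto
    ultimately show ?thesis by auto
  qed
  obtain a b c d where g: "a * d - b * c = 1" "g = hom_pgl a b c d" using norm[OF assms(1)] by blast
  obtain a' b' c' d' where h: "a' * d' - b' * c' = 1" "h = hom_pgl a' b' c' d'" using norm[OF assms(2)] by blast
  define p q r p' q' r' where v: "p = (a - d) / 2" "q = b" "r = c" "p' = (a' - d') / 2" "q' = b'" "r' = c'"
  have t: "(a + d)^2 \<le> 4" "(a' + d')^2 \<le> 4" using not_hyperbolic_trace g h assms by auto
  have "(a + d)^2 = 4 * (p^2 + q * r) + 4 * (a * d - b * c)" "(a' + d')^2 = 4 * (p'^2 + q' * r') + 4 * (a' * d' - b' * c')"
    unfolding v by (simp_all add: power2_eq_square field_simps)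
  then have cone: "p^2 + q * r \<le> 0" "p'^2 + q' * r' \<le> 0" using t g h by auto
  have n: "a * d - b * c \<noteq> 0" "a' * d' - b' * c' \<noteq> 0" "d * a - (- b) * (- c) \<noteq> 0" "d' * a' - (- b') * (- c') \<noteq> 0"
    using g h by (auto simp: mult.commute)
  define A B C D where ABCD: "A = a * a' + b * c'" "B = a * b' + b * d'" "C = c * a' + d * c'" "D = c * b' + d * d'"
  define A' B' C' D' where ABCD': "A' = a' * a + b' * c" "B' = a' * b + b' * d" "C' = c' * a + d' * c" "D' = c' * b + d' * d"
  have dets: "A * D - B * C = 1" "A' * D' - B' * C' = 1"
  proof -
    have "A * D - B * C = (a * d - b * c) * (a' * d' - b' * c')" "A' * D' - B' * C' = (a * d - b * c) * (a' * d' - b' * c')"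
      unfolding ABCD ABCD' by (simp_all add: algebra_simps)
    then show "A * D - B * C = 1" "A' * D' - B' * C' = 1" using g h by simp_all
  qed
  have AD: "g + h = hom_pgl A B C D" "h + g = hom_pgl A' B' C' D'"
    unfolding g(2) h(2) ABCD ABCD' using hom_pgl_plus[OF n(1,2)] hom_pgl_plus[OF n(2,1)] by simp_all
  have "g + h + - g + - h = (g + h) + - (h + g)" by (simp only: minus_add add.assoc)
  also have "\<dots> = hom_pgl A B C D + hom_pgl D' (- B') (- C') A'"
    unfolding AD using dets hom_pgl_uminus[of A' D' B' C'] by simp
  also have "\<dots> = hom_pgl (A * D' + B * - C') (A * - B' + B * A') (C * D' + D * - C') (C * - B' + D * A')"
    using dets by (intro hom_pgl_plus) (auto simp: mult.commute)
  finally have com: "g + h + - g + - h = hom_pgl (A * D' + B * - C') (A * - B' + B * A') (C * D' + D * - C') (C * - B' + D * A')" .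
  have "(A * D' + B * - C') * (C * - B' + D * A') - (A * - B' + B * A') * (C * D' + D * - C') = (A * D - B * C) * (A' * D' - B' * C')"
    by (simp add: algebra_simps)
  then have "((A * D' + B * - C') + (C * - B' + D * A'))^2 \<le> 4"
    using not_hyperbolic_trace[of "A * D' + B * - C'" "C * - B' + D * A'" "A * - B' + B * A'" "C * D' + D * - C'"] com assms(5) dets
    by simp
  then have tr: "(A * D' + B * - C') + (C * - B' + D * A') \<le> 2"
    using power2_le_iff_abs_le[of 2 "(A * D' + B * - C') + (C * - B' + D * A')"] by simp
  have "(A - A') * (D - D') - (B - B') * (C - C')
      = (A * D - B * C) + (A' * D' - B' * C') - ((A * D' + B * - C') + (C * - B' + D * A'))"
    by (simp add: algebra_simps)
  then have "(A - A') * (D - D') - (B - B') * (C - C') \<ge> 0" using tr dets by simp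
  moreover have "(A - A') * (D - D') - (B - B') * (C - C') = - ((q * r' - q' * r)^2 + 4 * (p * q' - p' * q) * (r * p' - r' * p))"
    unfolding ABCD ABCD' v by (simp add: power2_eq_square field_simps)
  ultimately have "(q * r' - q' * r)^2 + 4 * (p * q' - p' * q) * (r * p' - r' * p) \<le> 0" by simp
  from time_cone_bracket[OF cone this]
  have "mat_commute g h"
    unfolding g(2) h(2) mat_commute_hom_pgl[OF n(1,2)] v by (auto simp: field_simps)
  then show ?thesis by (rule mat_commute_imp_commute)
qed

text \<open>A hyperbolic homography has two fixed points; conjugate by a homography that sends them to
  infinity and 0. If the lower left entry \<open>c\<close> is 0, infinity is one of them, otherwise they are the
  roots \<open>p\<close>, \<open>q\<close> of \<open>c x\<^sup>2 + (d - a) x - b\<close>.\<close>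

lemma hyperbolic_conjugate_to_scaling:
  assumes "hyperbolic g"
  obtains x k where "k > 0" "k \<noteq> 1" "x + g + - x = hom_pgl k 0 0 1"
proof -
  obtain a b c d where g: "a * d - b * c = 1" "a + d > 2" "g = hom_pgl a b c d"
    using assms by (auto simp: hyperbolic_def)
  have "\<exists>x k. k > 0 \<and> k \<noteq> 1 \<and> x + g = hom_pgl k 0 0 1 + x"
  proof (cases "c = 0")
    case True
    then have ad: "a * d = 1" using g by simp
    have "a \<noteq> d" using ad g(2) less_1_mult[of a a] by auto
    define t where "t = b / (a - d)"
    have t: "b + t * d = a * t" using \<open>a \<noteq> d\<close> by (simp add: t_def field_simps)
    have d0: "d \<noteq> 0" "a \<noteq> 0" using ad by auto
    have k: "a / d = a^2" using ad d0 by (simp add: field_simps power2_eq_square)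
    have "hom_pgl 1 t 0 1 + g = hom_pgl a (b + t * d) 0 d"
      using g True d0 hom_pgl_plus[of 1 1 t 0 a d b c] by simp
    moreover have "hom_pgl (a / d) 0 0 1 + hom_pgl 1 t 0 1 = hom_pgl (a / d) ((a * t) / d) 0 1"
      using d0 hom_pgl_plus[of "a / d" 1 0 0 1 1 t 0] by simp
    moreover have "hom_pgl a (a * t) 0 d = hom_pgl (a / d) ((a * t) / d) 0 1"
      using d0 hom_pgl_scale[of d "a / d" "(a * t) / d" 0 1] by simp
    ultimately have "hom_pgl 1 t 0 1 + g = hom_pgl (a / d) 0 0 1 + hom_pgl 1 t 0 1" by (simp add: t)
    moreover have "a / d > 0" using k d0 by simp
    moreover have "a / d \<noteq> 1" using \<open>a \<noteq> d\<close> d0 by simp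
    ultimately show ?thesis by blast
  next
    case False
    define e where "e = sqrt ((a + d)^2 - 4)"
    have "(a + d)^2 > 2^2" using g(2) by (intro power_strict_mono) auto
    then have e: "e > 0" "e^2 = (a + d)^2 - 4" by (simp_all add: e_def)
    define p q where pq: "p = ((a - d) + e) / (2 * c)" "q = ((a - d) - e) / (2 * c)"
    have "p \<noteq> q" using e(1) False by (simp add: pq field_simps)
    have cpq: "2 * (c * p) = a - d + e" "2 * (c * q) = a - d - e" using False by (simp_all add: pq)
    have "c * (b - q * d + (a - q * c) * q) = 0" "c * (b - p * d + (a - p * c) * p) = 0"
      using cpq e(2) g(1) by algebra+
    then have "b - q * d + (a - q * c) * q = 0" "b - p * d + (a - p * c) * p = 0"
      using False by simp_all
    then have q: "b - q * d = - (a - q * c) * q" and p: "b - p * d = - (a - p * c) * p"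
      by (simp_all only: mult_minus_left eq_neg_iff_add_eq_0)
    have mn: "(a - q * c) * (a - p * c) = 1"
    proof -
      have "(a - q * c) * (a - p * c) = ((a + d)^2 - e^2) / 4" using cpq by algebra
      then show ?thesis using e(2) by simp
    qed
    define m n where mndef: "m = a - q * c" "n = a - p * c"
    have mn: "m * n = 1" "m \<noteq> 0" "n \<noteq> 0" using mn unfolding mndef by auto
    have det: "1 * - p - - q * 1 \<noteq> 0" using \<open>p \<noteq> q\<close> by simp
    have "hom_pgl 1 (-q) 1 (-p) + g = hom_pgl (a - q * c) (b - q * d) (a - p * c) (b - p * d)"
      using hom_pgl_plus[OF det, of a d b c] g by simp
    also have "\<dots> = hom_pgl m (- m * q) n (- n * p)" unfolding p q mndef by simp
    also have "\<dots> = hom_pgl (n * (m / n)) (n * (m / n * - q)) (n * 1) (n * - p)" using mn by simp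
    also have "\<dots> = hom_pgl (m / n) (m / n * - q) 1 (- p)" by (rule hom_pgl_scale[OF mn(3)])
    also have "\<dots> = hom_pgl (m / n) 0 0 1 + hom_pgl 1 (-q) 1 (-p)"
      using hom_pgl_plus[OF _ det, of "m / n" 1 0 0] mn by simp
    finally have "hom_pgl 1 (-q) 1 (-p) + g = hom_pgl (m / n) 0 0 1 + hom_pgl 1 (-q) 1 (-p)" .
    moreover have "m / n = m^2" using mn by (simp add: field_simps power2_eq_square)
    then have "m / n > 0" using mn by simp
    moreover have "m / n \<noteq> 1" using mn \<open>p \<noteq> q\<close> False by (simp add: mndef)
    ultimately show ?thesis by blast
  qed
  then obtain x k where "k > 0" "k \<noteq> 1" "x + g = hom_pgl k 0 0 1 + x" by blast
  then show thesis using that[of k x] by (simp add: add.assoc)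
qed

section \<open>Homomorphisms to the group of homographies\<close>

text \<open>The volume formula for boxes determines the Lebesgue measure, also on sets of infinite measure.\<close>

lemma lborel_linear_image:
  fixes f f' :: "real^'n::{finite,wellorder} \<Rightarrow> real^'n::_"
  assumes lin: "linear f" "linear f'" and inv: "\<And>x. f (f' x) = x" "\<And>x. f' (f x) = x"
    and det: "\<bar>det (matrix f')\<bar> = 1" and A: "A \<in> sets lborel"
  shows "f ` A \<in> sets lborel" "emeasure lborel (f ` A) = emeasure lborel A"
proof -
  have cont: "f \<in> borel_measurable borel" "f' \<in> borel_measurable borel"
    using lin by (auto intro!: borel_measurable_continuous_onI linear_continuous_on simp: linear_conv_bounded_linear)
  have eq: "f ` B = f' -` B" for B using inv by (intro Set.set_eqI) (metis image_iff vimage_eq)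
  have eq': "f' ` B = f -` B" for B using inv by (intro Set.set_eqI) (metis image_iff vimage_eq)
  have "lborel = distr lborel borel f"
  proof (rule lborel_eqI)
    fix l u :: "real^'n::{finite,wellorder}" assume lu: "\<And>b. b \<in> Basis \<Longrightarrow> l \<bullet> b \<le> u \<bullet> b"
    have m: "f' ` box l u \<in> lmeasurable" "measure lebesgue (f' ` box l u) = measure lebesgue (box l u)"
      using measurable_linear_image[OF lin(2)] measure_linear_image[OF lin(2)] det by auto
    have b: "f' ` box l u \<in> sets borel"
      unfolding eq' using measurable_sets[OF cont(1), of "box l u"] by simp
    have "emeasure (distr lborel borel f) (box l u) = emeasure lborel (f' ` box l u)"
      using cont by (simp add: emeasure_distr eq')
    also have "\<dots> = emeasure lebesgue (f' ` box l u)" using b by simp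
    also have "\<dots> = ennreal (measure lebesgue (f' ` box l u))"
      using m(1) by (rule emeasure_eq_measure2)
    also have "\<dots> = emeasure lebesgue (box l u)"
      unfolding m(2) by (intro emeasure_eq_measure2[symmetric]) simp
    also have "\<dots> = ennreal (\<Prod>b\<in>Basis. (u - l) \<bullet> b)" using lu by simp
    finally show "emeasure (distr lborel borel f) (box l u) = ennreal (\<Prod>b\<in>Basis. (u - l) \<bullet> b)" .
  qed simp
  then have "emeasure lborel (f ` A) = emeasure (distr lborel borel f) (f ` A)" by simp
  also show fA: "f ` A \<in> sets lborel"
    unfolding eq using measurable_sets[OF cont(2), of A] A by simp
  have "f -` (f ` A) = A" using inv by (auto, metis)
  then have "emeasure (distr lborel borel f) (f ` A) = emeasure lborel A"
    using cont fA by (simp add: emeasure_distr)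
  finally show "emeasure lborel (f ` A) = emeasure lborel A" .
qed

text \<open>The vector \<open>(x, y, z)\<close> stands for the symmetric matrix \<open>S\<close> with rows \<open>(x, y)\<close> and \<open>(y, z)\<close>, and
  a matrix \<open>A\<close> maps it to \<open>A S A\<^sup>T\<close>. If \<open>A\<close> is normalized to have determinant \<open>\<plusminus>1\<close>, the homography determines
  \<open>A\<close> up to sign, and the sign cancels. Up to positive factors, symmetric matrices \<open>S\<close> of negative
  determinant correspond to oriented geodesics, that is to half-planes, of the hyperbolic plane, whose
  points are the positive definite matrices; the base point is the unit matrix.\<close>

definition sym2 :: "real \<Rightarrow> real \<Rightarrow> real \<Rightarrow> real \<Rightarrow> real^3 \<Rightarrow> real^3"
  where "sym2 a b c d S = vector
    [a^2 * S$1 + 2 * a * b * S$2 + b^2 * S$3,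
     a * c * S$1 + (a * d + b * c) * S$2 + b * d * S$3,
     c^2 * S$1 + 2 * c * d * S$2 + d^2 * S$3]"

definition form_act :: "pgl \<Rightarrow> real^3 \<Rightarrow> real^3"
  where "form_act g = (THE f. \<exists>a b c d. \<bar>a * d - b * c\<bar> = 1 \<and> g = hom_pgl a b c d \<and> f = sym2 a b c d)"

lemma form_act_hom_pgl:
  assumes "\<bar>a * d - b * c\<bar> = 1"
  shows "form_act (hom_pgl a b c d) = sym2 a b c d"
  unfolding form_act_def
proof (rule the_equality)
  fix f assume "\<exists>p q r s. \<bar>p * s - q * r\<bar> = 1 \<and> hom_pgl a b c d = hom_pgl p q r s \<and> f = sym2 p q r s"
  then obtain p q r s where f: "\<bar>p * s - q * r\<bar> = 1" "hom_pgl a b c d = hom_pgl p q r s" "f = sym2 p q r s"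
    by blast
  have n: "a * d - b * c \<noteq> 0" "p * s - q * r \<noteq> 0" using f assms by auto
  obtain k where k: "p = k * a" "q = k * b" "r = k * c" "s = k * d" using hom_pgl_eqD[OF n f(2)] by metis
  have "p * s - q * r = k^2 * (a * d - b * c)" unfolding k by (simp add: power2_eq_square algebra_simps)
  then have "k^2 = 1" using f(1) assms by (simp add: abs_mult)
  then have "sym2 p q r s S = sym2 a b c d S" for S
    unfolding k sym2_def by (auto simp: power2_eq_1_iff)
  then show "f = sym2 a b c d" using f(3) by auto
qed (use assms in blast)

lemma form_act_plus: "form_act (g + h) S = form_act g (form_act h S)"
proof -
  obtain a b c d where g: "\<bar>a * d - b * c\<bar> = 1" "g = hom_pgl a b c d" by (rule hom_pgl_normalized)
  obtain a' b' c' d' where h: "\<bar>a' * d' - b' * c'\<bar> = 1" "h = hom_pgl a' b' c' d'" by (rule hom_pgl_normalized)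
  have "(a * a' + b * c') * (c * b' + d * d') - (a * b' + b * d') * (c * a' + d * c')
    = (a * d - b * c) * (a' * d' - b' * c')" by (simp add: algebra_simps)
  then have "\<bar>(a * a' + b * c') * (c * b' + d * d') - (a * b' + b * d') * (c * a' + d * c')\<bar> = 1"
    using g(1) h(1) by (simp add: abs_mult)
  from form_act_hom_pgl[OF this]
  have gh: "form_act (g + h) = sym2 (a * a' + b * c') (a * b' + b * d') (c * a' + d * c') (c * b' + d * d')"
    using g h by (subst g(2), subst h(2), subst hom_pgl_plus) auto
  show ?thesis
    unfolding gh unfolding g(2) h(2) form_act_hom_pgl[OF g(1)] form_act_hom_pgl[OF h(1)]
    by (simp add: sym2_def vec_eq_iff forall_3 vector_3 algebra_simps power2_eq_square)
qed

lemma form_act_zero: "form_act 0 S = S"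
  using form_act_hom_pgl[of 1 1 0 0] hom_pgl_scalar[of 1]
  by (simp add: sym2_def vec_eq_iff forall_3 vector_3)

lemma form_act_inv: "form_act (- g) (form_act g S) = S" "form_act g (form_act (- g) S) = S"
  by (simp_all flip: form_act_plus add: form_act_zero)

lemma linear_sym2: "linear (sym2 a b c d)"
  by (rule linearI) (simp_all add: sym2_def vec_eq_iff forall_3 vector_3 algebra_simps)

lemma linear_form_act: "linear (form_act g)"
proof -
  obtain a b c d where "\<bar>a * d - b * c\<bar> = 1" "g = hom_pgl a b c d" by (rule hom_pgl_normalized)
  then show ?thesis by (simp add: form_act_hom_pgl linear_sym2)
qed

lemma det_form_act: "\<bar>det (matrix (form_act g))\<bar> = 1"
proof -
  obtain a b c d where g: "\<bar>a * d - b * c\<bar> = 1" "g = hom_pgl a b c d" by (rule hom_pgl_normalized)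
  have "det (matrix (sym2 a b c d)) = (a * d - b * c)^3"
    by (simp add: det_3 matrix_def sym2_def vector_3 axis_def algebra_simps power2_eq_square power3_eq_cube)
  then show ?thesis using g by (simp add: form_act_hom_pgl power_abs)
qed

definition form_det :: "real^3 \<Rightarrow> real" where "form_det S = S$1 * S$3 - (S$2)^2"
definition form_tr :: "real^3 \<Rightarrow> real" where "form_tr S = S$1 + S$3"

lemma form_det_act: "form_det (form_act g S) = form_det S"
proof -
  obtain a b c d where g: "\<bar>a * d - b * c\<bar> = 1" "g = hom_pgl a b c d" by (rule hom_pgl_normalized)
  have "form_det (sym2 a b c d S) = (a * d - b * c)^2 * form_det S"
    by (simp add: form_det_def sym2_def vector_3) algebra
  moreover have "(a * d - b * c)^2 = 1" using g(1) by (metis power2_abs one_power2)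
  ultimately show ?thesis using g by (simp add: form_act_hom_pgl)
qed

text \<open>These matrices correspond to the half-planes bounded by a geodesic that separates the base point of the hyperbolic
  plane from its image under the inverse of \<open>g\<close>. With \<open>P = A\<^sup>T A\<close> for a normalized matrix \<open>A\<close> of \<open>g\<close>, the
  condition is that \<open>tr S\<close> and \<open>tr (P S)\<close> do not have the same sign. In terms of \<open>T = tr S\<close>, of
  \<open>s = tr P\<close> and of the traceless parts, whose squared lengths are \<open>r\<^sup>2 = T\<^sup>2 - 4 det S < T\<^sup>2 + 4\<close> and
  \<open>s\<^sup>2 - 4\<close>, the Cauchy--Schwarz inequality gives \<open>s\<^sup>2 T\<^sup>2 \<le> (s\<^sup>2 - 4) r\<^sup>2\<close>, hence \<open>T\<^sup>2 + 4 \<le> s\<^sup>2\<close>.\<close>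

lemma trace_separated_forms_bounded:
  "bounded {S. - 1 < form_det S \<and> form_det S < 0 \<and> form_tr S * form_tr (form_act g S) \<le> 0}"
proof -
  obtain a b c d where g: "\<bar>a * d - b * c\<bar> = 1" "g = hom_pgl a b c d" by (rule hom_pgl_normalized)
  define \<alpha> \<beta> \<gamma> where abc: "\<alpha> = a^2 + c^2" "\<beta> = a * b + c * d" "\<gamma> = b^2 + d^2"
  define s where "s = \<alpha> + \<gamma>"
  have "\<alpha> * \<gamma> - \<beta>^2 = (a * d - b * c)^2" unfolding abc by algebra
  then have one: "\<alpha> * \<gamma> - \<beta>^2 = 1" using g(1) by (metis power2_abs one_power2)
  have s0: "s \<ge> 0" by (simp add: s_def abc)
  have "norm S \<le> 3 * s"
    if S: "- 1 < form_det S" "form_det S < 0" "form_tr S * form_tr (form_act g S) \<le> 0" for S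
  proof -
    define x y z where xyz: "x = S$1" "y = S$2" "z = S$3"
    define T w where Tw: "T = x + z" "w = x - z"
    have q: "w^2 + 4 * y^2 < T^2 + 4"
      using S(1) by (simp add: form_det_def xyz[symmetric] Tw power2_eq_square algebra_simps)
    have "form_tr (form_act g S) = \<alpha> * x + 2 * \<beta> * y + \<gamma> * z"
      unfolding g(2) form_act_hom_pgl[OF g(1)] form_tr_def sym2_def abc xyz by (simp add: vector_3 algebra_simps)
    then have neg: "T * (\<alpha> * x + 2 * \<beta> * y + \<gamma> * z) \<le> 0" using S(3) by (simp add: form_tr_def xyz Tw)
    have e: "s * T + ((\<alpha> - \<gamma>) * w + 4 * \<beta> * y) = 2 * (\<alpha> * x + 2 * \<beta> * y + \<gamma> * z)"
      unfolding s_def Tw by (simp add: algebra_simps)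
    have "T * (s * T + ((\<alpha> - \<gamma>) * w + 4 * \<beta> * y)) = 2 * (T * (\<alpha> * x + 2 * \<beta> * y + \<gamma> * z))"
      unfolding e by (rule mult.left_commute)
    also have "\<dots> \<le> 0" by (rule mult_nonneg_nonpos[OF _ neg]) simp
    finally have "T * (s * T + ((\<alpha> - \<gamma>) * w + 4 * \<beta> * y)) \<le> 0" .
    then have le: "s * T * T + ((\<alpha> - \<gamma>) * w + 4 * \<beta> * y) * T \<le> 0" by (simp add: algebra_simps)
    let ?u = "(\<alpha> - \<gamma>) * w + 4 * \<beta> * y"
    have "(s * T)^2 \<le> ?u^2"
    proof (cases "T = 0")
      case False
      have "s * T * T \<le> \<bar>?u * T\<bar>" using le by linarith
      then have "(s * \<bar>T\<bar>) * \<bar>T\<bar> \<le> \<bar>?u\<bar> * \<bar>T\<bar>" unfolding abs_mult by (simp add: mult.assoc)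
      then have "s * \<bar>T\<bar> \<le> \<bar>?u\<bar>" using False by simp
      then have "\<bar>s * T\<bar> \<le> \<bar>?u\<bar>" using s0 by (simp add: abs_mult)
      then show ?thesis by (simp add: abs_le_square_iff)
    qed simp
    also have "?u^2 \<le> ((\<alpha> - \<gamma>)^2 + 4 * \<beta>^2) * (w^2 + 4 * y^2)"
    proof -
      have "((\<alpha> - \<gamma>)^2 + 4 * \<beta>^2) * (w^2 + 4 * y^2) - ?u^2 = (2 * (\<alpha> - \<gamma>) * y - 2 * \<beta> * w)^2"
        by (simp add: power2_eq_square algebra_simps)
      then show ?thesis by (smt (verit) zero_le_power2)
    qed
    also have "(\<alpha> - \<gamma>)^2 + 4 * \<beta>^2 = s^2 - 4" using one unfolding s_def by (simp add: power2_eq_square algebra_simps)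
    finally have *: "(s * T)^2 \<le> (s^2 - 4) * (w^2 + 4 * y^2)" .
    have "s^2 - 4 = (\<alpha> - \<gamma>)^2 + 4 * \<beta>^2" using one unfolding s_def by (simp add: power2_eq_square algebra_simps)
    then have "s^2 - 4 \<ge> 0" by simp
    then have "(s^2 - 4) * (w^2 + 4 * y^2) \<le> (s^2 - 4) * (T^2 + 4)" using q by (intro mult_left_mono) auto
    then have "s^2 * T^2 \<le> (s^2 - 4) * (T^2 + 4)" using * by (simp add: power_mult_distrib)
    then have T: "T^2 + 4 \<le> s^2" by (simp add: algebra_simps)
    have "T^2 \<le> s^2" using T by simp
    moreover have "w^2 \<le> s^2" using T q zero_le_power2[of y] by linarith
    moreover have "(2 * y)^2 = 4 * y^2" by (simp add: power_mult_distrib)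
    then have "(2 * y)^2 \<le> s^2" using T q zero_le_power2[of w] by linarith
    ultimately have "\<bar>T\<bar> \<le> s" "\<bar>w\<bar> \<le> s" "\<bar>2 * y\<bar> \<le> s"
      using s0 abs_le_square_iff[of _ s] by auto
    then have "\<bar>x\<bar> \<le> s" "\<bar>y\<bar> \<le> s" "\<bar>z\<bar> \<le> s" unfolding Tw by auto
    then have "(\<Sum>i\<in>UNIV. \<bar>S$i\<bar>) \<le> 3 * s" by (simp add: sum_3 xyz)
    then show ?thesis using norm_le_l1_cart[of S] by simp
  qed
  then show ?thesis unfolding bounded_iff by blast
qed

lemma emeasure_zero_of_disjoint_copies:
  assumes A: "A \<in> sets M" "emeasure M A < \<infinity>" and B: "\<And>n::nat. B n \<in> sets M" "\<And>n. B n \<subseteq> A"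
    and eq: "\<And>n. emeasure M (B n) = m" and disj: "disjoint_family B"
  shows "m = 0"
proof (rule ccontr)
  assume "m \<noteq> 0"
  have "(\<Sum>n. emeasure M (B n)) = \<infinity>"
    using nn_integral_count_space_nat[of "\<lambda>_. m"] \<open>m \<noteq> 0\<close> by (simp add: eq ennreal_mult_top)
  moreover have "(\<Sum>n. emeasure M (B n)) = emeasure M (\<Union>n. B n)"
    using B disj by (intro suminf_emeasure) auto
  moreover have "emeasure M (\<Union>n. B n) \<le> emeasure M A" using A B by (intro emeasure_mono) auto
  ultimately show False using A(2) by simp
qed

text \<open>Let \<open>X\<close> be the set of the half-planes that contain the base point, represented by symmetric
  matrices with \<open>-1 < det S < 0\<close> and positive trace. It is commensurated, because bounded sets
  have finite measure. A scaling by \<open>k > 1\<close> multiplies \<open>(x, y, z)\<close> by \<open>(k, 1, 1/k)\<close>. The box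
  \<open>F\<close>, where \<open>x < 0 < z\<close>, is disjoint from its images under nontrivial powers of the scaling, which lie outside \<open>X\<close> for large powers,
  and inside for negative powers. Any invariant set \<open>Y\<close> at finite distance from \<open>X\<close> would therefore
  meet \<open>F\<close> in a null set, and so would its complement, although \<open>F\<close> is open and
  nonempty.\<close>

proposition property_T_no_scaling:
  fixes G :: "('g, 'm) monoid_scheme" (structure)
  assumes T: "property_T G" and hom: "\<And>g h. g \<in> carrier G \<Longrightarrow> h \<in> carrier G \<Longrightarrow> \<rho> (g \<otimes> h) = \<rho> g + \<rho> h"
    and g: "g \<in> carrier G" and k: "k > 1"
  shows "\<rho> g \<noteq> hom_pgl k 0 0 1"
proof
  assume \<rho>g: "\<rho> g = hom_pgl k 0 0 1"
  interpret group G by (rule property_TD(1)[OF T])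
  have \<rho>1: "\<rho> \<one> = 0" using hom[of \<one> \<one>] by (metis add.right_neutral add_left_cancel one_closed r_one)
  have \<rho>inv: "\<rho> (inv h) = - \<rho> h" if "h \<in> carrier G" for h
    using hom[OF that inv_closed[OF that]] that \<rho>1 by (metis r_inv minus_unique)
  define act where "act h = form_act (\<rho> h)" for h
  have act: "acts_on G UNIV act"
    by (intro acts_onI) (simp_all add: act_def \<rho>1 form_act_zero hom form_act_plus)
  have mp: "act h ` A \<in> sets lborel" "emeasure lborel (act h ` A) = emeasure lborel A"
    if "A \<in> sets lborel" for h A
    using lborel_linear_image[OF linear_form_act linear_form_act form_act_inv(2,1) det_form_act that]
    by (simp_all add: act_def)
  define X where "X = {S. - 1 < form_det S \<and> form_det S < 0 \<and> form_tr S > 0}"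
  have "open X"
    unfolding X_def form_det_def form_tr_def by (intro open_Collect_conj open_Collect_less continuous_intros)
  then have X: "X \<in> sets lborel" by simp
  have actX: "act h ` X = {S. - 1 < form_det S \<and> form_det S < 0 \<and> form_tr (form_act (- \<rho> h) S) > 0}" for h
  proof -
    have "act h ` X = form_act (- \<rho> h) -` X" 
      unfolding act_def using form_act_inv by (intro Set.set_eqI) (metis image_iff vimage_eq)
    then show ?thesis by (auto simp: X_def form_det_act)
  qed
  have fin: "emeasure lborel (sym_diff X (act h ` X)) < \<infinity>" if "h \<in> carrier G" for h
  proof -
    have "sym_diff X (act h ` X)
        \<subseteq> {S. - 1 < form_det S \<and> form_det S < 0 \<and> form_tr S * form_tr (form_act (- \<rho> h) S) \<le> 0}"
      unfolding actX by (auto simp: X_def not_less mult_nonneg_nonpos mult_nonneg_nonpos2)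
    then have "bounded (sym_diff X (act h ` X))"
      using trace_separated_forms_bounded bounded_subset by blast
    then show ?thesis by (rule emeasure_bounded_finite)
  qed
  obtain Y where Y: "Y \<in> sets lborel" "\<And>h. h \<in> carrier G \<Longrightarrow> act h ` Y = Y"
      "emeasure lborel (sym_diff X Y) < \<infinity>"
    by (rule property_T_invariant_set[OF T, of lborel act X]) (use act mp X fin in auto)
  have sdY: "sym_diff X Y \<in> sets lborel" using X Y by blast
  have pow: "\<rho> (h [^] n) = ((+) (\<rho> h) ^^ n) 0" if "h \<in> carrier G" for h and n :: nat
  proof (induction n)
    case (Suc n)
    have "h [^] Suc n = h \<otimes> h [^] n" using that by (rule nat_pow_Suc2)
    then show ?case using Suc hom that by simp
  qed (simp add: \<rho>1)
  have mul: "form_act (((+) (hom_pgl l 0 0 1) ^^ n) 0) S = vector [l ^ n * S$1, S$2, S$3 / l ^ n]"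
    if "l > 0" for l n S
  proof (induction n)
    case 0 show ?case by (simp add: form_act_zero vec_eq_iff forall_3 vector_3)
  next
    case (Suc n)
    have "hom_pgl l 0 0 1 = hom_pgl (sqrt l) 0 0 (1 / sqrt l)"
      using hom_pgl_scale[of "sqrt l" "sqrt l" 0 0 "1 / sqrt l"] \<open>l > 0\<close> by simp
    then have "form_act (hom_pgl l 0 0 1) = sym2 (sqrt l) 0 0 (1 / sqrt l)"
      using form_act_hom_pgl[of "sqrt l" "1 / sqrt l" 0 0] \<open>l > 0\<close> by simp
    then show ?case
      using Suc \<open>l > 0\<close> by (simp add: form_act_plus sym2_def vec_eq_iff forall_3 vector_3 power_divide field_simps)
  qed
  have fwd: "act (g [^] n) S = vector [k ^ n * S$1, S$2, S$3 / k ^ n]" for n :: nat and S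
    using mul[of k n S] k by (simp add: act_def pow[OF g] \<rho>g)
  have "- hom_pgl k 0 0 1 = hom_pgl (1 / k) 0 0 1"
    using k hom_pgl_uminus[of k 1 0 0] hom_pgl_scale[of k "1 / k" 0 0 1] by simp
  then have bwd: "act (inv g [^] n) S = vector [S$1 / k ^ n, S$2, S$3 * k ^ n]" for n :: nat and S
    using mul[of "1 / k" n S] k by (simp add: act_def pow[OF inv_closed[OF g]] \<rho>inv[OF g] \<rho>g power_one_over)
  \<comment> \<open>Chosen such that \<open>x z - y\<^sup>2 > - 2 u k - 1/4 = - 1/2\<close> on the box, and \<open>|x| < z\<close>.\<close>
  define u where "u = 1 / (8 * k)"
  have u: "u > 0" "u * k = 1 / 8" using k by (auto simp: u_def)
  define F :: "(real^3) set" where "F = box (vector [- 2 * u, - 1/2, 1]) (vector [- u, 1/2, k])"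
  have F_iff: "S \<in> F \<longleftrightarrow> - 2 * u < S$1 \<and> S$1 < - u \<and> - 1/2 < S$2 \<and> S$2 < 1/2 \<and> 1 < S$3 \<and> S$3 < k" for S
    unfolding F_def by (auto simp: mem_box_cart forall_3 vector_3)
  have Fm: "F \<in> sets lborel" by (simp add: F_def)
  have F_det: "- 1 < form_det S \<and> form_det S < 0" if "S \<in> F" for S
  proof -
    have S: "0 < - S$1" "- S$1 < 2 * u" "0 < S$3" "S$3 < k" "\<bar>S$2\<bar> < 1/2"
      using that u by (auto simp: F_iff)
    have "(- S$1) * S$3 < (2 * u) * k" using S by (intro mult_strict_mono) auto
    moreover have "(- S$1) * S$3 > 0" using S by (intro mult_pos_pos)
    moreover have "(S$2)^2 < (1/2)^2" using S(5) by (metis abs_ge_zero abs_le_square_iff not_le power2_abs abs_of_nonneg zero_le_divide_1_iff zero_le_numeral)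
    ultimately show ?thesis using u unfolding form_det_def by (simp add: power2_eq_square) (smt (verit) zero_le_square)
  qed
  have apart: "\<not> (1 < x * k ^ n / k ^ m \<and> x * k ^ n / k ^ m < k)" if "1 < x" "x < k" and mn: "m \<noteq> n" for x :: real and m n :: nat
  proof (cases "m < n")
    case True
    then obtain j where n: "n = Suc (m + j)" by (metis less_iff_Suc_add)
    have "x * k ^ n / k ^ m = x * (k * k ^ j)" using k by (simp add: n power_add)
    moreover have "1 * (k * 1) \<le> x * (k * k ^ j)" using k that by (intro mult_mono) auto
    ultimately show ?thesis by simp
  next
    case False
    then obtain j where m: "m = Suc (n + j)" using mn by (metis less_iff_Suc_add linorder_neqE_nat)
    have "x * k ^ n / k ^ m = x / (k * k ^ j)" using k by (simp add: m power_add field_simps)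
    moreover have "x \<le> k * k ^ j" using k that one_le_power[of k j] by (smt (verit) mult_left_le mult_le_cancel_left1)
    ultimately show ?thesis using k by (simp add: divide_le_eq)
  qed
  have disj: "disjoint_family (\<lambda>n. act (g [^] (n + N)) ` (F \<inter> Z))" for N :: nat and Z
  proof -
    have "m = n" if "S \<in> F" "S' \<in> F" "act (g [^] (m + N)) S = act (g [^] (n + N)) S'" for m n S S'
    proof (rule ccontr)
      assume "m \<noteq> n"
      have "S$3 / k ^ (m + N) = S'$3 / k ^ (n + N)" using that(3) by (simp add: fwd vec_eq_iff forall_3 vector_3)
      then have "S'$3 = S$3 * k ^ (n + N) / k ^ (m + N)" using k by (simp add: field_simps)
      then show False using apart[of "S$3" "m + N" "n + N"] that(1,2) \<open>m \<noteq> n\<close> by (auto simp: F_iff)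
    qed
    then show ?thesis unfolding disjoint_family_on_def by blast
  qed
  have disj': "disjoint_family (\<lambda>n::nat. act (inv g [^] n) ` (F \<inter> Z))" for Z
  proof -
    have "m = n" if "S \<in> F" "S' \<in> F" "act (inv g [^] m) S = act (inv g [^] n) S'" for m n :: nat and S S'
    proof (rule ccontr)
      assume "m \<noteq> n"
      have "S$3 * k ^ m = S'$3 * k ^ n" using that(3) by (simp add: bwd vec_eq_iff forall_3 vector_3)
      then have "S'$3 = S$3 * k ^ m / k ^ n" using k by (simp add: field_simps)
      then show False using apart[of "S$3" n m] that(1,2) \<open>m \<noteq> n\<close> by (auto simp: F_iff)
    qed
    then show ?thesis unfolding disjoint_family_on_def by blast
  qed
  obtain N where N: "k / u < k ^ N" using real_arch_pow[OF k] by blast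
  have out: "act (g [^] (n + N)) S \<notin> X" if "S \<in> F" for n S
  proof -
    have "k ^ N \<le> k ^ (n + N)" using k by (intro power_increasing) auto
    then have "k < u * k ^ (n + N)" using N u(1) by (simp add: field_simps) (smt (verit) mult_left_mono)
    moreover have "u * k ^ (n + N) \<le> (- S$1) * k ^ (n + N)" using that k by (intro mult_right_mono) (auto simp: F_iff)
    moreover have "S$3 / k ^ (n + N) \<le> k"
    proof -
      have "S$3 \<le> k * 1" using that k by (simp add: F_iff)
      also have "\<dots> \<le> k * k ^ (n + N)" using k by (intro mult_left_mono one_le_power) auto
      finally show ?thesis using k by (simp add: divide_le_eq)
    qed
    ultimately show ?thesis unfolding X_def form_tr_def fwd by (simp add: vector_3 mult.commute)
  qed
  have "in": "act (inv g [^] n) S \<in> X" if "S \<in> F" for n :: nat and S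
  proof -
    have "form_tr (act (inv g [^] n) S) > 0"
    proof -
      have "k ^ n \<ge> 1" using k by simp
      then have "S$3 * 1 \<le> S$3 * k ^ n" using that by (intro mult_left_mono) (auto simp: F_iff)
      then have "1 < S$3 * k ^ n" using that unfolding F_iff by linarith
      moreover have "- 1 < S$1 / k ^ n"
      proof -
        have "2 * u \<le> 1" using u k by (simp add: u_def)
        then have "- 1 < S$1" using that by (simp add: F_iff)
        moreover have "k ^ n > 0" using k by simp
        ultimately show ?thesis using \<open>k ^ n \<ge> 1\<close> by (simp add: less_divide_eq)
      qed
      ultimately show ?thesis by (simp add: form_tr_def bwd vector_3)
    qed
    then show ?thesis using F_det[OF that] by (simp add: X_def act_def form_det_act)
  qed
  have pc: "g [^] n \<in> carrier G" "inv g [^] n \<in> carrier G" for n :: nat using g by auto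
  have inY: "act h S \<in> Y \<longleftrightarrow> S \<in> Y" if "h \<in> carrier G" for h S
    using Y(2)[OF that] acts_on_inj[OF is_group act that] by (metis UNIV_I inj_on_image_mem_iff subset_UNIV)
  have "emeasure lborel (F \<inter> Y) = 0"
  proof (rule emeasure_zero_of_disjoint_copies[OF sdY Y(3)])
    show "disjoint_family (\<lambda>n. act (g [^] (n + N)) ` (F \<inter> Y))" by (rule disj)
    show "act (g [^] (n + N)) ` (F \<inter> Y) \<subseteq> sym_diff X Y" for n using out inY[OF pc(1)] by blast
    show "act (g [^] (n + N)) ` (F \<inter> Y) \<in> sets lborel"
      "emeasure lborel (act (g [^] (n + N)) ` (F \<inter> Y)) = emeasure lborel (F \<inter> Y)" for n
      using mp Fm Y(1) by auto
  qed
  moreover have "emeasure lborel (F \<inter> - Y) = 0"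
  proof (rule emeasure_zero_of_disjoint_copies[OF sdY Y(3)])
    show "disjoint_family (\<lambda>n::nat. act (inv g [^] n) ` (F \<inter> - Y))" by (rule disj')
    show "act (inv g [^] n) ` (F \<inter> - Y) \<subseteq> sym_diff X Y" for n :: nat using "in" inY[OF pc(2)] by blast
    show "act (inv g [^] n) ` (F \<inter> - Y) \<in> sets lborel"
      "emeasure lborel (act (inv g [^] n) ` (F \<inter> - Y)) = emeasure lborel (F \<inter> - Y)" for n :: nat
      using mp Fm Y(1) by auto
  qed
  moreover have "emeasure lborel F = emeasure lborel (F \<inter> Y) + emeasure lborel (F \<inter> - Y)"
    using Fm Y(1) by (subst plus_emeasure) (auto intro!: arg_cong[where f = "emeasure lborel"])
  ultimately have "emeasure lborel F = 0" by simp
  moreover have "F \<noteq> {}"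
    using F_iff[of "vector [- (3/2) * u, 0, (1 + k) / 2]"] u k by (auto simp: vector_3)
  moreover have "open F" unfolding F_def by (rule open_box)
  ultimately show False using open_not_negligible[of F] Fm
    by (simp add: negligible_iff_null_sets null_sets_def)
qed

text \<open>Conjugate the homomorphism so that the hyperbolic element becomes a scaling, and pass to its
  inverse if it contracts.\<close>

theorem property_T_no_hyperbolic:
  fixes G :: "('g, 'm) monoid_scheme" (structure)
  assumes T: "property_T G" and hom: "\<And>g h. g \<in> carrier G \<Longrightarrow> h \<in> carrier G \<Longrightarrow> \<rho> (g \<otimes> h) = \<rho> g + \<rho> h"
    and g: "g \<in> carrier G"
  shows "\<not> hyperbolic (\<rho> g)"
proof
  assume "hyperbolic (\<rho> g)"
  then obtain x k where k: "k > 0" "k \<noteq> 1" "x + \<rho> g + - x = hom_pgl k 0 0 1"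
    by (rule hyperbolic_conjugate_to_scaling)
  interpret group G by (rule property_TD(1)[OF T])
  let ?\<rho> = "\<lambda>h. x + \<rho> h + - x"
  have hom': "?\<rho> (h \<otimes> h') = ?\<rho> h + ?\<rho> h'" if "h \<in> carrier G" "h' \<in> carrier G" for h h'
    using hom[OF that] by (simp only: add.assoc minus_add_cancel)
  have \<rho>1: "\<rho> \<one> = 0" using hom[of \<one> \<one>] by (metis add.right_neutral add_left_cancel one_closed r_one)
  have "\<rho> (inv g) = - \<rho> g"
    using hom[OF g inv_closed[OF g]] g \<rho>1 by (metis r_inv minus_unique)
  then have "?\<rho> (inv g) = - ?\<rho> g" by (simp only: minus_add minus_minus add.assoc)
  also have "\<dots> = hom_pgl 1 0 0 k" unfolding k(3) using hom_pgl_uminus[of k 1 0 0] k by simp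
  also have "\<dots> = hom_pgl (1 / k) 0 0 1" using hom_pgl_scale[of k "1 / k" 0 0 1] k by simp
  finally have inv: "?\<rho> (inv g) = hom_pgl (1 / k) 0 0 1" .
  show False
  proof (cases "k > 1")
    case True
    then show ?thesis using property_T_no_scaling[OF T, of ?\<rho>, OF hom' g True] k(3) by simp
  next
    case False
    then have "1 / k > 1" using k by simp
    then show ?thesis using property_T_no_scaling[OF T, of ?\<rho>, OF hom' inv_closed[OF g]] inv by blast
  qed
qed

section \<open>One-sided points of the projective line\<close>

lemma app_plus_fun: "app (g + h) = app g \<circ> app h"
  by (simp add: fun_eq_iff app_plus)

lemma app_zero_fun: "app 0 = (\<lambda>x. x)"
  by (simp add: fun_eq_iff)

text \<open>A one-sided point of the projective line: the germs of half-open intervals at a real number, and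
  the two ends of the real line, which are the sides of the point at infinity. A side \<open>p\<close> is best
  seen as a filter \<open>side_filter p\<close> of real numbers; homographies act by mapping filters, so
  that the composition law needs no case distinction.\<close>

datatype side = Below real | Above real | PosInf | NegInf

fun side_filter :: "side \<Rightarrow> real filter" where
  "side_filter (Below x) = at_left x"
| "side_filter (Above x) = at_right x"
| "side_filter PosInf = at_top"
| "side_filter NegInf = at_bot"

fun opp :: "side \<Rightarrow> side" where
  "opp (Below x) = Above x" | "opp (Above x) = Below x" | "opp PosInf = NegInf" | "opp NegInf = PosInf"

fun base :: "side \<Rightarrow> proj_line" where
  "base (Below x) = Some x" | "base (Above x) = Some x" | "base PosInf = None" | "base NegInf = None"

lemma opp_opp [simp]: "opp (opp p) = p"
  by (cases p) auto

lemma opp_neq [simp]: "opp p \<noteq> p"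
  by (cases p) auto

lemma base_opp [simp]: "base (opp p) = base p"
  by (cases p) auto

lemma base_eq_Some: "base p = Some x \<longleftrightarrow> p = Below x \<or> p = Above x"
  by (cases p) auto

lemma finite_base_vimage:
  assumes "finite E"
  shows "finite {p. base p \<in> E}"
proof -
  have "{p. base p \<in> E} \<subseteq> {PosInf, NegInf} \<union> (Below \<circ> the) ` E \<union> (Above \<circ> the) ` E"
  proof
    fix p assume p: "p \<in> {p. base p \<in> E}"
    show "p \<in> {PosInf, NegInf} \<union> (Below \<circ> the) ` E \<union> (Above \<circ> the) ` E"
      using p by (cases p) force+
  qed
  then show ?thesis using assms by (auto intro: finite_subset)
qed

lemma side_filter_neq_bot [simp]: "side_filter p \<noteq> bot"
  by (cases p) auto

lemma eventually_less_at_bot: "\<forall>\<^sub>F y in at_bot. y < (c::real)"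
  by (auto simp: eventually_at_bot_dense)

lemma side_filter_interval:
  assumes "\<forall>\<^sub>F y in side_filter p. P y"
  obtains J where "open J" "connected J" "\<forall>\<^sub>F y in side_filter p. y \<in> J" "\<And>y. y \<in> J \<Longrightarrow> P y"
proof (cases p)
  case (Below x)
  then obtain b where "b < x" "\<And>y. b < y \<Longrightarrow> y < x \<Longrightarrow> P y"
    using assms by (auto simp: eventually_at_left[of "x - 1"])
  then show thesis using that[of "{b<..<x}"] Below eventually_at_left_real by auto
next
  case (Above x)
  then obtain b where "x < b" "\<And>y. x < y \<Longrightarrow> y < b \<Longrightarrow> P y"
    using assms by (auto simp: eventually_at_right[of x "x + 1"])
  then show thesis using that[of "{x<..<b}"] Above eventually_at_right_real by auto
next
  case PosInf
  then obtain b where "\<And>y. y > b \<Longrightarrow> P y" using assms by (auto simp: eventually_at_top_dense)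
  then show thesis using that[of "{b<..}"] PosInf eventually_gt_at_top by auto
next
  case NegInf
  then obtain b where "\<And>y. y < b \<Longrightarrow> P y" using assms by (auto simp: eventually_at_bot_dense)
  then show thesis using that[of "{..<b}"] NegInf eventually_less_at_bot by auto
qed

lemma side_filter_eventually_nhds:
  assumes "\<forall>\<^sub>F y in side_filter p. P y"
  shows "\<forall>\<^sub>F y in side_filter p. \<forall>\<^sub>F z in nhds y. P z"
proof -
  obtain J where J: "open J" "connected J" "\<forall>\<^sub>F y in side_filter p. y \<in> J" "\<And>y. y \<in> J \<Longrightarrow> P y"
    by (rule side_filter_interval[OF assms]) blast
  show ?thesis using J(3) by eventually_elim (use J(1,4) eventually_nhds in blast)
qed

lemma side_filter_infinite:
  assumes "\<forall>\<^sub>F y in side_filter p. P y"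
  shows "infinite {y. P y}"
proof -
  obtain J where J: "open J" "connected J" "\<forall>\<^sub>F y in side_filter p. y \<in> J" "\<And>y. y \<in> J \<Longrightarrow> P y"
    by (rule side_filter_interval[OF assms]) blast
  have "J \<noteq> {}" using J(3) by auto
  then have "infinite J" using J(1) finite_imp_not_open by blast
  then show ?thesis using J(4) by (meson finite_subset mem_Collect_eq subsetI)
qed

lemma side_filter_cofinite:
  assumes "finite E"
  shows "\<forall>\<^sub>F y in side_filter p. y \<notin> E"
proof -
  have *: "\<forall>\<^sub>F y in side_filter p. y \<noteq> e" for e
  proof (cases p)
    case (Below x) then show ?thesis
      using eventually_neq_at_within[of e x "{..<x}"] by simp
  next
    case (Above x) then show ?thesis
      using eventually_neq_at_within[of e x "{x<..}"] by simp
  next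
    case PosInf then show ?thesis using eventually_gt_at_top[of e] by (auto elim: eventually_mono)
  next
    case NegInf then show ?thesis using eventually_less_at_bot[of e] by (auto elim: eventually_mono)
  qed
  have "\<forall>\<^sub>F y in side_filter p. \<forall>e\<in>E. y \<noteq> e"
    using assms * by (simp add: eventually_ball_finite)
  then show ?thesis by (auto elim: eventually_mono)
qed

lemma side_filter_almost_everywhere:
  assumes "\<forall>\<^sub>\<infinity>x. Q x"
  shows "\<forall>\<^sub>F y in side_filter p. Q (Some y)"
proof -
  have "finite (Some -` {x. \<not> Q x})" using assms by (intro finite_vimageI) (auto simp: eventually_cofinite)
  from side_filter_cofinite[OF this] show ?thesis by simp
qed

lemma side_filter_inj:
  assumes "side_filter p = side_filter q"
  shows "p = q"
proof -
  let ?F = "side_filter p"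
  have lim: "((\<lambda>y. y) \<longlongrightarrow> x) (side_filter r)" if "base r = Some x" for r x
    using that by (auto simp: base_eq_Some)
  have inf: "filterlim (\<lambda>y. y) at_infinity (side_filter r)" if "base r = None" for r
    using that filterlim_ident[of at_top] filterlim_ident[of at_bot]
    by (cases r) (auto intro: filterlim_at_top_imp_at_infinity filterlim_at_bot_imp_at_infinity)
  have "base p = base q"
  proof (cases "base p"; cases "base q")
    fix x y assume "base p = Some x" "base q = Some y"
    then show ?thesis using lim[of p x] lim[of q y] assms tendsto_unique side_filter_neq_bot by metis
  next
    fix x assume "base p = Some x" "base q = None"
    then show ?thesis using lim[of p x] inf[of q] assms not_tendsto_and_filterlim_at_infinity side_filter_neq_bot by metis
  next
    fix x assume "base p = None" "base q = Some x"
    then show ?thesis using lim[of q x] inf[of p] assms not_tendsto_and_filterlim_at_infinity side_filter_neq_bot by metis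
  qed simp
  moreover have "q \<noteq> opp p"
  proof
    assume q: "q = opp p"
    have "\<exists>P. (\<forall>\<^sub>F y in side_filter p. P y) \<and> (\<forall>\<^sub>F y in side_filter (opp p). \<not> P y)"
    proof (cases p)
      case (Below x) then show ?thesis
        by (intro exI[of _ "\<lambda>y. y < x"]) (auto simp: eventually_at_filter)
    next
      case (Above x) then show ?thesis
        by (intro exI[of _ "\<lambda>y. y > x"]) (auto simp: eventually_at_filter)
    next
      case PosInf then show ?thesis
        by (intro exI[of _ "\<lambda>y. y > 0"]) (auto intro: eventually_gt_at_top eventually_le_at_bot simp: not_less)
    next
      case NegInf then show ?thesis
        by (intro exI[of _ "\<lambda>y. y < 0"]) (auto intro: eventually_less_at_bot eventually_ge_at_top simp: not_less)
    qed
    then have "\<exists>P. (\<forall>\<^sub>F y in ?F. P y) \<and> (\<forall>\<^sub>F y in ?F. \<not> P y)" using q assms by simp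
    then obtain P where P: "\<forall>\<^sub>F y in ?F. P y" "\<forall>\<^sub>F y in ?F. \<not> P y" by blast
    have "\<forall>\<^sub>F y in ?F. False" using P by eventually_elim simp
    then show False by simp
  qed
  ultimately show ?thesis by (cases p; cases q) auto
qed

definition proj_filter :: "side \<Rightarrow> proj_line filter"
  where "proj_filter p = filtermap Some (side_filter p)"

lemma proj_filter_inj: "proj_filter p = proj_filter q \<Longrightarrow> p = q"
proof -
  assume "proj_filter p = proj_filter q"
  then have "filtermap the (proj_filter p) = filtermap the (proj_filter q)" by simp
  then show ?thesis by (simp add: proj_filter_def filtermap_filtermap side_filter_inj)
qed

text \<open>The second and third condition say that a side of \<open>x\<close> is sent to a side of the image of \<open>x\<close>, and
  that the two sides of \<open>x\<close> go to different sides. As all three conditions are stable under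
  composition, it suffices to find such a map for generators of the group.\<close>

definition side_map :: "pgl \<Rightarrow> (side \<Rightarrow> side) \<Rightarrow> bool"
  where "side_map g a \<longleftrightarrow> (\<forall>p. filtermap (app g) (proj_filter p) = proj_filter (a p) \<and>
     base (a p) = app g (base p) \<and> a (opp p) = opp (a p))"

lemma side_map_plus: "side_map g a \<Longrightarrow> side_map h b \<Longrightarrow> side_map (g + h) (a \<circ> b)"
proof -
  assume gh: "side_map g a" "side_map h b"
  have "filtermap (app (g + h)) (proj_filter p) = filtermap (app g) (filtermap (app h) (proj_filter p))" for p
    by (simp add: filtermap_filtermap app_plus_fun comp_def)
  then show ?thesis using gh by (simp add: side_map_def app_plus)
qed

lemma side_mapI:
  assumes f: "\<And>p. \<forall>\<^sub>F y in side_filter p. app g (Some y) = Some (f y)"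
    and map: "\<And>p. filtermap f (side_filter p) = side_filter (a p)"
    and "\<And>p. base (a p) = app g (base p)" "\<And>p. a (opp p) = opp (a p)"
  shows "side_map g a"
  unfolding side_map_def
proof (intro allI conjI assms(3,4))
  fix p
  have "filtermap (app g) (proj_filter p) = filtermap (\<lambda>y. app g (Some y)) (side_filter p)"
    by (simp add: proj_filter_def filtermap_filtermap)
  also have "\<dots> = filtermap (\<lambda>y. Some (f y)) (side_filter p)"
    using f[of p] by (auto simp: filter_eq_iff eventually_filtermap elim: eventually_elim2)
  also have "\<dots> = filtermap Some (filtermap f (side_filter p))" by (simp add: filtermap_filtermap)
  finally show "filtermap (app g) (proj_filter p) = proj_filter (a p)" by (simp add: map proj_filter_def)
qed

lemma side_map_shift: "\<exists>a. side_map (hom_pgl 1 t 0 1) a"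
proof -
  let ?a = "\<lambda>p. case p of Below x \<Rightarrow> Below (x + t) | Above x \<Rightarrow> Above (x + t) | _ \<Rightarrow> p"
  have "side_map (hom_pgl 1 t 0 1) ?a"
  proof (rule side_mapI[where f = "\<lambda>y. y + t"])
    fix p
    show "filtermap (\<lambda>y. y + t) (side_filter p) = side_filter (?a p)"
    proof (rule filtermap_fun_inverse[where g = "\<lambda>y. y - t"])
      show "filterlim (\<lambda>y. y - t) (side_filter p) (side_filter (?a p))"
        by (cases p; simp; real_asymp)
      show "filterlim (\<lambda>y. y + t) (side_filter (?a p)) (side_filter p)"
        by (cases p; simp; real_asymp)
    qed simp
    show "?a (opp p) = opp (?a p)" "base (?a p) = app (hom_pgl 1 t 0 1) (base p)"
      by (cases p; simp add: app_hom_pgl)+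
  qed (simp add: app_hom_pgl)
  then show ?thesis by blast
qed

lemma side_map_scale: "k > 0 \<Longrightarrow> \<exists>a. side_map (hom_pgl k 0 0 1) a"
proof -
  assume k: "k > 0"
  let ?a = "\<lambda>p. case p of Below x \<Rightarrow> Below (k * x) | Above x \<Rightarrow> Above (k * x) | _ \<Rightarrow> p"
  have "side_map (hom_pgl k 0 0 1) ?a"
  proof (rule side_mapI[where f = "\<lambda>y. k * y"])
    fix p
    show "filtermap (\<lambda>y. k * y) (side_filter p) = side_filter (?a p)"
    proof (rule filtermap_fun_inverse[where g = "\<lambda>y. y / k"])
      show "filterlim (\<lambda>y. y / k) (side_filter p) (side_filter (?a p))"
        using k by (cases p; simp; real_asymp)
      show "filterlim (\<lambda>y. k * y) (side_filter (?a p)) (side_filter p)"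
        using k by (cases p; simp; real_asymp)
    qed (use k in simp)
    show "?a (opp p) = opp (?a p)" "base (?a p) = app (hom_pgl k 0 0 1) (base p)"
      using k by (cases p; simp add: app_hom_pgl)+
  qed (use k in \<open>simp add: app_hom_pgl\<close>)
  then show ?thesis by blast
qed

lemma side_map_neg: "\<exists>a. side_map (hom_pgl (-1) 0 0 1) a"
proof -
  let ?a = "\<lambda>p. case p of Below x \<Rightarrow> Above (- x) | Above x \<Rightarrow> Below (- x) | PosInf \<Rightarrow> NegInf | NegInf \<Rightarrow> PosInf"
  have "side_map (hom_pgl (-1) 0 0 1) ?a"
  proof (rule side_mapI[where f = "\<lambda>y. - y"])
    fix p
    show "filtermap (\<lambda>y. - y) (side_filter p) = side_filter (?a p)"
    proof (rule filtermap_fun_inverse[where g = "\<lambda>y. - y"])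
      show "filterlim (\<lambda>y. - y) (side_filter p) (side_filter (?a p))"
        by (cases p; simp; real_asymp)
      show "filterlim (\<lambda>y. - y) (side_filter (?a p)) (side_filter p)"
        by (cases p; simp; real_asymp)
    qed simp
    show "?a (opp p) = opp (?a p)" "base (?a p) = app (hom_pgl (-1) 0 0 1) (base p)"
      by (cases p; simp add: app_hom_pgl)+
  qed (simp add: app_hom_pgl)
  then show ?thesis by blast
qed

lemma side_map_inverse: "\<exists>a. side_map (hom_pgl 0 1 1 0) a"
proof -
  let ?a = "\<lambda>p. case p of Below x \<Rightarrow> (if x = 0 then NegInf else Above (1 / x))
    | Above x \<Rightarrow> (if x = 0 then PosInf else Below (1 / x)) | PosInf \<Rightarrow> Above 0 | NegInf \<Rightarrow> Below 0"
  have aa: "?a (?a p) = p" for p by (cases p) auto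
  have lim: "filterlim (\<lambda>y. 1 / y) (side_filter (?a p)) (side_filter p)" for p
  proof (cases p)
    case (Below x)
    have "filterlim (\<lambda>y. 1 / y) (at_right (1 / x)) (at_left x)" if "x \<noteq> 0"
    proof (rule filterlim_at_withinI)
      have s: "\<forall>\<^sub>F y in at_left x. y * x > 0 \<and> y < x"
      proof -
        have "((\<lambda>y. y * x) \<longlongrightarrow> x * x) (at_left x)" by (intro tendsto_intros)
        moreover have "0 < x * x" using that by (auto simp: zero_less_mult_iff)
        ultimately have "\<forall>\<^sub>F y in at_left x. y * x > 0" by (rule order_tendstoD(1))
        moreover have "\<forall>\<^sub>F y in at_left x. y < x" by (simp add: eventually_at_filter)
        ultimately show ?thesis by eventually_elim simp
      qed
      show "\<forall>\<^sub>F y in at_left x. 1 / y \<in> {1 / x<..} - {1 / x}"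
        using s by eventually_elim (auto simp: field_simps zero_less_mult_iff)
    qed (use that in \<open>auto intro!: tendsto_intros\<close>)
    moreover have "filterlim (\<lambda>y::real. 1 / y) at_bot (at_left 0)" by real_asymp
    ultimately show ?thesis using Below by auto
  next
    case (Above x)
    have "filterlim (\<lambda>y. 1 / y) (at_left (1 / x)) (at_right x)" if "x \<noteq> 0"
    proof (rule filterlim_at_withinI)
      have s: "\<forall>\<^sub>F y in at_right x. y * x > 0 \<and> y > x"
      proof -
        have "((\<lambda>y. y * x) \<longlongrightarrow> x * x) (at_right x)" by (intro tendsto_intros)
        moreover have "0 < x * x" using that by (auto simp: zero_less_mult_iff)
        ultimately have "\<forall>\<^sub>F y in at_right x. y * x > 0" by (rule order_tendstoD(1))
        moreover have "\<forall>\<^sub>F y in at_right x. y > x" by (simp add: eventually_at_filter)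
        ultimately show ?thesis by eventually_elim simp
      qed
      show "\<forall>\<^sub>F y in at_right x. 1 / y \<in> {..<1 / x} - {1 / x}"
        using s by eventually_elim (auto simp: field_simps zero_less_mult_iff)
    qed (use that in \<open>auto intro!: tendsto_intros\<close>)
    moreover have "filterlim (\<lambda>y::real. 1 / y) at_top (at_right 0)" by real_asymp
    ultimately show ?thesis using Above by auto
  next
    case PosInf
    have "filterlim (\<lambda>y::real. 1 / y) (at_right 0) at_top" by real_asymp
    then show ?thesis using PosInf by simp
  next
    case NegInf
    have "filterlim (\<lambda>y::real. 1 / y) (at_left 0) at_bot" by real_asymp
    then show ?thesis using NegInf by simp
  qed
  have "side_map (hom_pgl 0 1 1 0) ?a"
  proof (rule side_mapI[where f = "\<lambda>y. 1 / y"])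
    fix p
    show "filtermap (\<lambda>y. 1 / y) (side_filter p) = side_filter (?a p)"
      using lim[of "?a p"] lim[of p] aa by (intro filtermap_fun_inverse[where g = "\<lambda>y. 1 / y"]) auto
    show "?a (opp p) = opp (?a p)" "base (?a p) = app (hom_pgl 0 1 1 0) (base p)"
      by (cases p; simp add: app_hom_pgl)+
    show "\<forall>\<^sub>F y in side_filter p. app (hom_pgl 0 1 1 0) (Some y) = Some (1 / y)"
      using side_filter_cofinite[of "{0}" p, simplified] by eventually_elim (simp add: app_hom_pgl)
  qed
  then show ?thesis by blast
qed

text \<open>A homography is a composition of translations, scalings and the inversion, by
  \<open>(a x + b) / (c x + d) = a / c + m / (x + d / c)\<close> with \<open>m = (b c - a d) / c\<^sup>2\<close>.\<close>

lemma side_map_exists: "\<exists>a. side_map g a"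
proof -
  have plus: "\<exists>a. side_map (g + h) a" if "\<exists>a. side_map g a" "\<exists>a. side_map h a" for g h
    using that side_map_plus by blast
  have mult: "\<exists>a. side_map (hom_pgl k 0 0 1) a" if k: "k \<noteq> 0" for k
  proof (cases "k > 0")
    case False
    then have "hom_pgl k 0 0 1 = hom_pgl (-1) 0 0 1 + hom_pgl (-k) 0 0 1"
      using k by (subst hom_pgl_plus) auto
    then show ?thesis using plus[OF side_map_neg side_map_scale, of "-k"] False k by simp
  qed (rule side_map_scale)
  obtain a b c d where g: "a * d - b * c \<noteq> 0" "g = hom_pgl a b c d" by (rule hom_pgl_exists)
  show ?thesis
  proof (cases "c = 0")
    case True
    then have n: "a \<noteq> 0" "d \<noteq> 0" using g by auto
    then have "g = hom_pgl 1 (b / d) 0 1 + hom_pgl (a / d) 0 0 1"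
      using g(2) True hom_pgl_scale[of d "a / d" "b / d" 0 1] by (subst hom_pgl_plus) auto
    then show ?thesis using plus[OF side_map_shift mult] n by auto
  next
    case False
    define m where "m = (b * c - a * d) / c^2"
    have m: "m \<noteq> 0" using g(1) False by (simp add: m_def)
    have "hom_pgl 1 (a / c) 0 1 + (hom_pgl m 0 0 1 + (hom_pgl 0 1 1 0 + hom_pgl 1 (d / c) 0 1))
       = hom_pgl (a / c) (m + a / c * (d / c)) 1 (d / c)"
      using m by (subst hom_pgl_plus; simp)+
    also have "m + a / c * (d / c) = b / c" using False by (simp add: m_def field_simps power2_eq_square)
    also have "hom_pgl (a / c) (b / c) 1 (d / c) = g"
      using g(2) False hom_pgl_scale[of c "a / c" "b / c" 1 "d / c"] by simp
    finally show ?thesis using plus[OF side_map_shift plus[OF mult[OF m] plus[OF side_map_inverse side_map_shift]]]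
      by metis
  qed
qed

definition side_act :: "pgl \<Rightarrow> side \<Rightarrow> side"
  where "side_act g = (SOME a. side_map g a)"

lemma side_map_side_act: "side_map g (side_act g)"
  unfolding side_act_def using side_map_exists by (rule someI_ex)

lemma filtermap_side_act: "filtermap (app g) (proj_filter p) = proj_filter (side_act g p)"
  and base_side_act: "base (side_act g p) = app g (base p)"
  and side_act_opp: "side_act g (opp p) = opp (side_act g p)"
  using side_map_side_act[of g] by (simp_all add: side_map_def)

lemma side_act_plus: "side_act (g + h) p = side_act g (side_act h p)"
proof (rule proj_filter_inj)
  have "proj_filter (side_act (g + h) p) = filtermap (app g) (filtermap (app h) (proj_filter p))"
    by (simp add: filtermap_side_act[symmetric] filtermap_filtermap app_plus_fun comp_def)
  then show "proj_filter (side_act (g + h) p) = proj_filter (side_act g (side_act h p))"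
    by (simp add: filtermap_side_act)
qed

lemma side_act_zero [simp]: "side_act 0 p = p"
proof (rule proj_filter_inj)
  show "proj_filter (side_act 0 p) = proj_filter p"
    by (simp add: filtermap_side_act[symmetric] app_zero_fun)
qed

lemma eventually_side_act:
  assumes "\<forall>\<^sub>F z in side_filter (side_act g p). P z"
  shows "\<forall>\<^sub>F y in side_filter p. \<exists>z. app g (Some y) = Some z \<and> P z"
proof -
  have "\<forall>\<^sub>F w in proj_filter (side_act g p). \<exists>z. w = Some z \<and> P z"
    unfolding proj_filter_def eventually_filtermap using assms by simp
  then show ?thesis
    unfolding filtermap_side_act[symmetric] unfolding eventually_filtermap proj_filter_def by simp
qed

text \<open>Continuity for a discrete target, if a neighbourhood of a side \<open>p\<close> consists of \<open>p\<close> and the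
  sides of the points of an interval ending at \<open>p\<close>. Jumps between the two sides of a point are
  allowed.\<close>

definition side_continuous :: "(side \<Rightarrow> 'b) \<Rightarrow> bool"
  where "side_continuous \<phi> \<longleftrightarrow> (\<forall>p. \<forall>\<^sub>F y in side_filter p. \<phi> (Below y) = \<phi> p \<and> \<phi> (Above y) = \<phi> p)"

lemma side_continuous_const: "side_continuous (\<lambda>_. x)"
  by (simp add: side_continuous_def)

lemma side_continuous_compose: "side_continuous \<phi> \<Longrightarrow> side_continuous (\<lambda>p. f (\<phi> p))"
  unfolding side_continuous_def by (intro allI, erule allE) (erule eventually_mono, simp)

lemma side_continuous_Pair:
  "side_continuous \<phi> \<Longrightarrow> side_continuous \<psi> \<Longrightarrow> side_continuous (\<lambda>p. (\<phi> p, \<psi> p))"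
  unfolding side_continuous_def by (intro allI, (erule allE)+) (erule (1) eventually_elim2, simp)

lemma side_continuous_compose2:
  "side_continuous \<phi> \<Longrightarrow> side_continuous \<psi> \<Longrightarrow> side_continuous (\<lambda>p. f (\<phi> p) (\<psi> p))"
  using side_continuous_compose[OF side_continuous_Pair, of \<phi> \<psi> "\<lambda>(x, y). f x y"] by simp

text \<open>Near \<open>p\<close> the transformation is the homography \<open>c p\<close>, which maps the sides of a point near
  \<open>p\<close> to the sides of a point near the image of \<open>p\<close>.\<close>

lemma side_continuous_act:
  assumes c: "side_continuous c" and \<phi>: "side_continuous \<phi>"
  shows "side_continuous (\<lambda>p. \<phi> (side_act (c p) p))"
  unfolding side_continuous_def
proof
  fix p
  let ?q = "side_act (c p) p"
  have "\<forall>\<^sub>F z in side_filter ?q. \<phi> (Below z) = \<phi> ?q \<and> \<phi> (Above z) = \<phi> ?q"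
    using \<phi> by (simp add: side_continuous_def)
  from eventually_side_act[OF this]
  have "\<forall>\<^sub>F y in side_filter p. \<exists>z. app (c p) (Some y) = Some z \<and> \<phi> (Below z) = \<phi> ?q \<and> \<phi> (Above z) = \<phi> ?q" .
  moreover have "\<forall>\<^sub>F y in side_filter p. c (Below y) = c p \<and> c (Above y) = c p"
    using c by (simp add: side_continuous_def)
  ultimately show "\<forall>\<^sub>F y in side_filter p.
      \<phi> (side_act (c (Below y)) (Below y)) = \<phi> ?q \<and> \<phi> (side_act (c (Above y)) (Above y)) = \<phi> ?q"
  proof eventually_elim
    case (elim y)
    then obtain z where z: "app (c p) (Some y) = Some z" "\<phi> (Below z) = \<phi> ?q" "\<phi> (Above z) = \<phi> ?q" by blast
    have "base (side_act (c p) (Below y)) = Some z" "base (side_act (c p) (Above y)) = Some z"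
      using z(1) by (simp_all add: base_side_act)
    then show ?case using z elim by (auto simp: base_eq_Some)
  qed
qed

text \<open>The finite set \<open>P\<close> cuts the real line into intervals; the rank of a side is the number of
  the interval to which it belongs.\<close>

fun rank :: "real set \<Rightarrow> side \<Rightarrow> nat" where
  "rank P (Below x) = card {t \<in> P. t < x}"
| "rank P (Above x) = card {t \<in> P. t \<le> x}"
| "rank P PosInf = card P"
| "rank P NegInf = 0"

lemma rank_le: "finite P \<Longrightarrow> rank P p \<le> card P"
  by (cases p) (auto intro: card_mono)

lemma side_continuous_rank:
  assumes P: "finite P"
  shows "side_continuous (rank P)"
  unfolding side_continuous_def
proof
  fix p
  have *: "\<forall>\<^sub>F y in side_filter p. \<forall>t\<in>P. Q t y" if "\<And>t. \<forall>\<^sub>F y in side_filter p. Q t y" for Q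
    using P that by (simp add: eventually_ball_finite)
  show "\<forall>\<^sub>F y in side_filter p. rank P (Below y) = rank P p \<and> rank P (Above y) = rank P p"
  proof (cases p)
    case (Below x)
    have "\<forall>\<^sub>F y in side_filter p. (t < y \<longleftrightarrow> t < x) \<and> (t \<le> y \<longleftrightarrow> t < x)" for t
    proof (cases "t < x")
      case True
      then have "\<forall>\<^sub>F y in at_left x. y \<in> {t<..<x}" by (rule eventually_at_left_real)
      then show ?thesis using Below True by (auto elim: eventually_mono)
    next
      case False
      have "\<forall>\<^sub>F y in at_left x. y < x" by (simp add: eventually_at_filter)
      then show ?thesis using Below False by (auto elim!: eventually_mono)
    qed
    from *[OF this] show ?thesis
      by eventually_elim (auto simp: Below intro!: arg_cong[where f = card])
  next
    case (Above x)
    have "\<forall>\<^sub>F y in side_filter p. (t < y \<longleftrightarrow> t \<le> x) \<and> (t \<le> y \<longleftrightarrow> t \<le> x)" for t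
    proof (cases "x < t")
      case True
      then have "\<forall>\<^sub>F y in at_right x. y \<in> {x<..<t}" by (rule eventually_at_right_real)
      then show ?thesis using Above True by (auto elim: eventually_mono)
    next
      case False
      have "\<forall>\<^sub>F y in at_right x. y > x" by (simp add: eventually_at_filter)
      then show ?thesis using Above False by (auto elim!: eventually_mono)
    qed
    from *[OF this] show ?thesis
      by eventually_elim (auto simp: Above intro!: arg_cong[where f = card])
  next
    case PosInf
    have "\<forall>\<^sub>F y in side_filter p. t < y" for t using PosInf eventually_gt_at_top by simp
    from *[of "\<lambda>t y. t < y", OF this] show ?thesis
    proof eventually_elim
      case (elim y)
      then have "{t \<in> P. t < y} = P" "{t \<in> P. t \<le> y} = P" by (auto intro: less_imp_le)
      then show ?case by (simp add: PosInf)
    qed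
  next
    case NegInf
    have "\<forall>\<^sub>F y in side_filter p. y < t" for t using NegInf eventually_less_at_bot by simp
    from *[of "\<lambda>t y. y < t", OF this] show ?thesis
    proof eventually_elim
      case (elim y)
      then have "{t \<in> P. t < y} = {}" "{t \<in> P. t \<le> y} = {}" by force+
      then show ?case by (simp only: NegInf rank.simps card.empty)
    qed
  qed
qed

text \<open>The sides of given rank surround an interval, which is connected.\<close>

lemma side_continuous_eq_of_rank_eq:
  assumes P: "finite P" and \<phi>: "side_continuous \<phi>"
    and cont: "\<And>y. y \<notin> P \<Longrightarrow> \<phi> (Below y) = \<phi> (Above y)"
    and r: "rank P p = rank P q"
  shows "\<phi> p = \<phi> q"
proof -
  define J where "J = {y. y \<notin> P \<and> rank P (Above y) = rank P p}"
  have mono: "rank P (Above x) \<le> rank P (Above y)" if "x \<le> y" for x y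
    using P that by (auto intro!: card_mono)
  have "connected J"
    unfolding connected_iff_interval
  proof (intro ballI allI impI)
    fix x y z assume x: "x \<in> J" and y: "y \<in> J" and z: "x \<le> z" "z \<le> y"
    have rz: "rank P (Above z) = rank P p"
      using mono[OF z(1)] mono[OF z(2)] x y by (simp add: J_def)
    moreover have "z \<notin> P"
    proof
      assume "z \<in> P"
      then have "x < z" using x z by (auto simp: J_def less_le)
      then have "z \<in> {t \<in> P. t \<le> z} - {t \<in> P. t \<le> x}" "{t \<in> P. t \<le> x} \<subseteq> {t \<in> P. t \<le> z}"
        using \<open>z \<in> P\<close> by auto
      then have "{t \<in> P. t \<le> x} \<subset> {t \<in> P. t \<le> z}" by blast
      then have "rank P (Above x) < rank P (Above z)" using P by (auto intro: psubset_card_mono)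
      then show False using rz x by (simp add: J_def)
    qed
    ultimately show "z \<in> J" by (simp add: J_def)
  qed
  have near: "\<exists>y\<in>J. \<phi> (Above y) = \<phi> s" if "rank P s = rank P p" for s
  proof -
    have "\<forall>\<^sub>F y in side_filter s. y \<in> J \<and> \<phi> (Above y) = \<phi> s"
      using side_filter_cofinite[OF P, of s] side_continuous_rank[OF P, unfolded side_continuous_def, rule_format, of s]
        \<phi>[unfolded side_continuous_def, rule_format, of s]
      by eventually_elim (simp add: J_def that)
    then obtain y where "y \<in> J \<and> \<phi> (Above y) = \<phi> s"
      using eventually_happens'[OF side_filter_neq_bot] by blast
    then show ?thesis by blast
  qed
  obtain x where x: "x \<in> J" "\<phi> (Above x) = \<phi> p" using near by blast
  obtain y where y: "y \<in> J" "\<phi> (Above y) = \<phi> q" using near r by metis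
  have "\<phi> (Above x) = \<phi> (Above y)"
  proof (rule connected_local_const[OF \<open>connected J\<close> x(1) y(1)], intro ballI)
    fix a assume a: "a \<in> J"
    have l: "\<forall>\<^sub>F b in at_left a. \<phi> (Above b) = \<phi> (Below a)" "\<forall>\<^sub>F b in at_right a. \<phi> (Above b) = \<phi> (Above a)"
      using \<phi>[unfolded side_continuous_def, rule_format, of "Below a"]
        \<phi>[unfolded side_continuous_def, rule_format, of "Above a"] by (auto elim: eventually_mono)
    have "\<phi> (Below a) = \<phi> (Above a)" using cont a by (auto simp: J_def)
    then have "\<forall>\<^sub>F b in at a. \<phi> (Above a) = \<phi> (Above b)"
      using l by (auto simp: at_eq_sup_left_right eventually_sup elim: eventually_mono)
    then show "\<forall>\<^sub>F b in at a within J. \<phi> (Above a) = \<phi> (Above b)"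
      using filter_leD[OF at_le[of J UNIV a]] by simp
  qed
  then show ?thesis using x y by simp
qed

lemma finite_range_of_finite_jumps:
  assumes P: "finite P" and \<phi>: "side_continuous \<phi>"
    and cont: "\<And>y. y \<notin> P \<Longrightarrow> \<phi> (Below y) = \<phi> (Above y)"
  shows "finite (range \<phi>)"
proof -
  define f where "f k = \<phi> (SOME p. rank P p = k)" for k
  have "\<phi> p = f (rank P p)" for p
    unfolding f_def
    by (rule side_continuous_eq_of_rank_eq[OF P \<phi> cont]) (auto intro: someI[of "\<lambda>q. rank P q = rank P p", symmetric])
  then have "range \<phi> \<subseteq> f ` {..card P}" using rank_le[OF P] by auto
  then show ?thesis by (rule finite_subset) simp
qed

section \<open>Germs of piecewise projective maps\<close>

definition germ :: "(proj_line \<Rightarrow> proj_line) \<Rightarrow> side \<Rightarrow> pgl"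
  where "germ f p = (THE g. \<forall>\<^sub>F y in side_filter p. f (Some y) = app g (Some y))"

text \<open>A homography is determined by its values at infinitely many points.\<close>

lemma germ_unique:
  assumes "\<forall>\<^sub>F y in side_filter p. f (Some y) = app g (Some y)"
    and "\<forall>\<^sub>F y in side_filter p. f (Some y) = app h (Some y)"
  shows "g = h"
proof (rule pgl_eqI, rule side_filter_infinite)
  show "\<forall>\<^sub>F y in side_filter p. app g (Some y) = app h (Some y)"
    using assms by eventually_elim simp
qed

lemma germ_eqI:
  assumes "\<forall>\<^sub>F y in side_filter p. f (Some y) = app g (Some y)"
  shows "germ f p = g"
  unfolding germ_def using assms germ_unique by blast

definition regular_point :: "(proj_line \<Rightarrow> proj_line) \<Rightarrow> real \<Rightarrow> bool"
  where "regular_point f y \<longleftrightarrow> (\<exists>g. \<forall>\<^sub>F z in nhds y. f (Some z) = app g (Some z))"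

lemma piecewise_projective_regular:
  assumes "piecewise_projective f"
  shows "finite {y. \<not> regular_point f y}"
proof -
  have "\<forall>\<^sub>\<infinity>x. \<forall>y. x = Some y \<longrightarrow> regular_point f y"
    using assms unfolding piecewise_projective_def
  proof eventually_elim
    case (elim x)
    then obtain V g where V: "openin P1 V" "x \<in> V" and g: "g \<in> PGL2" "\<And>x'. x' \<in> V \<Longrightarrow> f x' = g x'" by blast
    show ?case
    proof (intro allI impI)
      fix y assume x: "x = Some y"
      have "open (Some -` V)"
        using V(1) unfolding P1_def openin_Alexandroff_compactification
        by (auto simp: vimage_image_eq open_openin[symmetric] Compl_eq_Diff_UNIV[symmetric])
          (auto simp: vimage_def image_iff open_Compl closed_closedin[symmetric] Compl_eq[symmetric])
      then have "\<forall>\<^sub>F z in nhds y. z \<in> Some -` V" using V(2) x by (intro eventually_nhds_in_open) auto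
      then have "\<forall>\<^sub>F z in nhds y. f (Some z) = app (of_map g) (Some z)"
        by eventually_elim (simp add: g of_map_inverse)
      then show "regular_point f y" by (auto simp: regular_point_def)
    qed
  qed
  then have "finite {x. \<not> (\<forall>y. x = Some y \<longrightarrow> regular_point f y)}" by (simp add: eventually_cofinite)
  then have "finite (Some -` {x. \<not> (\<forall>y. x = Some y \<longrightarrow> regular_point f y)})"
    by (rule finite_vimageI) simp
  then show ?thesis by (rule finite_subset[rotated]) auto
qed

lemma side_filter_le_nhds: "base p = Some x \<Longrightarrow> side_filter p \<le> nhds x"
  by (auto simp: base_eq_Some at_within_le_nhds)

text \<open>Next to a side there is an interval of regular points. The homography that \<open>f\<close> agrees with
  around a point of the interval is locally constant, hence constant.\<close>

lemma eventually_germ: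
  assumes "piecewise_projective f"
  shows "\<forall>\<^sub>F y in side_filter p. f (Some y) = app (germ f p) (Some y)"
proof -
  have "\<forall>\<^sub>F y in side_filter p. regular_point f y"
    using side_filter_cofinite[OF piecewise_projective_regular[OF assms], of p] by simp
  then obtain J where J: "open J" "connected J" "\<forall>\<^sub>F y in side_filter p. y \<in> J" "\<And>y. y \<in> J \<Longrightarrow> regular_point f y"
    by (rule side_filter_interval) blast
  define \<psi> where "\<psi> y = (SOME g. \<forall>\<^sub>F z in nhds y. f (Some z) = app g (Some z))" for y
  have \<psi>: "\<forall>\<^sub>F z in nhds y. f (Some z) = app (\<psi> y) (Some z)" if "y \<in> J" for y
    using J(4)[OF that] unfolding regular_point_def \<psi>_def by (rule someI_ex)
  have loc: "\<forall>\<^sub>F b in at a within J. \<psi> a = \<psi> b" if a: "a \<in> J" for a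
  proof -
    have "\<forall>\<^sub>F b in nhds a. \<forall>\<^sub>F z in nhds b. f (Some z) = app (\<psi> a) (Some z)"
      using \<psi>[OF a] by (simp add: eventually_eventually)
    moreover have "\<forall>\<^sub>F b in nhds a. b \<in> J" using J(1) a by (rule eventually_nhds_in_open)
    ultimately have "\<forall>\<^sub>F b in nhds a. \<psi> a = \<psi> b"
    proof eventually_elim
      case (elim b)
      then have "\<forall>\<^sub>F z in nhds b. f (Some z) = app (\<psi> a) (Some z)" "\<forall>\<^sub>F z in nhds b. f (Some z) = app (\<psi> b) (Some z)"
        using \<psi> by auto
      moreover have "side_filter (Above b) \<le> nhds b" by (rule side_filter_le_nhds) simp
      ultimately show ?case by (metis germ_unique filter_leD)
    qed
    then show ?thesis using filter_leD[OF at_within_le_nhds] by blast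
  qed
  obtain a where a: "a \<in> J" using J(3) eventually_happens'[OF side_filter_neq_bot] by blast
  have "\<psi> b = \<psi> a" if "b \<in> J" for b
    using connected_local_const[where f = \<psi>, OF J(2) that a] loc by blast
  then have "f (Some y) = app (\<psi> a) (Some y)" if "y \<in> J" for y
    using \<psi>[OF that] that eventually_nhds_x_imp_x by fastforce
  then have "\<forall>\<^sub>F y in side_filter p. f (Some y) = app (\<psi> a) (Some y)"
    using J(3) by (auto elim: eventually_mono)
  then show ?thesis using germ_eqI by metis
qed

lemma germ_regular:
  assumes "\<forall>\<^sub>F z in nhds y. f (Some z) = app g (Some z)"
  shows "germ f (Below y) = g" "germ f (Above y) = g"
  using side_filter_le_nhds[of "Below y" y] side_filter_le_nhds[of "Above y" y] assms
  by (auto intro!: germ_eqI elim: filter_leD)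

lemma side_continuous_germ:
  assumes "piecewise_projective f"
  shows "side_continuous (germ f)"
  unfolding side_continuous_def
proof
  fix p
  show "\<forall>\<^sub>F y in side_filter p. germ f (Below y) = germ f p \<and> germ f (Above y) = germ f p"
    using side_filter_eventually_nhds[OF eventually_germ[OF assms, of p]]
    by eventually_elim (simp add: germ_regular)
qed

lemma finite_germ_jumps:
  assumes "piecewise_projective f"
  shows "finite {y. germ f (Below y) \<noteq> germ f (Above y)}"
  by (rule finite_subset[OF _ piecewise_projective_regular[OF assms]])
    (auto simp: regular_point_def dest: germ_regular)

lemma germ_comp:
  assumes "piecewise_projective f" "piecewise_projective g"
  shows "germ (f \<circ> g) p = germ f (side_act (germ g p) p) + germ g p"
proof (rule germ_eqI)
  show "\<forall>\<^sub>F y in side_filter p. (f \<circ> g) (Some y) = app (germ f (side_act (germ g p) p) + germ g p) (Some y)"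
    using eventually_side_act[OF eventually_germ[OF assms(1), of "side_act (germ g p) p"]]
      eventually_germ[OF assms(2), of p]
    by eventually_elim (auto simp: app_plus)
qed

lemma germ_id: "germ id p = 0"
  by (rule germ_eqI) simp

lemma germ_cong:
  assumes "\<forall>\<^sub>\<infinity>x. f x = f' x" "piecewise_projective f"
  shows "germ f' = germ f"
proof
  fix p
  have "\<forall>\<^sub>F y in side_filter p. f' (Some y) = app (germ f p) (Some y)"
    using side_filter_almost_everywhere[OF assms(1), of p] eventually_germ[OF assms(2), of p]
    by eventually_elim simp
  then show "germ f' p = germ f p" by (rule germ_eqI)
qed

lemma germ_zero_imp_id:
  assumes "piecewise_projective f" "\<And>p. germ f p = 0"
  shows "\<forall>\<^sub>\<infinity>x. f x = x"
proof -
  have "f (Some y) = Some y" if "regular_point f y" for y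
  proof -
    obtain g where g: "\<forall>\<^sub>F z in nhds y. f (Some z) = app g (Some z)" using \<open>regular_point f y\<close> by (auto simp: regular_point_def)
    then have "g = 0" using germ_regular(1)[OF g] assms(2) by simp
    then show ?thesis using eventually_nhds_x_imp_x[OF g] by simp
  qed
  then have "{x. f x \<noteq> x} \<subseteq> insert None (Some ` {y. \<not> regular_point f y})"
    by (auto simp: image_iff) (metis not_None_eq)
  then show ?thesis
    unfolding eventually_cofinite using piecewise_projective_regular[OF assms(1)] by (simp add: finite_subset)
qed

text \<open>Germs do not depend on the representative, by \<open>germ_cong\<close>.\<close>

definition class_germ :: "(proj_line \<Rightarrow> proj_line) set \<Rightarrow> side \<Rightarrow> pgl"
  where "class_germ X = germ (SOME f. f \<in> X \<and> piecewise_projective f)"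

lemma class_germ_eq:
  assumes "PC_map f" "piecewise_projective f"
  shows "class_germ (PC_rel `` {f}) = germ f"
proof -
  have "f \<in> PC_rel `` {f}" using assms(1) by (simp add: PC_rel_def)
  then have "\<exists>f'. f' \<in> PC_rel `` {f} \<and> piecewise_projective f'" using assms(2) by blast
  define f' where "f' = (SOME f'. f' \<in> PC_rel `` {f} \<and> piecewise_projective f')"
  have "f' \<in> PC_rel `` {f}" using someI_ex[OF \<open>\<exists>f'. _\<close>] unfolding f'_def by blast
  then have "\<forall>\<^sub>\<infinity>x. f x = f' x" by (simp add: PC_rel_def)
  from germ_cong[OF this assms(2)] show ?thesis by (simp only: class_germ_def f'_def)
qed

section \<open>Cyclic subgroups\<close>

text \<open>Powers in the additive notation, for the cyclic holonomy groups.\<close>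

primrec nat_multiple :: "nat \<Rightarrow> 'a::group_add \<Rightarrow> 'a" where
  "nat_multiple 0 a = 0"
| "nat_multiple (Suc n) a = a + nat_multiple n a"

definition multiple :: "int \<Rightarrow> 'a::group_add \<Rightarrow> 'a"
  where "multiple n a = (if n \<ge> 0 then nat_multiple (nat n) a else - nat_multiple (nat (- n)) a)"

lemma nat_multiple_comm: "a + nat_multiple n a = nat_multiple n a + a"
  by (induction n) (auto simp flip: add.assoc)

lemma multiple_0 [simp]: "multiple 0 a = 0"
  by (simp add: multiple_def)

lemma multiple_1 [simp]: "multiple 1 a = a"
  by (simp add: multiple_def)

lemma multiple_succ: "multiple (n + 1) a = a + multiple n a"
proof (cases "n \<ge> 0")
  case True
  then have "nat (n + 1) = Suc (nat n)" by simp
  then show ?thesis using True by (simp add: multiple_def)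
next
  case False
  then obtain m where m: "n = - int (Suc m)" by (metis negD not_le)
  show ?thesis
  proof (cases m)
    case 0 then show ?thesis using m by (simp add: multiple_def)
  next
    case (Suc j)
    have "- nat_multiple m a = a + - (nat_multiple m a + a)"
      by (simp only: minus_add add_minus_cancel)
    then have "- nat_multiple m a = a + - (a + nat_multiple m a)" by (simp only: nat_multiple_comm)
    moreover have "nat (- (n + 1)) = m" "nat (- n) = Suc m" "\<not> 0 \<le> n + 1" "\<not> 0 \<le> n" using m Suc by auto
    ultimately show ?thesis by (simp only: multiple_def if_False nat_multiple.simps(2))
  qed
qed

lemma multiple_pred: "multiple (n - 1) a = - a + multiple n a"
  using multiple_succ[of "n - 1" a] by simp

lemma multiple_add: "multiple (m + n) a = multiple m a + multiple n a"
proof (induction m rule: int_induct[of _ 0])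
  case (step1 i)
  have "multiple (i + 1 + n) a = a + multiple (i + n) a" using multiple_succ[of "i + n" a] by (simp add: ac_simps)
  then show ?case using step1 by (simp add: multiple_succ add.assoc)
next
  case (step2 i)
  have "multiple (i - 1 + n) a = - a + multiple (i + n) a" using multiple_pred[of "i + n" a] by (simp add: algebra_simps)
  then show ?case using step2 by (simp add: multiple_pred add.assoc)
qed simp

lemma multiple_minus: "multiple (- n) a = - multiple n a"
  using multiple_add[of "- n" n a] by (simp add: eq_neg_iff_add_eq_0)

lemma multiple_commute: "multiple m a + multiple n a = multiple n a + multiple m a"
  by (simp flip: multiple_add add: add.commute)

lemma multiple_multiple: "multiple m (multiple n a) = multiple (m * n) a"
proof (induction m rule: int_induct[of _ 0])
  case (step1 i)
  have "(i + 1) * n = n + i * n" by (simp add: algebra_simps)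
  then show ?case using step1 by (simp only: multiple_succ) (simp only: multiple_add)
next
  case (step2 i)
  have "(i - 1) * n = - n + i * n" by (simp add: algebra_simps)
  then show ?case using step2 by (simp only: multiple_pred) (simp only: multiple_add multiple_minus)
qed simp

lemma multiple_conj: "multiple n (e + a + - e) = e + multiple n a + - e"
proof (induction n rule: int_induct[of _ 0])
  case (step1 i) then show ?case by (simp only: multiple_succ add.assoc minus_add_cancel)
next
  case (step2 i) then show ?case by (simp only: multiple_pred add.assoc minus_add minus_minus minus_add_cancel)
qed (simp only: multiple_0 add_0_right add.right_inverse)

text \<open>An automorphism of the cyclic group generated by \<open>a\<close> maps \<open>a\<close> to \<open>a\<close> or \<open>- a\<close>, unless the
  group is finite.\<close>

lemma finite_conjugate_generators:
  "finite {s \<in> range (\<lambda>n. multiple n a). \<exists>e. s = e + a + - e \<and> - e + a + e \<in> range (\<lambda>n. multiple n a)}"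
    (is "finite ?A")
proof (cases "\<exists>N>0. multiple N a = 0")
  case True
  then obtain N where N: "N > 0" "multiple N a = 0" by blast
  have "multiple n a = multiple (n mod N) a" for n
  proof -
    have "multiple n a = multiple (n div N * N + n mod N) a" by simp
    also have "\<dots> = multiple (n div N) (multiple N a) + multiple (n mod N) a"
      by (simp only: multiple_add multiple_multiple)
    also have "\<dots> = multiple (n div N) (multiple 0 a) + multiple (n mod N) a" using N(2) by simp
    also have "\<dots> = multiple (n mod N) a" unfolding multiple_multiple by simp
    finally show ?thesis .
  qed
  then have "range (\<lambda>n. multiple n a) \<subseteq> (\<lambda>n. multiple n a) ` {0..<N}"
    using N(1) by (auto intro!: image_eqI[of _ _ "_ mod N"])
  then have "finite (range (\<lambda>n. multiple n a))" by (rule finite_subset) simp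
  then show ?thesis by simp
next
  case False
  have "?A \<subseteq> {a, - a}"
  proof
    fix s assume "s \<in> ?A"
    then obtain m e m' where s: "s = multiple m a" "s = e + a + - e" "- e + a + e = multiple m' a" by blast
    have "a = e + (- e + a + e) + - e" by (simp only: add.assoc add_minus_cancel add.right_inverse add_0_right)
    also have "\<dots> = multiple m' s" unfolding s(3) s(2) multiple_conj ..
    also have "\<dots> = multiple (m' * m) a" unfolding s(1) multiple_multiple ..
    finally have "multiple (m' * m - 1) a = 0" using multiple_add[of "m' * m" "-1" a] by (simp add: multiple_minus)
    moreover from this have "multiple (- (m' * m - 1)) a = 0" by (simp only: multiple_minus minus_zero)
    ultimately have "m' * m = 1" using False by (metis diff_gt_0_iff_gt linorder_neqE_linordered_idom minus_diff_eq eq_iff_diff_eq_0)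
    then have "m = 1 \<or> m = - 1" using zmult_eq_1_iff by blast
    then show "s \<in> {a, - a}" using s(1) by (auto simp: multiple_minus)
  qed
  then show ?thesis by (rule finite_subset) simp
qed

section \<open>Invariant gluings and atlases\<close>

text \<open>All that is used about a group of piecewise projective transformations: the homography \<open>c g p\<close>
  which \<open>g\<close> agrees with near the side \<open>p\<close>.\<close>

locale projective_cocycle =
  fixes G :: "('g, 'm) monoid_scheme" (structure) and c :: "'g \<Rightarrow> side \<Rightarrow> pgl"
  assumes T: "property_T G"
    and c_one: "c \<one> p = 0"
    and c_mult: "\<lbrakk>g \<in> carrier G; h \<in> carrier G\<rbrakk> \<Longrightarrow> c (g \<otimes> h) p = c g (side_act (c h p) p) + c h p"
    and c_cont: "g \<in> carrier G \<Longrightarrow> side_continuous (c g)"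
    and c_jumps: "g \<in> carrier G \<Longrightarrow> finite {y. c g (Below y) \<noteq> c g (Above y)}"
    and c_faithful: "\<lbrakk>g \<in> carrier G; \<And>p. c g p = 0\<rbrakk> \<Longrightarrow> g = \<one>"
begin

sublocale group G by (rule property_TD(1)[OF T])

definition act :: "'g \<Rightarrow> side \<Rightarrow> side"
  where "act g p = side_act (c g p) p"

lemma act: "acts_on G UNIV act"
  by (rule acts_onI) (simp_all add: act_def c_one c_mult side_act_plus)

lemma act_one [simp]: "act \<one> p = p"
  by (simp add: act_def c_one)

lemma act_mult: "g \<in> carrier G \<Longrightarrow> h \<in> carrier G \<Longrightarrow> act (g \<otimes> h) p = act g (act h p)"
  using acts_onD(3)[OF act] by simp

lemma act_inv: "g \<in> carrier G \<Longrightarrow> act (inv g) (act g p) = p" "g \<in> carrier G \<Longrightarrow> act g (act (inv g) p) = p"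
  using acts_on_inv[OF is_group act] by simp_all

lemma c_mult': "g \<in> carrier G \<Longrightarrow> h \<in> carrier G \<Longrightarrow> c (g \<otimes> h) p = c g (act h p) + c h p"
  by (simp add: c_mult act_def)

lemma side_continuous_comp_act: "g \<in> carrier G \<Longrightarrow> side_continuous \<phi> \<Longrightarrow> side_continuous (\<lambda>p. \<phi> (act g p))"
  unfolding act_def by (rule side_continuous_act[OF c_cont])

lemma finite_range_c: "g \<in> carrier G \<Longrightarrow> finite (range (c g))"
  by (rule finite_range_of_finite_jumps[OF c_jumps c_cont]) auto

lemma finite_opp_jumps: "g \<in> carrier G \<Longrightarrow> finite {p. c g p \<noteq> c g (opp p)}"
proof -
  assume g: "g \<in> carrier G"
  let ?E = "insert None (Some ` {y. c g (Below y) \<noteq> c g (Above y)})"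
  have "{p. c g p \<noteq> c g (opp p)} \<subseteq> {p. base p \<in> ?E}"
  proof clarify
    fix p assume "c g p \<noteq> c g (opp p)" "base p \<notin> Some ` {y. c g (Below y) \<noteq> c g (Above y)}"
    then show "base p = None" by (cases p) (auto simp: image_iff)
  qed
  moreover have "finite {p. base p \<in> ?E}" using c_jumps[OF g] by (intro finite_base_vimage) auto
  ultimately show ?thesis by (rule finite_subset)
qed

text \<open>A gluing \<open>(p, q, h)\<close> prescribes that a chart \<open>\<phi>\<close> near \<open>q\<close> and the chart \<open>\<phi> + h\<close> near \<open>p\<close> fit
  together. After applying \<open>g\<close>, charts are composed with the inverse of its germs, which gives this
  formula.\<close>

definition glue_act :: "'g \<Rightarrow> side \<times> side \<times> pgl \<Rightarrow> side \<times> side \<times> pgl"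
  where "glue_act g = (\<lambda>(p, q, h). (act g p, act g q, c g q + h + - c g p))"

lemma glue_act: "acts_on G UNIV glue_act"
  by (rule acts_onI)
    (auto simp: glue_act_def act_mult c_one c_mult' add.assoc minus_add simp del: add_uminus_conv_diff)

definition standard :: "(side \<times> side \<times> pgl) set"
  where "standard = range (\<lambda>p. (p, opp p, 0))"

lemma finite_glue_act_standard: "g \<in> carrier G \<Longrightarrow> finite (glue_act g ` standard - standard)"
proof -
  assume g: "g \<in> carrier G"
  have "glue_act g ` standard - standard \<subseteq> (\<lambda>p. glue_act g (p, opp p, 0)) ` {p. c g p \<noteq> c g (opp p)}"
  proof
    fix x assume x: "x \<in> glue_act g ` standard - standard"
    then obtain p where p: "x = glue_act g (p, opp p, 0)" by (auto simp: standard_def)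
    have "c g p \<noteq> c g (opp p)"
    proof
      assume "c g p = c g (opp p)"
      then have "x = (act g p, opp (act g p), 0)" by (simp add: p glue_act_def act_def side_act_opp)
      then show False using x by (auto simp: standard_def)
    qed
    then show "x \<in> (\<lambda>p. glue_act g (p, opp p, 0)) ` {p. c g p \<noteq> c g (opp p)}" using p by blast
  qed
  then show ?thesis using finite_opp_jumps[OF g] by (meson finite_imageI finite_subset)
qed

text \<open>The standard gluings are commensurated by \<open>finite_glue_act_standard\<close>. From an invariant set \<open>Y\<close>
  near them, keep the gluings whose reverse is also in \<open>Y\<close>, and among these the ones that
  compete with no other gluing at either of their two sides. These conditions are invariant, and
  only spoil finitely many standard gluings, because each spoilt one is accounted for by a
  difference between \<open>Y\<close> and the standard set.\<close>

lemma invariant_matching: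
  obtains R where
    "\<And>p q h. (p, q, h) \<in> R \<Longrightarrow> (q, p, - h) \<in> R"
    "\<And>p q h q' h'. (p, q, h) \<in> R \<Longrightarrow> (p, q', h') \<in> R \<Longrightarrow> q' = q \<and> h' = h"
    "\<And>p q h. (p, q, h) \<in> R \<Longrightarrow> p \<noteq> q"
    "\<And>g x. g \<in> carrier G \<Longrightarrow> x \<in> R \<Longrightarrow> glue_act g x \<in> R"
    "finite (standard - R)"
proof -
  obtain Y where Y: "\<And>g. g \<in> carrier G \<Longrightarrow> glue_act g ` Y = Y" "finite (sym_diff standard Y)"
    using property_T_transfixes[OF T glue_act _ finite_glue_act_standard] by auto
  define S where "S = {(p, q, h). (p, q, h) \<in> Y \<and> (q, p, - h) \<in> Y \<and> p \<noteq> q}"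
  have S_sym: "(q, p, - h) \<in> S" if "(p, q, h) \<in> S" for p q h using that by (auto simp: S_def)
  define rev where "rev = (\<lambda>(p :: side, q :: side, h :: pgl). (q, p, - h))"
  have rev_act: "rev (glue_act g x) = glue_act g (rev x)" for g x
    by (cases x) (simp add: rev_def glue_act_def minus_add add.assoc del: add_uminus_conv_diff)
  have S_iff: "x \<in> S \<longleftrightarrow> x \<in> Y \<and> rev x \<in> Y \<and> fst x \<noteq> fst (rev x)" for x
    by (cases x) (auto simp: S_def rev_def)
  have YI: "glue_act g x \<in> Y" if "g \<in> carrier G" "x \<in> Y" for g x using Y(1) that by blast
  have act_eq: "act g p = act g q \<longleftrightarrow> p = q" if "g \<in> carrier G" for g p q
    using act_inv(1)[OF that] by metis
  have SI: "glue_act g x \<in> S" if "g \<in> carrier G" "x \<in> S" for g x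
  proof -
    have "fst (glue_act g x) \<noteq> fst (glue_act g (rev x))"
      using that act_eq[OF that(1)] by (cases x) (auto simp: S_iff rev_def glue_act_def)
    then show ?thesis using that YI unfolding S_iff rev_act by auto
  qed
  define R where "R = {(p, q, h) \<in> S. (\<forall>q' h'. (p, q', h') \<in> S \<longrightarrow> q' = q \<and> h' = h) \<and>
    (\<forall>q' h'. (q, q', h') \<in> S \<longrightarrow> q' = p \<and> h' = - h)}"
  show thesis
  proof (rule that)
    show "(q, p, - h) \<in> R" if "(p, q, h) \<in> R" for p q h using that S_sym by (auto simp: R_def)
    show "q' = q \<and> h' = h" if "(p, q, h) \<in> R" "(p, q', h') \<in> R" for p q h q' h' using that unfolding R_def by blast
    show "p \<noteq> q" if "(p, q, h) \<in> R" for p q h using that unfolding R_def S_def by blast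
    show "glue_act g x \<in> R" if g: "g \<in> carrier G" and x: "x \<in> R" for g x
    proof -
      obtain p q h where xx: "x = (p, q, h)" by (cases x)
      have uniq: "q' = act g r' \<and> h' = c g r' + k + - c g r"
        if r: "\<forall>q' h'. (r, q', h') \<in> S \<longrightarrow> q' = r' \<and> h' = k" and s: "(act g r, q', h') \<in> S" for r r' k q' h'
      proof -
        have ig: "inv g \<in> carrier G" using g by simp
        have "fst (glue_act (inv g) (act g r, q', h')) = r" using act_inv(1)[OF g] by (simp add: glue_act_def)
        then have "glue_act (inv g) (act g r, q', h') = (r, r', k)"
          using SI[OF ig s] r by (metis prod.collapse)
        then have "glue_act g (r, r', k) = (act g r, q', h')"
          using acts_on_inv(2)[OF is_group glue_act g, of "(act g r, q', h')"] by simp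
        then show ?thesis by (simp add: glue_act_def)
      qed
      have "(p, q, h) \<in> S" and u1: "\<forall>q' h'. (p, q', h') \<in> S \<longrightarrow> q' = q \<and> h' = h"
        and u2: "\<forall>q' h'. (q, q', h') \<in> S \<longrightarrow> q' = p \<and> h' = - h" using x unfolding xx R_def by blast+
      let ?h = "c g q + h + - c g p"
      have "c g p + - h + - c g q = - ?h" by (simp only: minus_add minus_minus add.assoc)
      then have "\<forall>q' h'. (act g q, q', h') \<in> S \<longrightarrow> q' = act g p \<and> h' = - ?h" using uniq[OF u2] by metis
      moreover have "\<forall>q' h'. (act g p, q', h') \<in> S \<longrightarrow> q' = act g q \<and> h' = ?h" using uniq[OF u1] by blast
      moreover have "(act g p, act g q, ?h) \<in> S"
        using SI[OF g \<open>(p, q, h) \<in> S\<close>] by (simp only: glue_act_def prod.case)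
      ultimately show ?thesis unfolding xx glue_act_def R_def mem_Collect_eq prod.case by (intro conjI)
    qed
    have "standard - R \<subseteq> (sym_diff standard Y) \<union> rev ` (sym_diff standard Y)
        \<union> (\<lambda>p. (p, opp p, 0)) ` (fst ` sym_diff standard Y) \<union> (\<lambda>p. (opp p, p, 0)) ` (fst ` sym_diff standard Y)"
      (is "_ \<subseteq> ?B")
    proof
      fix x assume x: "x \<in> standard - R"
      then obtain p where p: "x = (p, opp p, 0)" by (auto simp: standard_def)
      have st: "(r, opp r, 0) \<in> standard" for r by (auto simp: standard_def)
      have st_iff: "(r, r', k) \<in> standard \<longleftrightarrow> r' = opp r \<and> k = 0" for r r' k by (auto simp: standard_def)
      have rx: "rev (opp p, p, 0) = x" by (simp add: p rev_def)
      have "(opp p, p, 0) \<in> standard" using st[of "opp p"] by simp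
      show "x \<in> ?B"
      proof (cases "x \<in> Y \<and> (opp p, p, 0) \<in> Y")
        case False
        then have "x \<in> sym_diff standard Y \<or> (opp p, p, 0) \<in> sym_diff standard Y"
          using x \<open>(opp p, p, 0) \<in> standard\<close> by blast
        then show ?thesis using rx by blast
      next
        case True
        then have "x \<in> S" using not_sym[OF opp_neq[of p]] by (auto simp: p S_def)
        then have "\<not> ((\<forall>q' h'. (p, q', h') \<in> S \<longrightarrow> q' = opp p \<and> h' = 0) \<and>
            (\<forall>q' h'. (opp p, q', h') \<in> S \<longrightarrow> q' = p \<and> h' = - 0))"
          using x unfolding p R_def by blast
        then obtain q' h' where "((p, q', h') \<in> S \<and> \<not> (q' = opp p \<and> h' = 0)) \<or> ((opp p, q', h') \<in> S \<and> \<not> (q' = p \<and> h' = - 0))"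
          by blast
        moreover have "S \<subseteq> Y" by (auto simp: S_def)
        ultimately have "((p, q', h') \<in> Y \<and> \<not> (q' = opp p \<and> h' = 0)) \<or> ((opp p, q', h') \<in> Y \<and> \<not> (q' = p \<and> h' = 0))"
          by auto
        then have "(p, q', h') \<in> sym_diff standard Y \<or> (opp p, q', h') \<in> sym_diff standard Y"
          by (auto simp: st_iff)
        then have "p \<in> fst ` sym_diff standard Y \<or> opp p \<in> fst ` sym_diff standard Y" by force
        then show ?thesis
        proof
          assume "p \<in> fst ` sym_diff standard Y"
          then show ?thesis unfolding p by blast
        next
          assume "opp p \<in> fst ` sym_diff standard Y"
          then have "(opp (opp p), opp p, 0) \<in> (\<lambda>p. (opp p, p, 0 :: pgl)) ` (fst ` sym_diff standard Y)" by blast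
          then show ?thesis unfolding p by simp
        qed
      qed
    qed
    moreover have "finite ?B" using Y(2) by simp
    ultimately show "finite (standard - R)" by (rule finite_subset)
  qed
qed

end

locale projective_gluing = projective_cocycle +
  fixes R :: "(side \<times> side \<times> pgl) set"
  assumes R_sym: "(p, q, h) \<in> R \<Longrightarrow> (q, p, - h) \<in> R"
    and R_unique: "(p, q, h) \<in> R \<Longrightarrow> (p, q', h') \<in> R \<Longrightarrow> q' = q \<and> h' = h"
    and R_neq: "(p, q, h) \<in> R \<Longrightarrow> p \<noteq> q"
    and R_act: "g \<in> carrier G \<Longrightarrow> x \<in> R \<Longrightarrow> glue_act g x \<in> R"
    and R_standard: "finite (standard - R)"
begin

text \<open>The sides at which an atlas (see below) fails to be compatible with the matching: they are glued to another
  piece, or to the same piece by a transition other than the one in the charts.\<close>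

definition marked :: "(side \<Rightarrow> nat) \<Rightarrow> (side \<Rightarrow> pgl) \<Rightarrow> side set"
  where "marked v D = {p. \<exists>q h. (p, q, h) \<in> R \<and> \<not> (v p = v q \<and> D q + h = D p)}"

text \<open>Connectedness of the piece with number \<open>k\<close> in the glued manifold: continuous boolean functions
  that agree across the compatible gluings within it are constant.\<close>

definition connected_piece :: "(side \<Rightarrow> nat) \<Rightarrow> (side \<Rightarrow> pgl) \<Rightarrow> nat \<Rightarrow> bool"
  where "connected_piece v D k \<longleftrightarrow> (\<forall>\<phi> :: side \<Rightarrow> bool. side_continuous \<phi> \<longrightarrow>
     (\<forall>p q h. (p, q, h) \<in> R \<longrightarrow> v p = k \<longrightarrow> v q = k \<longrightarrow> D q + h = D p \<longrightarrow> \<phi> p = \<phi> q) \<longrightarrow>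
     (\<forall>p q. v p = k \<longrightarrow> v q = k \<longrightarrow> \<phi> p = \<phi> q))"

text \<open>The function \<open>v\<close> numbers the pieces, and \<open>D p\<close> is the chart used near the side \<open>p\<close>. The bound
  of two on the marked sides of a piece says that pieces are intervals with two ends; it is the
  reason why no component has more than one independent loop.\<close>

definition atlas :: "(side \<Rightarrow> nat) \<Rightarrow> (side \<Rightarrow> pgl) \<Rightarrow> bool"
  where "atlas v D \<longleftrightarrow> side_continuous v \<and> side_continuous D \<and> finite (range v) \<and> finite (range D) \<and>
     (\<forall>k. finite {p \<in> marked v D. v p = k} \<and> card {p \<in> marked v D. v p = k} \<le> 2 \<and> connected_piece v D k)"

lemma connected_pieceD:
  assumes "connected_piece v D k" "side_continuous \<phi>"
    "\<And>p q h. (p, q, h) \<in> R \<Longrightarrow> v p = k \<Longrightarrow> v q = k \<Longrightarrow> D q + h = D p \<Longrightarrow> \<phi> p = \<phi> q" "v p = k" "v q = k"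
  shows "\<phi> p = (\<phi> q :: bool)"
proof -
  have "\<forall>p q. v p = k \<longrightarrow> v q = k \<longrightarrow> \<phi> p = \<phi> q"
    using assms(1)[unfolded connected_piece_def, rule_format, of \<phi>] assms(2,3) by blast
  then show ?thesis using assms(4,5) by blast
qed

text \<open>Cut the real line at the finite set \<open>P\<close> of points at which the matching is not standard, and
  take the identity as chart everywhere. Only the sides of the points of \<open>P\<close> and of
  infinity are marked, and an interval has one left and one right end.\<close>

lemma initial_atlas: "\<exists>v D. atlas v D"
proof -
  define B where "B = {p. (p, opp p, 0) \<notin> R}"
  have "B \<subseteq> fst ` (standard - R)" by (force simp: B_def standard_def image_iff)
  then have fB: "finite B" using R_standard by (meson finite_imageI finite_subset)
  define P where "P = {y. Below y \<in> B \<or> Above y \<in> B}"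
  have "P \<subseteq> Below -` B \<union> Above -` B" by (auto simp: P_def)
  moreover have "finite (Below -` B)" "finite (Above -` B)"
    using fB by (auto intro!: finite_vimageI simp: inj_def)
  ultimately have fP: "finite P" by (meson finite_UnI finite_subset)
  let ?v = "rank P" and ?D = "\<lambda>_ :: side. 0 :: pgl"
  have reg: "(Below y, Above y, 0) \<in> R" "(Above y, Below y, 0) \<in> R" if "y \<notin> P" for y
    using that by (auto simp: P_def B_def)
  have rank_eq: "rank P (Below y) = rank P (Above y)" if "y \<notin> P" for y
    using that by (auto intro!: arg_cong[where f = card] simp: le_less)
  have marked: "base p \<in> insert None (Some ` P)" if "p \<in> marked ?v ?D" for p
  proof (rule ccontr)
    assume "base p \<notin> insert None (Some ` P)"
    then obtain y where y: "base p = Some y" "y \<notin> P" by (cases "base p") auto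
    then have "(p, opp p, 0) \<in> R" "rank P p = rank P (opp p)"
      using reg rank_eq by (auto simp: base_eq_Some)
    then show False using that R_unique by (fastforce simp: marked_def)
  qed
  have lt: "rank P (Above x) < rank P (Above y)" "rank P (Below x) < rank P (Below y)"
    if "x < y" "x \<in> P" "y \<in> P" for x y
  proof -
    have "{t \<in> P. t \<le> x} \<subset> {t \<in> P. t \<le> y}" using that by force
    moreover have "{t \<in> P. t < x} \<subset> {t \<in> P. t < y}" using that by force
    ultimately show "rank P (Above x) < rank P (Above y)" "rank P (Below x) < rank P (Below y)"
      using fP by (auto intro: psubset_card_mono)
  qed
  have inj: "x = y" if "x \<in> P" "y \<in> P" "rank P (Above x) = rank P (Above y) \<or> rank P (Below x) = rank P (Below y)" for x y
    using lt[of x y] lt[of y x] that by (metis less_irrefl linorder_neqE_linordered_idom)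
  have pos: "rank P (Above x) > 0" "rank P (Below x) < card P" if "x \<in> P" for x
  proof -
    show "rank P (Above x) > 0" using that fP by (auto simp: card_gt_0_iff)
    have "{t \<in> P. t < x} \<subset> P" using that by force
    then show "rank P (Below x) < card P" using fP by (simp add: psubset_card_mono)
  qed
  have two: "finite {p \<in> marked ?v ?D. ?v p = k} \<and> card {p \<in> marked ?v ?D. ?v p = k} \<le> 2" for k
  proof -
    let ?L = "{p. (p = NegInf \<or> (\<exists>x\<in>P. p = Above x)) \<and> ?v p = k}"
    let ?U = "{p. (p = PosInf \<or> (\<exists>x\<in>P. p = Below x)) \<and> ?v p = k}"
    have single: "finite A \<and> card A \<le> 1" if "\<And>p q. p \<in> A \<Longrightarrow> q \<in> A \<Longrightarrow> p = q" for A :: "side set"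
    proof (cases "A = {}")
      case False
      then obtain a where "a \<in> A" by blast
      then have "A = {a}" using that by blast
      then show ?thesis by simp
    qed simp
    have L: "finite ?L \<and> card ?L \<le> 1"
    proof (rule single)
      fix p q assume pq: "p \<in> ?L" "q \<in> ?L"
      show "p = q"
      proof (cases "p = NegInf"; cases "q = NegInf")
        assume "p = NegInf" "q \<noteq> NegInf"
        then show ?thesis using pq pos(1) by fastforce
      next
        assume "p \<noteq> NegInf" "q = NegInf"
        then show ?thesis using pq pos(1) by fastforce
      next
        assume "p \<noteq> NegInf" "q \<noteq> NegInf"
        then obtain x y where "p = Above x" "q = Above y" "x \<in> P" "y \<in> P" using pq by blast
        then show ?thesis using pq inj[of x y] by simp
      qed simp
    qed
    have U: "finite ?U \<and> card ?U \<le> 1"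
    proof (rule single)
      fix p q assume pq: "p \<in> ?U" "q \<in> ?U"
      show "p = q"
      proof (cases "p = PosInf"; cases "q = PosInf")
        assume "p = PosInf" "q \<noteq> PosInf"
        then show ?thesis using pq pos(2) by fastforce
      next
        assume "p \<noteq> PosInf" "q = PosInf"
        then show ?thesis using pq pos(2) by fastforce
      next
        assume "p \<noteq> PosInf" "q \<noteq> PosInf"
        then obtain x y where "p = Below x" "q = Below y" "x \<in> P" "y \<in> P" using pq by blast
        then show ?thesis using pq inj[of x y] by simp
      qed simp
    qed
    have "{p \<in> marked ?v ?D. ?v p = k} \<subseteq> ?L \<union> ?U"
    proof clarify
      fix p assume p: "p \<in> marked ?v ?D" "k = rank P p"
        "\<not> ((p = PosInf \<or> (\<exists>x\<in>P. p = Below x)) \<and> rank P p = rank P p)"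
      show "(p = NegInf \<or> (\<exists>x\<in>P. p = Above x)) \<and> rank P p = rank P p"
        using marked[OF p(1)] p(3) by (cases p) auto
    qed
    moreover have "finite (?L \<union> ?U)" "card (?L \<union> ?U) \<le> 2"
      using L U card_Un_le[of ?L ?U] by auto
    ultimately show ?thesis by (meson card_mono finite_subset order_trans)
  qed
  have conn: "connected_piece ?v ?D k" for k
    unfolding connected_piece_def
  proof (intro allI impI)
    fix \<phi> :: "side \<Rightarrow> bool" and p q
    assume \<phi>: "side_continuous \<phi>" and eq: "\<forall>p q h. (p, q, h) \<in> R \<longrightarrow> ?v p = k \<longrightarrow> ?v q = k \<longrightarrow> 0 + h = 0 \<longrightarrow> \<phi> p = \<phi> q"
      and pq: "?v p = k" "?v q = k"
    let ?\<psi> = "\<lambda>r. ?v r = k \<and> \<phi> r"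
    have \<psi>: "side_continuous ?\<psi>"
      using side_continuous_compose2[OF side_continuous_rank[OF fP] \<phi>, of "\<lambda>i b. i = k \<and> b"] .
    have \<psi>eq: "?\<psi> (Below y) = ?\<psi> (Above y)" if "y \<notin> P" for y
      using eq[rule_format, OF reg(1)[OF that]] rank_eq[OF that] by auto
    have "?\<psi> p = ?\<psi> q"
      by (rule side_continuous_eq_of_rank_eq[where \<phi> = ?\<psi>, OF fP \<psi> \<psi>eq]) (simp_all add: pq)
    then show "\<phi> p = \<phi> q" using pq by simp
  qed
  have "range ?v \<subseteq> {..card P}" using rank_le[OF fP] by auto
  then have finv: "finite (range ?v)" by (rule finite_subset) simp
  have "atlas ?v ?D"
    unfolding atlas_def
  proof (intro conjI allI)
    fix k
    show "finite {p \<in> marked ?v ?D. ?v p = k}" "card {p \<in> marked ?v ?D. ?v p = k} \<le> 2" using two[of k] by auto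
  qed (simp_all add: side_continuous_rank[OF fP] side_continuous_const finv conn)
  then show ?thesis by blast
qed

text \<open>Two pieces that are joined by a gluing \<open>(p, q, h)\<close> become one, after a change of the charts of the second by the
  constant \<open>a\<close> which makes this gluing compatible. The sides \<open>p\<close> and \<open>q\<close> are no longer marked, so
  that the union again has at most \<open>1 + 1\<close> marked sides.\<close>

lemma merge_pieces:
  assumes at: "atlas v D" and pqh: "(p, q, h) \<in> R" and ne: "v p \<noteq> v q"
  shows "\<exists>v' D'. atlas v' D' \<and> card (range v') < card (range v)"
proof -
  define k l where kl: "k = v p" "l = v q"
  define a where "a = D p + - h + - D q"
  define v' where "v' r = (if v r = l then k else v r)" for r
  define D' where "D' r = (if v r = l then a + D r else D r)" for r
  note at = at[unfolded atlas_def]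
  have kl_ne: "k \<noteq> l" using ne kl by simp
  have cont: "side_continuous v'" "side_continuous D'"
    unfolding v'_def D'_def
    using side_continuous_compose[of v "\<lambda>i. if i = l then k else i"]
      side_continuous_compose2[of v D "\<lambda>i e. if i = l then a + e else e"] at by auto
  have rng: "range v' \<subseteq> range v - {l}" using kl kl_ne by (auto simp: v'_def)
  have "range v - {l} \<subset> range v" using kl by auto
  then have card: "card (range v') < card (range v)"
    using rng at by (meson card_mono finite_Diff le_less_trans psubset_card_mono)
  have finv: "finite (range v')" using rng at by (meson finite_Diff finite_subset)
  have "range D' \<subseteq> range D \<union> (\<lambda>e. a + e) ` range D" by (auto simp: D'_def)
  then have finD: "finite (range D')" using at by (meson finite_UnI finite_imageI finite_subset)
  have keep: "v' r = v' s \<and> D' s + j = D' r" if "v r = v s" "D s + j = D r" for r s j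
    using that by (simp add: v'_def D'_def add.assoc)
  have glued: "v' p = k" "v' q = k" "D' q + h = D' p"
    using kl kl_ne by (simp_all add: v'_def D'_def a_def add.assoc)
  then have glued': "D' p + - h = D' q" by (metis add.assoc add.right_inverse add_0_right)
  have pq_marked: "p \<in> marked v D" "q \<in> marked v D"
    using pqh R_sym[OF pqh] ne unfolding marked_def by (metis (mono_tags, lifting) mem_Collect_eq)+
  have mk: "marked v' D' \<subseteq> marked v D - {p, q}"
  proof
    fix r assume "r \<in> marked v' D'"
    then obtain s j where rs: "(r, s, j) \<in> R" "\<not> (v' r = v' s \<and> D' s + j = D' r)" by (auto simp: marked_def)
    have "r \<in> marked v D" using rs keep unfolding marked_def by blast
    moreover have "r \<noteq> p" using rs R_unique[OF pqh] glued by metis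
    moreover have "r \<noteq> q" using rs R_unique[OF R_sym[OF pqh]] glued glued' by metis
    ultimately show "r \<in> marked v D - {p, q}" by simp
  qed
  have two: "finite {r \<in> marked v' D'. v' r = i} \<and> card {r \<in> marked v' D'. v' r = i} \<le> 2" for i
  proof (cases "i = k")
    case True
    let ?A = "\<lambda>i. {r \<in> marked v D. v r = i}"
    have fA: "finite (?A k)" "finite (?A l)" "card (?A k) \<le> 2" "card (?A l) \<le> 2" using at by auto
    have "{r \<in> marked v' D'. v' r = i} \<subseteq> (?A k - {p}) \<union> (?A l - {q})"
      using mk by (auto simp: True v'_def split: if_splits)
    moreover have "card (?A k - {p}) \<le> 1" "card (?A l - {q}) \<le> 1"
      using fA pq_marked kl by (simp_all add: card_Diff_singleton)
    then have "card ((?A k - {p}) \<union> (?A l - {q})) \<le> 2" using card_Un_le[of "?A k - {p}" "?A l - {q}"] by linarith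
    moreover have "finite ((?A k - {p}) \<union> (?A l - {q}))" using fA by simp
    ultimately show ?thesis by (meson card_mono finite_subset order_trans)
  next
    case False
    then have "{r \<in> marked v' D'. v' r = i} \<subseteq> {r \<in> marked v D. v r = i}"
      using mk by (auto simp: v'_def split: if_splits)
    moreover have "finite {r \<in> marked v D. v r = i}" "card {r \<in> marked v D. v r = i} \<le> 2" using at by auto
    ultimately show ?thesis by (meson card_mono finite_subset order_trans)
  qed
  have conn: "connected_piece v' D' i" for i
    unfolding connected_piece_def
  proof (intro allI impI)
    fix \<phi> :: "side \<Rightarrow> bool" and r s
    assume \<phi>: "side_continuous \<phi>"
      and eq: "\<forall>p q h. (p, q, h) \<in> R \<longrightarrow> v' p = i \<longrightarrow> v' q = i \<longrightarrow> D' q + h = D' p \<longrightarrow> \<phi> p = \<phi> q"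
      and rs: "v' r = i" "v' s = i"
    have old: "\<phi> r = \<phi> s" if j: "v r = j" "v s = j" "v' r = i" for r s j
    proof (rule connected_pieceD[of v D j \<phi>])
      show "connected_piece v D j" using at by blast
      show "\<phi> x = \<phi> y" if "(x, y, t) \<in> R" "v x = j" "v y = j" "D y + t = D x" for x y t
      proof -
        have "v' x = i" "v' y = i" using that j by (auto simp: v'_def)
        then show ?thesis using eq that keep[of x y t] by auto
      qed
    qed (use \<phi> j in auto)
    show "\<phi> r = \<phi> s"
    proof (cases "i = k")
      case True
      have "\<phi> p = \<phi> q" using eq pqh glued True by blast
      moreover have "\<phi> x = \<phi> p" if "v' x = k" for x
      proof (cases "v x = l")
        case x: True
        have "\<phi> x = \<phi> q" by (rule old[OF x kl(2)[symmetric]]) (simp only: that \<open>i = k\<close>)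
        then show ?thesis using \<open>\<phi> p = \<phi> q\<close> by simp
      next
        case False
        then have x: "v x = k" using that by (simp add: v'_def)
        show ?thesis by (rule old[OF x kl(1)[symmetric]]) (simp only: that \<open>i = k\<close>)
      qed
      ultimately show ?thesis using rs True by metis
    next
      case False
      then have "v r = i" "v s = i" using rs by (auto simp: v'_def split: if_splits)
      then show ?thesis using old rs by blast
    qed
  qed
  have "atlas v' D'"
    unfolding atlas_def
  proof (intro conjI allI)
    fix i
    show "finite {r \<in> marked v' D'. v' r = i}" "card {r \<in> marked v' D'. v' r = i} \<le> 2" using two[of i] by auto
  qed (simp_all add: cont finv finD conn)
  then show ?thesis using card by blast
qed

text \<open>With the minimal number of pieces, nothing is left to merge.\<close>

lemma unbranched_atlas:
  obtains v D where "atlas v D" "\<And>p q h. (p, q, h) \<in> R \<Longrightarrow> v p = v q"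
proof -
  obtain v0 D0 where "atlas v0 D0" using initial_atlas by blast
  then obtain v D where vD: "atlas v D"
    and least: "\<And>v' D'. atlas v' D' \<Longrightarrow> card (range v) \<le> card (range v')"
    using ex_has_least_nat[of "\<lambda>x. atlas (fst x) (snd x)" "(v0, D0)" "\<lambda>x. card (range (fst x))"] by auto
  have "v p = v q" if "(p, q, h) \<in> R" for p q h
    using merge_pieces[OF vD that] least by (meson not_le)
  then show thesis using that vD by blast
qed

end

section \<open>Finiteness\<close>

context projective_cocycle
begin

text \<open>Subgroups that replace the whole group when an orbit is to be shown finite. They arise by
  iterating the passage to stabilizers of points with finite orbits, so they have finite index.\<close>

definition large :: "'g set \<Rightarrow> bool"
  where "large H \<longleftrightarrow> subgroup H G \<and> property_T (G\<lparr>carrier := H\<rparr>) \<and>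
    (\<forall>bct (y :: side \<times> pgl). acts_on G UNIV bct \<longrightarrow> finite ((\<lambda>g. bct g y) ` H) \<longrightarrow> finite ((\<lambda>g. bct g y) ` carrier G))"

lemma large_carrier: "large (carrier G)"
  unfolding large_def using T subgroup_self by simp

lemma large_stabilizer:
  assumes H: "large H" and a: "acts_on (G\<lparr>carrier := H\<rparr>) Z a" "z \<in> Z" "finite ((\<lambda>g. a g z) ` H)"
  shows "large {g \<in> H. a g z = z}"
proof -
  let ?H = "G\<lparr>carrier := H\<rparr>"
  have sub: "subgroup H G" and TH: "property_T ?H" using H by (auto simp: large_def)
  interpret H: group ?H by (rule property_TD(1)[OF TH])
  have T': "property_T (G\<lparr>carrier := {g \<in> H. a g z = z}\<rparr>)"
    using property_T_stabilizer[OF TH a(1,2)] a(3) by simp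
  have "subgroup {g \<in> H. a g z = z} G"
  proof (rule subgroupI)
    show "{g \<in> H. a g z = z} \<subseteq> carrier G" using subgroup.subset[OF sub] by auto
    show "{g \<in> H. a g z = z} \<noteq> {}"
      using acts_onD(2)[OF a(1,2)] subgroup.one_closed[OF sub] by auto
  next
    fix g assume g: "g \<in> {g \<in> H. a g z = z}"
    then have "inv\<^bsub>?H\<^esub> g = inv g" using m_inv_consistent[OF sub] by simp
    then show "inv g \<in> {g \<in> H. a g z = z}"
      using g acts_on_inv(1)[OF H.is_group a(1), of g z] a(2) subgroup.m_inv_closed[OF sub] by auto
  next
    fix g h assume "g \<in> {g \<in> H. a g z = z}" "h \<in> {g \<in> H. a g z = z}"
    then show "g \<otimes> h \<in> {g \<in> H. a g z = z}"
      using acts_onD(3)[OF a(1), of g h z] a(2) subgroup.m_closed[OF sub] by auto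
  qed
  moreover have "finite ((\<lambda>g. bct g y) ` carrier G)"
    if "acts_on G UNIV bct" "finite ((\<lambda>g. bct g y) ` {g \<in> H. a g z = z})" for bct and y :: "side \<times> pgl"
  proof -
    have "finite ((\<lambda>g. bct g y) ` carrier ?H)"
      using that a(2,3)
      by (intro finite_orbit_via_stabilizer[OF H.is_group a(1,2) _ acts_on_subgroup[OF that(1) sub]]) auto
    then show ?thesis using H that(1) by (cases y) (simp add: large_def)
  qed
  ultimately show ?thesis using T' by (simp add: large_def)
qed

text \<open>The orbit of \<open>(p, 0)\<close> consists of the pairs of the image of \<open>p\<close> under \<open>g\<close> and of the germ of \<open>g\<close> at \<open>p\<close>.\<close>

definition chart_act :: "'g \<Rightarrow> side \<times> pgl \<Rightarrow> side \<times> pgl"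
  where "chart_act g = (\<lambda>(p, x). (act g p, c g p + x))"

lemma chart_act: "acts_on G UNIV chart_act"
  by (rule acts_onI) (auto simp: chart_act_def act_mult c_one c_mult' add.assoc)

end

locale projective_atlas = projective_gluing +
  fixes v :: "side \<Rightarrow> nat" and D :: "side \<Rightarrow> pgl"
  assumes atlas: "atlas v D" and unbranched: "(p, q, h) \<in> R \<Longrightarrow> v p = v q"
begin

lemma v_cont: "side_continuous v" and D_cont: "side_continuous D"
  and fin_v: "finite (range v)" and fin_D: "finite (range D)"
  and fin_marked: "finite {p \<in> marked v D. v p = k}"
  and card_marked: "card {p \<in> marked v D. v p = k} \<le> 2"
  and conn: "connected_piece v D k"
  using atlas by (auto simp: atlas_def)

lemma R_act': "g \<in> carrier G \<Longrightarrow> (p, q, h) \<in> R \<Longrightarrow> (act g p, act g q, c g q + h + - c g p) \<in> R"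
  using R_act[of g "(p, q, h)"] by (simp only: glue_act_def prod.case)

text \<open>Since the reverse of a compatible gluing is compatible, one implication across gluings
  suffices.\<close>

lemma piece_eqI:
  assumes "side_continuous \<phi>"
    "\<And>p q h. (p, q, h) \<in> R \<Longrightarrow> v p = v p0 \<Longrightarrow> D q + h = D p \<Longrightarrow> \<phi> p \<Longrightarrow> \<phi> q"
    "\<phi> p0" "v p = v p0"
  shows "\<phi> p"
proof -
  have "\<phi> p = \<phi> p0"
  proof (rule connected_pieceD[OF conn[of "v p0"] assms(1)])
    fix r s j assume rs: "(r, s, j) \<in> R" "v r = v p0" "v s = v p0" "D s + j = D r"
    then have "D r + - j = D s" by (metis add.assoc add.right_inverse add_0_right)
    then show "\<phi> r = \<phi> s" using assms(2) rs R_sym[OF rs(1)] by blast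
  qed (simp_all add: assms(4))
  then show ?thesis using assms(3) by simp
qed

lemma act_piece:
  assumes g: "g \<in> carrier G" and pq: "v p = v q"
  shows "v (act g p) = v (act g q)"
proof (rule piece_eqI[where \<phi> = "\<lambda>r. v (act g r) = v (act g q)", OF _ _ _ pq])
  show "side_continuous (\<lambda>r. v (act g r) = v (act g q))"
    by (rule side_continuous_compose[where f = "\<lambda>i. i = v (act g q)", OF side_continuous_comp_act[OF g v_cont]])
  show "v (act g s) = v (act g q)" if "(r, s, h) \<in> R" "v (act g r) = v (act g q)" for r s h
    using unbranched[OF R_act'[OF g that(1)]] that(2) by simp
qed simp

text \<open>The transition of the gluing, expressed in the charts at its two sides: 0 if the gluing is
  compatible.\<close>

definition defect :: "side \<Rightarrow> side \<Rightarrow> pgl \<Rightarrow> pgl"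
  where "defect p q h = D q + h + - D p"

text \<open>A gluing with nonzero defect has its two sides marked, so these are all the marked sides of
  the piece, and the matching leaves no further gluing than this one and its reverse.\<close>

lemma holonomy_exists:
  "\<exists>\<tau>. (\<forall>p q h. (p, q, h) \<in> R \<longrightarrow> v p = k \<longrightarrow> defect p q h \<in> {0, \<tau>, - \<tau>}) \<and>
    (\<tau> \<noteq> 0 \<longrightarrow> (\<exists>p q h. (p, q, h) \<in> R \<and> v p = k \<and> defect p q h = \<tau>))"
proof (cases "\<exists>p q h. (p, q, h) \<in> R \<and> v p = k \<and> defect p q h \<noteq> 0")
  case True
  then obtain p q h where p: "(p, q, h) \<in> R" "v p = k" "defect p q h \<noteq> 0" by blast
  have d0: "defect p q h = 0 \<longleftrightarrow> D q + h = D p" for p q h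
    unfolding defect_def by (metis add.right_inverse add_minus_cancel add.assoc add_0_right minus_add_cancel)
  have rev: "defect q p (- h) = - defect p q h" for p q h
    unfolding defect_def by (simp only: minus_add minus_minus add.assoc)
  have mk: "{p, q} \<subseteq> {p \<in> marked v D. v p = k}"
  proof -
    have "p \<in> marked v D" using p d0 unfolding marked_def by blast
    moreover have "defect q p (- h) \<noteq> 0" using p(3) rev by simp
    then have "q \<in> marked v D" using R_sym[OF p(1)] d0 unfolding marked_def by blast
    ultimately show ?thesis using p unbranched[OF p(1)] by simp
  qed
  moreover have "card {p, q} = 2" using R_neq[OF p(1)] by simp
  ultimately have all: "{p \<in> marked v D. v p = k} = {p, q}"
    using card_marked[of k] fin_marked[of k] by (metis card_seteq)
  have "defect r s j \<in> {0, defect p q h, - defect p q h}" if r: "(r, s, j) \<in> R" "v r = k" for r s j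
  proof (cases "defect r s j = 0")
    case False
    then have "r \<in> marked v D" using r d0 unfolding marked_def by blast
    then have "r = p \<or> r = q" using all r(2) by blast
    then show ?thesis
      using r(1) R_unique[OF p(1)] R_unique[OF R_sym[OF p(1)]] rev by blast
  qed simp
  then show ?thesis using p by blast
next
  case False
  then show ?thesis by (intro exI[of _ 0]) auto
qed

text \<open>The transformation \<open>g\<close> near \<open>p\<close>, expressed in the charts.\<close>

definition \<delta> :: "'a \<Rightarrow> side \<Rightarrow> pgl"
  where "\<delta> g p = D (act g p) + c g p + - D p"

lemma \<delta>_mult: "g \<in> carrier G \<Longrightarrow> h \<in> carrier G \<Longrightarrow> \<delta> (g \<otimes> h) p = \<delta> g (act h p) + \<delta> h p"
  by (simp only: \<delta>_def act_mult c_mult' add.assoc minus_add_cancel)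

lemma \<delta>_one: "\<delta> \<one> p = 0"
  by (simp only: \<delta>_def act_one c_one add_0_right add.right_inverse)

lemma \<delta>_cont: "g \<in> carrier G \<Longrightarrow> side_continuous (\<delta> g)"
  unfolding \<delta>_def
  using side_continuous_compose2[OF side_continuous_comp_act[OF _ D_cont]
      side_continuous_compose2[OF c_cont D_cont, of _ "\<lambda>x y. x + - y"], of g g "\<lambda>x y. x + y"]
  by (simp only: add.assoc)

lemma \<delta>_defect:
  "defect (act g p) (act g q) (c g q + h + - c g p) = \<delta> g q + defect p q h + - \<delta> g p"
  unfolding defect_def \<delta>_def by (simp only: add.assoc minus_add minus_minus minus_add_cancel)

lemma finite_range_\<delta>: "g \<in> carrier G \<Longrightarrow> finite (range (\<delta> g))"
proof -
  assume g: "g \<in> carrier G"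
  have "range (\<delta> g) \<subseteq> (\<lambda>(x, y, z). x + y + - z) ` (range D \<times> range (c g) \<times> range D)"
  proof (rule image_subsetI)
    fix p show "\<delta> g p \<in> (\<lambda>(x, y, z). x + y + - z) ` (range D \<times> range (c g) \<times> range D)"
      by (rule image_eqI[of _ _ "(D (act g p), c g p, D p)"]) (simp_all add: \<delta>_def)
  qed
  then show ?thesis
    by (rule finite_subset) (intro finite_imageI finite_cartesian_product fin_D finite_range_c[OF g])
qed

end

locale projective_piece = projective_atlas +
  fixes p0 :: side and \<tau> :: pgl
  assumes hol: "(p, q, h) \<in> R \<Longrightarrow> v p = v p0 \<Longrightarrow> defect p q h \<in> {0, \<tau>, - \<tau>}"
    and loop: "\<tau> \<noteq> 0 \<Longrightarrow> \<exists>p q h. (p, q, h) \<in> R \<and> v p = v p0 \<and> defect p q h = \<tau>"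
begin

definition H :: "'a set"
  where "H = {g \<in> carrier G. v (act g p0) = v p0}"

definition C :: "pgl set"
  where "C = range (\<lambda>n. multiple n \<tau>)"

lemma C_multiple: "multiple n \<tau> \<in> C"
  by (simp add: C_def)

lemma C_zero: "0 \<in> C" and C_gen: "\<tau> \<in> C" and C_gen': "- \<tau> \<in> C"
  using C_multiple[of 0] C_multiple[of 1] C_multiple[of "-1"] by (simp_all add: multiple_minus)

lemma C_plus: "x \<in> C \<Longrightarrow> y \<in> C \<Longrightarrow> x + y \<in> C"
  by (auto simp: C_def simp flip: multiple_add)

lemma C_minus: "x \<in> C \<Longrightarrow> - x \<in> C"
  by (auto simp: C_def simp flip: multiple_minus)

lemma C_comm: "x \<in> C \<Longrightarrow> y \<in> C \<Longrightarrow> x + y = y + x"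
  by (auto simp: C_def intro: multiple_commute)

lemma H_carrier: "g \<in> H \<Longrightarrow> g \<in> carrier G"
  by (simp add: H_def)

lemma H_piece: "g \<in> H \<Longrightarrow> v p = v p0 \<Longrightarrow> v (act g p) = v p0"
  using act_piece[of g p p0] by (simp add: H_def)

lemma large_H: "large H"
proof -
  define rep where "rep k = (SOME p. v p = k)" for k
  have rep: "v (rep k) = k" if "k \<in> range v" for k
    unfolding rep_def by (rule someI_ex) (use that in auto)
  define a where "a g k = v (act g (rep k))" for g k
  have av: "a g (v p) = v (act g p)" if "g \<in> carrier G" for g p
    unfolding a_def by (rule act_piece[OF that]) (simp add: rep)
  have "acts_on G (range v) a"
  proof (rule acts_onI)
    show "a g x \<in> range v" if "g \<in> carrier G" "x \<in> range v" for g x by (simp add: a_def)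
    show "a \<one> x = x" if "x \<in> range v" for x using that rep by (simp add: a_def)
    show "a (g \<otimes> h) x = a g (a h x)" if "g \<in> carrier G" "h \<in> carrier G" "x \<in> range v" for g h x
      using that by (auto simp: av act_mult)
  qed
  moreover have "finite ((\<lambda>g. a g (v p0)) ` carrier G)"
    by (rule finite_subset[OF _ fin_v]) (auto simp: a_def)
  ultimately have "large {g \<in> carrier G. a g (v p0) = v p0}"
    using large_stabilizer[OF large_carrier, of "range v" a "v p0"] by simp
  moreover have "{g \<in> carrier G. a g (v p0) = v p0} = H" using av by (auto simp: H_def)
  ultimately show ?thesis by simp
qed

lemma subgroup_H: "subgroup H G"
  using large_H by (simp add: large_def)

text \<open>In the charts \<open>g\<close> is locally constant along the piece. It can only jump where its image
  crosses a gluing with a defect, and then by an element of the holonomy group \<open>C\<close>.\<close>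

lemma \<delta>_coset:
  assumes g: "g \<in> H" and p: "v p = v p0"
  shows "\<exists>t\<in>C. \<delta> g p = t + \<delta> g p0"
proof (rule piece_eqI[where \<phi> = "\<lambda>r. \<exists>t\<in>C. \<delta> g r = t + \<delta> g p0", OF _ _ _ p])
  have gG: "g \<in> carrier G" using g by (rule H_carrier)
  show "side_continuous (\<lambda>r. \<exists>t\<in>C. \<delta> g r = t + \<delta> g p0)"
    by (rule side_continuous_compose[where f = "\<lambda>x. \<exists>t\<in>C. x = t + \<delta> g p0", OF \<delta>_cont[OF gG]])
  show "\<exists>t\<in>C. \<delta> g p0 = t + \<delta> g p0" using C_zero by force
  fix r s j assume rs: "(r, s, j) \<in> R" "v r = v p0" "D s + j = D r" "\<exists>t\<in>C. \<delta> g r = t + \<delta> g p0"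
  then obtain t where t: "t \<in> C" "\<delta> g r = t + \<delta> g p0" by blast
  define e where "e = defect (act g r) (act g s) (c g s + j + - c g r)"
  have "e \<in> {0, \<tau>, - \<tau>}" unfolding e_def by (rule hol[OF R_act'[OF gG rs(1)] H_piece[OF g rs(2)]])
  then have e: "e \<in> C" using C_zero C_gen C_gen' by auto
  have "defect r s j = 0" unfolding defect_def rs(3) by simp
  then have "e = \<delta> g s + - \<delta> g r" unfolding e_def \<delta>_defect by simp
  then have "\<delta> g s = e + \<delta> g r" by (simp add: add.assoc)
  also have "\<dots> = (e + t) + \<delta> g p0" by (simp add: t(2) add.assoc)
  finally show "\<exists>t\<in>C. \<delta> g s = t + \<delta> g p0" using C_plus[OF e t(1)] by blast
qed

text \<open>The image of a loop with holonomy \<open>\<tau>\<close> is again a loop in the piece.\<close>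

lemma conj_in_C:
  assumes g: "g \<in> H"
  shows "\<delta> g p0 + \<tau> + - \<delta> g p0 \<in> C"
proof (cases "\<tau> = 0")
  case True
  then show ?thesis using C_zero by simp
next
  case False
  have gG: "g \<in> carrier G" using g by (rule H_carrier)
  obtain p q h where p: "(p, q, h) \<in> R" "v p = v p0" "defect p q h = \<tau>" using loop[OF False] by blast
  have q: "v q = v p0" using unbranched[OF p(1)] p(2) by simp
  obtain t where t: "t \<in> C" "\<delta> g p = t + \<delta> g p0" using \<delta>_coset[OF g p(2)] by blast
  obtain u where u: "u \<in> C" "\<delta> g q = u + \<delta> g p0" using \<delta>_coset[OF g q] by blast
  define e where "e = defect (act g p) (act g q) (c g q + h + - c g p)"
  have "e \<in> {0, \<tau>, - \<tau>}" unfolding e_def by (rule hol[OF R_act'[OF gG p(1)] H_piece[OF g p(2)]])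
  then have e: "e \<in> C" using C_zero C_gen C_gen' by auto
  have "e = u + (\<delta> g p0 + \<tau> + - \<delta> g p0) + - t"
    unfolding e_def \<delta>_defect p(3) t(2) u(2) by (simp only: add.assoc minus_add)
  then have "\<delta> g p0 + \<tau> + - \<delta> g p0 = - u + e + t" by (simp only: add.assoc minus_add_cancel left_minus add_0_right)
  then show ?thesis using C_plus C_minus e t(1) u(1) by metis
qed

lemma conj_C:
  assumes "g \<in> H" "t \<in> C"
  shows "\<delta> g p0 + t + - \<delta> g p0 \<in> C"
proof -
  obtain n where n: "t = multiple n \<tau>" using assms(2) by (auto simp: C_def)
  obtain m where m: "\<delta> g p0 + \<tau> + - \<delta> g p0 = multiple m \<tau>" using conj_in_C[OF assms(1)] by (auto simp: C_def)
  have "\<delta> g p0 + t + - \<delta> g p0 = multiple (n * m) \<tau>" unfolding n multiple_conj[symmetric] m multiple_multiple ..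
  then show ?thesis by (simp add: C_def)
qed

lemma \<delta>_mult_C:
  assumes "g \<in> H" "h \<in> H"
  shows "\<exists>t\<in>C. \<delta> (g \<otimes> h) p0 = t + (\<delta> g p0 + \<delta> h p0)"
proof -
  have "v (act h p0) = v p0" using assms(2) by (simp add: H_def)
  then obtain t where "t \<in> C" "\<delta> g (act h p0) = t + \<delta> g p0" using \<delta>_coset[OF assms(1)] by blast
  then show ?thesis using \<delta>_mult[of g h p0] assms H_carrier by (auto simp: add.assoc)
qed

text \<open>The germ \<open>c g p0\<close> is recovered, up to the finitely many values of \<open>D\<close>, from the chart expression
  \<open>\<delta> g p0\<close>, which is the cocycle to which the growth estimate applies.\<close>

lemma finite_orbit_of_commuting:
  assumes K: "large K" "K \<subseteq> H"
    and com: "\<And>g h p q. g \<in> K \<Longrightarrow> h \<in> K \<Longrightarrow> v p = v p0 \<Longrightarrow> v q = v p0 \<Longrightarrow> \<delta> g p + \<delta> h q = \<delta> h q + \<delta> g p"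
  shows "finite ((\<lambda>g. chart_act g (p0, 0)) ` carrier G)"
proof -
  let ?K = "G\<lparr>carrier := K\<rparr>"
  have sub: "subgroup K G" and TK: "property_T ?K" using K(1) by (auto simp: large_def)
  have KG: "K \<subseteq> carrier G" using subgroup.subset[OF sub] .
  let ?Z = "(\<lambda>g. chart_act g (p0, 0)) ` carrier ?K"
  have Zv: "v (fst z) = v p0" if "z \<in> ?Z" for z
    using that K(2) by (auto simp: chart_act_def H_def)
  have "finite ?Z"
  proof (rule property_T_finite_orbit_of_commuting_cocycle[OF TK acts_on_subgroup[OF chart_act sub],
        where \<kappa> = "\<lambda>z. D (fst z) + snd z + - D p0" and \<sigma> = "\<lambda>g z. \<delta> g (fst z)" and N = "card (range D)"])
    show "D (fst (chart_act g z)) + snd (chart_act g z) + - D p0 = \<delta> g (fst z) + (D (fst z) + snd z + - D p0)"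
      if "g \<in> carrier ?K" "z \<in> ?Z" for g z
      by (cases z) (simp only: chart_act_def prod.case fst_conv snd_conv \<delta>_def add.assoc minus_add_cancel)
    show "finite ((\<lambda>z. \<delta> g (fst z)) ` ?Z)" if "g \<in> carrier ?K" for g
    proof (rule finite_subset[OF _ finite_range_\<delta>])
      show "g \<in> carrier G" using that KG by auto
    qed auto
    show "\<delta> g (fst z) + \<delta> h (fst w) = \<delta> h (fst w) + \<delta> g (fst z)"
      if "g \<in> carrier ?K" "h \<in> carrier ?K" "z \<in> ?Z" "w \<in> ?Z" for g h z w
      using com that(1,2) Zv[OF that(3)] Zv[OF that(4)] by simp
    fix a
    let ?F = "{z \<in> ?Z. D (fst z) + snd z + - D p0 = a}"
    have "?F \<subseteq> (\<lambda>e. (side_act (- e + a + D p0) p0, - e + a + D p0)) ` range D"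
    proof
      fix z assume z: "z \<in> ?F"
      then obtain g where g: "z = (act g p0, c g p0)" by (auto simp: chart_act_def)
      have "D (act g p0) + c g p0 + - D p0 = a" using z g by simp
      then have "c g p0 = - D (act g p0) + a + D p0"
        by (metis add.assoc left_minus add_0_right minus_add_cancel)
      then have "z = (side_act (- D (act g p0) + a + D p0) p0, - D (act g p0) + a + D p0)"
        unfolding g act_def by simp
      then show "z \<in> (\<lambda>e. (side_act (- e + a + D p0) p0, - e + a + D p0)) ` range D" by blast
    qed
    then show "finite ?F \<and> card ?F \<le> card (range D)"
      using fin_D by (meson card_image_le card_mono finite_imageI finite_subset order_trans)
  qed auto
  then show ?thesis using K(1) chart_act by (simp add: large_def)
qed

text \<open>Here \<open>\<delta> g\<close> is constant on the piece and a homomorphism in \<open>g\<close>. The subgroup \<open>K\<close> of the elements that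
  preserve the orientation in the charts has no hyperbolic elements in its image, which is
  therefore commutative.\<close>

lemma finite_orbit_trivial_holonomy:
  assumes "\<tau> = 0"
  shows "finite ((\<lambda>g. chart_act g (p0, 0)) ` carrier G)"
proof -
  have "x = 0" if x: "x \<in> C" for x
  proof -
    obtain n where "x = multiple n \<tau>" using x by (auto simp: C_def)
    then show ?thesis using multiple_multiple[of n 0 0] assms by simp
  qed
  then have \<delta>p: "\<delta> g p = \<delta> g p0" if "g \<in> H" "v p = v p0" for g p
    using \<delta>_coset[OF that] \<open>\<And>x. x \<in> C \<Longrightarrow> x = 0\<close> by (metis add_0_left)
  have hom: "\<delta> (g \<otimes> h) p0 = \<delta> g p0 + \<delta> h p0" if "g \<in> H" "h \<in> H" for g h
    using \<delta>_mult[of g h p0] \<delta>p[OF that(1), of "act h p0"] that by (simp add: H_def)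
  let ?H = "G\<lparr>carrier := H\<rparr>"
  define a where "a g b \<longleftrightarrow> (b \<longleftrightarrow> pos_det (\<delta> g p0))" for g b
  have "acts_on ?H UNIV a"
    using \<delta>_one[of p0] by (intro acts_onI) (auto simp: a_def hom pos_det_plus pos_det_zero)
  from large_stabilizer[OF large_H this, of True]
  have K: "large {g \<in> H. a g True = True}" by simp
  define K where "K = {g \<in> H. a g True = True}"
  have KH: "K \<subseteq> H" and Kpos: "\<And>g. g \<in> K \<Longrightarrow> pos_det (\<delta> g p0)" by (auto simp: K_def a_def)
  have sub: "subgroup K G" and TK: "property_T (G\<lparr>carrier := K\<rparr>)" using K by (auto simp: large_def K_def)
  have nohyp: "\<not> hyperbolic (\<delta> g p0)" if "g \<in> K" for g
    using property_T_no_hyperbolic[OF TK, of "\<lambda>g. \<delta> g p0"] hom KH that by auto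
  have inv: "\<delta> (inv g) p0 = - \<delta> g p0" if "g \<in> H" for g
  proof -
    have "\<delta> (inv g) p0 + \<delta> g p0 = 0"
      using hom[of "inv g" g] that \<delta>_one subgroup.m_inv_closed[OF subgroup_H that] H_carrier[OF that] by simp
    then show ?thesis by (simp add: eq_neg_iff_add_eq_0)
  qed
  have com: "\<delta> g p0 + \<delta> h p0 = \<delta> h p0 + \<delta> g p0" if g: "g \<in> K" and h: "h \<in> K" for g h
  proof (rule no_hyperbolic_commute)
    have m: "g \<otimes> h \<in> K" "inv g \<in> K" "inv h \<in> K" "g \<otimes> h \<otimes> inv g \<in> K" "g \<otimes> h \<otimes> inv g \<otimes> inv h \<in> K"
      using g h subgroup.m_closed[OF sub] subgroup.m_inv_closed[OF sub] by auto
    have inH: "g \<in> H" "h \<in> H" "g \<otimes> h \<in> H" "inv g \<in> H" "inv h \<in> H" "g \<otimes> h \<otimes> inv g \<in> H"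
      using g h m KH by auto
    have "\<delta> (g \<otimes> h \<otimes> inv g \<otimes> inv h) p0 = \<delta> g p0 + \<delta> h p0 + - \<delta> g p0 + - \<delta> h p0"
      by (simp only: hom inv inH)
    then show "\<not> hyperbolic (\<delta> g p0 + \<delta> h p0 + - \<delta> g p0 + - \<delta> h p0)" using nohyp[OF m(5)] by simp
  qed (use g h Kpos nohyp in auto)
  have "large K" using K by (simp add: K_def)
  then show ?thesis
  proof (rule finite_orbit_of_commuting[OF _ KH])
    fix g h p q assume "g \<in> K" "h \<in> K" "v p = v p0" "v q = v p0"
    then show "\<delta> g p + \<delta> h q = \<delta> h q + \<delta> g p"
      using com[of g h] \<delta>p[of g p] \<delta>p[of h q] subsetD[OF KH, of g] subsetD[OF KH, of h] by simp
  qed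
qed

text \<open>The group \<open>H\<close> acts by conjugation on the cyclic group \<open>C\<close>, well-defined because \<open>C\<close> is
  commutative. The orbit of the generator is finite by \<open>finite_conjugate_generators\<close>; its stabilizer
  \<open>K1\<close> consists of elements whose chart expressions commute with \<open>\<tau>\<close>. By the action \<open>b\<close> on two
  points, a further subgroup has matrices commuting with that of \<open>\<tau>\<close>, and these commute with
  each other.\<close>

lemma finite_orbit_nontrivial_holonomy:
  assumes "\<tau> \<noteq> 0"
  shows "finite ((\<lambda>g. chart_act g (p0, 0)) ` carrier G)"
proof -
  define d where "d g = \<delta> g p0" for g
  let ?H = "G\<lparr>carrier := H\<rparr>"
  define a where "a g t = d g + t + - d g" for g t
  have d_one: "d \<one> = 0" by (simp add: d_def \<delta>_one)
  have conj: "d g + t + - d g \<in> C" if "g \<in> H" "t \<in> C" for g t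
    using conj_C[OF that] by (simp add: d_def)
  have act_a: "acts_on ?H C a"
  proof (rule acts_onI)
    show "a g t \<in> C" if "g \<in> carrier ?H" "t \<in> C" for g t using that conj by (simp add: a_def)
    show "a \<one>\<^bsub>?H\<^esub> t = t" for t by (simp add: a_def d_one)
    show "a (g \<otimes>\<^bsub>?H\<^esub> h) t = a g (a h t)" if gh: "g \<in> carrier ?H" "h \<in> carrier ?H" and t: "t \<in> C" for g h t
    proof -
      obtain u where u: "u \<in> C" "d (g \<otimes> h) = u + (d g + d h)" using \<delta>_mult_C gh unfolding d_def by auto
      let ?x = "d g + (d h + t + - d h) + - d g"
      have x: "?x \<in> C" using conj gh t by simp
      have "a (g \<otimes> h) t = u + ?x + - u" unfolding a_def u(2) by (simp only: minus_add add.assoc)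
      also have "\<dots> = ?x" using C_comm[OF u(1) x] by (simp only: add.assoc add.right_inverse add_0_right)
      finally show ?thesis by (simp add: a_def)
    qed
  qed
  have orb: "(\<lambda>g. a g \<tau>) ` H \<subseteq> {s \<in> range (\<lambda>n. multiple n \<tau>). \<exists>e. s = e + \<tau> + - e \<and> - e + \<tau> + e \<in> range (\<lambda>n. multiple n \<tau>)}"
  proof clarify
    fix g assume g: "g \<in> H"
    then have ig: "inv g \<in> H" by (rule subgroup.m_inv_closed[OF subgroup_H])
    obtain u where u: "u \<in> C" "d (inv g \<otimes> g) = u + (d (inv g) + d g)" using \<delta>_mult_C[OF ig g] unfolding d_def by blast
    then have "u + d (inv g) + d g = 0" using H_carrier[OF g] d_one by (simp add: add.assoc)
    then have "- d g = u + d (inv g)" by (metis add.assoc add.right_inverse add_0_right add_0_left minus_unique)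
    then have dg: "- d g + \<tau> + d g = u + (d (inv g) + \<tau> + - d (inv g)) + - u"
      by (metis (no_types, lifting) add.assoc minus_add minus_minus)
    have "- d g + \<tau> + d g \<in> C" unfolding dg using u(1) conj[OF ig C_gen] C_plus C_minus by metis
    then show "a g \<tau> \<in> range (\<lambda>n. multiple n \<tau>) \<and> (\<exists>e. a g \<tau> = e + \<tau> + - e \<and> - e + \<tau> + e \<in> range (\<lambda>n. multiple n \<tau>))"
      using conj[OF g C_gen] unfolding a_def C_def by blast
  qed
  have K1: "large {g \<in> H. a g \<tau> = \<tau>}"
    using large_stabilizer[OF large_H act_a C_gen finite_subset[OF orb finite_conjugate_generators]] .
  define K1 where "K1 = {g \<in> H. a g \<tau> = \<tau>}"
  have K1H: "K1 \<subseteq> H" by (auto simp: K1_def)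
  have com\<tau>: "d g + \<tau> = \<tau> + d g" if "g \<in> K1" for g
  proof -
    have "d g + \<tau> + - d g = \<tau>" using that by (simp add: K1_def a_def)
    then show ?thesis by (metis add.assoc left_minus add_0_right)
  qed
  have C\<tau>: "t + \<tau> = \<tau> + t" if "t \<in> C" for t using C_comm[OF that C_gen] .
  have mcC: "mat_commute t \<tau>" if t: "t \<in> C" for t
  proof -
    have neg: "mat_commute (- \<tau>) \<tau>"
      using mat_commute_plus[of \<tau> \<tau> "- \<tau>"] mat_commute_refl[of \<tau>] mat_commute_zero[of \<tau>] by simp
    obtain n where "t = multiple n \<tau>" using t by (auto simp: C_def)
    moreover have "mat_commute (multiple n \<tau>) \<tau>" for n
    proof (induction n rule: int_induct[of _ 0])
      case base show ?case by (simp add: mat_commute_zero)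
    next
      case (step1 i)
      have "multiple i \<tau> + \<tau> = \<tau> + multiple i \<tau>" by (rule C\<tau>) (simp add: C_def)
      then show ?case unfolding multiple_succ using step1 mat_commute_plus[of \<tau> \<tau> "multiple i \<tau>"] mat_commute_refl by simp
    next
      case (step2 i)
      have "multiple i \<tau> + \<tau> = \<tau> + multiple i \<tau>" by (rule C\<tau>) (simp add: C_def)
      then show ?case unfolding multiple_pred using step2 neg mat_commute_plus[of "- \<tau>" \<tau> "multiple i \<tau>"] by simp
    qed
    ultimately show ?thesis by simp
  qed
  have mc_shift: "mat_commute (t + x) \<tau> \<longleftrightarrow> mat_commute x \<tau>" if "t \<in> C" "x + \<tau> = \<tau> + x" for t x
    using mat_commute_plus[OF C\<tau>[OF that(1)] that(2)] mcC[OF that(1)] by simp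
  define b where "b g x \<longleftrightarrow> (x \<longleftrightarrow> mat_commute (d g) \<tau>)" for g x
  let ?K1 = "G\<lparr>carrier := K1\<rparr>"
  have act_b: "acts_on ?K1 UNIV b"
  proof (rule acts_onI)
    show "b \<one>\<^bsub>?K1\<^esub> x = x" for x by (simp add: b_def d_one mat_commute_zero)
    show "b (g \<otimes>\<^bsub>?K1\<^esub> h) x = b g (b h x)" if gh: "g \<in> carrier ?K1" "h \<in> carrier ?K1" for g h x
    proof -
      obtain u where u: "u \<in> C" "d (g \<otimes> h) = u + (d g + d h)" using \<delta>_mult_C gh K1H unfolding d_def by force
      have "d g + d h + \<tau> = \<tau> + (d g + d h)" using com\<tau> gh by (simp add: add.assoc) (simp flip: add.assoc add: com\<tau>)
      then have "mat_commute (d (g \<otimes> h)) \<tau> \<longleftrightarrow> mat_commute (d g + d h) \<tau>" unfolding u(2) by (rule mc_shift[OF u(1)])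
      also have "\<dots> \<longleftrightarrow> (mat_commute (d g) \<tau> \<longleftrightarrow> mat_commute (d h) \<tau>)" using com\<tau> gh by (intro mat_commute_plus) auto
      finally show ?thesis by (auto simp: b_def)
    qed
  qed simp
  have K1': "large K1" using K1 by (simp add: K1_def)
  from large_stabilizer[OF K1' act_b, of True]
  have K2: "large {g \<in> K1. b g True = True}" by simp
  show ?thesis
  proof (rule finite_orbit_of_commuting[OF K2])
    show "{g \<in> K1. b g True = True} \<subseteq> H" using K1H by auto
    have mc: "mat_commute (\<delta> g p) \<tau>" if g: "g \<in> {g \<in> K1. b g True = True}" and p: "v p = v p0" for g p
    proof -
      obtain t where t: "t \<in> C" "\<delta> g p = t + d g" using \<delta>_coset[OF _ p, of g] g K1H unfolding d_def by auto
      have "mat_commute (t + d g) \<tau> \<longleftrightarrow> mat_commute (d g) \<tau>" using mc_shift[OF t(1) com\<tau>] g by simp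
      then show ?thesis using g t(2) by (simp add: b_def)
    qed
    show "\<delta> g p + \<delta> h q = \<delta> h q + \<delta> g p"
      if "g \<in> {g \<in> K1. b g True = True}" "h \<in> {g \<in> K1. b g True = True}" "v p = v p0" "v q = v p0" for g h p q
      using mat_commute_trans[OF mc[OF that(1,3)] mc[OF that(2,4)] assms] .
  qed
qed

lemma finite_chart_orbit: "finite ((\<lambda>g. chart_act g (p0, 0)) ` carrier G)"
  using finite_orbit_trivial_holonomy finite_orbit_nontrivial_holonomy by blast

end

context projective_atlas
begin

lemma finite_chart_orbit_any: "finite ((\<lambda>g. chart_act g (p, 0)) ` carrier G)"
proof -
  obtain \<tau> where \<tau>: "\<forall>r q h. (r, q, h) \<in> R \<longrightarrow> v r = v p \<longrightarrow> defect r q h \<in> {0, \<tau>, - \<tau>}"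
    "\<tau> \<noteq> 0 \<longrightarrow> (\<exists>r q h. (r, q, h) \<in> R \<and> v r = v p \<and> defect r q h = \<tau>)"
    using holonomy_exists[of "v p"] by metis
  interpret projective_piece G c R v D p \<tau>
    by unfold_locales (use \<tau> in blast)+
  show ?thesis by (rule finite_chart_orbit)
qed

text \<open>If \<open>g\<close> fixes the germ at one side of a gluing, uniqueness in the matching makes it fix the
  other side and the germ there.\<close>

lemma trivial_germ_on_piece:
  assumes g: "g \<in> carrier G" and "c g p = 0" and "v q = v p"
  shows "c g q = 0"
proof (rule piece_eqI[where \<phi> = "\<lambda>r. c g r = 0", OF _ _ assms(2,3)])
  show "side_continuous (\<lambda>r. c g r = 0)"
    by (rule side_continuous_compose[where f = "\<lambda>x. x = 0", OF c_cont[OF g]])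
  fix r s j assume rs: "(r, s, j) \<in> R" "c g r = 0"
  then have "(r, act g s, c g s + j) \<in> R" using R_act'[OF g rs(1)] by (simp add: act_def)
  then have "c g s + j = j" using R_unique[OF rs(1)] by blast
  then show "c g s = 0" by (metis add.assoc add.right_inverse add_0_right)
qed

text \<open>An element is determined by its germs at one chosen side \<open>rep k\<close> of each piece, and there are
  finitely many possibilities for each of these germs.\<close>

theorem finite_carrier: "finite (carrier G)"
proof -
  define rep where "rep k = (SOME p. v p = k)" for k
  have rep: "v (rep (v p)) = v p" for p unfolding rep_def by (rule someI) simp
  define F where "F k = (\<lambda>g. chart_act g (rep k, 0)) ` carrier G" for k
  define f where "f g = (\<lambda>k\<in>range v. chart_act g (rep k, 0))" for g
  have "inj_on f (carrier G)"
  proof (rule inj_onI)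
    fix g h assume gh: "g \<in> carrier G" "h \<in> carrier G" "f g = f h"
    have "c (inv h \<otimes> g) p = 0" for p
    proof -
      let ?r = "rep (v p)"
      have "chart_act g (?r, 0) = chart_act h (?r, 0)" using gh(3) by (auto simp: f_def fun_eq_iff restrict_def split: if_splits)
      then have e: "act g ?r = act h ?r" "c g ?r = c h ?r" by (auto simp: chart_act_def)
      have "c (inv h \<otimes> g) ?r = c (inv h) (act h ?r) + c h ?r" using gh e by (simp add: c_mult')
      also have "\<dots> = c (inv h \<otimes> h) ?r" by (rule c_mult'[symmetric]) (use gh in auto)
      also have "\<dots> = 0" using gh by (simp add: c_one)
      finally show ?thesis using gh by (intro trivial_germ_on_piece[of _ ?r p]) (simp_all add: rep)
    qed
    then have "inv h \<otimes> g = \<one>" using gh by (intro c_faithful) auto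
    then show "g = h" using gh by (metis inv_closed inv_inv inv_equality inv_unique' inv_comm)
  qed
  moreover have "f ` carrier G \<subseteq> (\<Pi>\<^sub>E k\<in>range v. F k)" by (auto simp: f_def F_def)
  moreover have "finite (\<Pi>\<^sub>E k\<in>range v. F k)"
    unfolding F_def using fin_v finite_chart_orbit_any by (intro finite_PiE) auto
  ultimately show ?thesis by (meson finite_imageD finite_subset)
qed

end

theorem (in projective_cocycle) finite_group: "finite (carrier G)"
proof -
  obtain R where R: "\<And>p q h. (p, q, h) \<in> R \<Longrightarrow> (q, p, - h) \<in> R"
    "\<And>p q h q' h'. (p, q, h) \<in> R \<Longrightarrow> (p, q', h') \<in> R \<Longrightarrow> q' = q \<and> h' = h"
    "\<And>p q h. (p, q, h) \<in> R \<Longrightarrow> p \<noteq> q"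
    "\<And>g x. g \<in> carrier G \<Longrightarrow> x \<in> R \<Longrightarrow> glue_act g x \<in> R"
    "finite (standard - R)"
    by (rule invariant_matching) blast
  interpret projective_gluing G c R
  proof unfold_locales
    show "(q, p, - h) \<in> R" if "(p, q, h) \<in> R" for p q h using R(1)[OF that] .
    show "q' = q \<and> h' = h" if "(p, q, h) \<in> R" "(p, q', h') \<in> R" for p q h q' h' using R(2)[OF that] .
    show "p \<noteq> q" if "(p, q, h) \<in> R" for p q h using R(3)[OF that] .
    show "glue_act g x \<in> R" if "g \<in> carrier G" "x \<in> R" for g x using R(4)[OF that] .
  qed (rule R(5))
  obtain v D where vD: "atlas v D" "\<And>p q h. (p, q, h) \<in> R \<Longrightarrow> v p = v q"
    by (rule unbranched_atlas) blast
  interpret projective_atlas G c R v D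
  proof unfold_locales
    show "v p = v q" if "(p, q, h) \<in> R" for p q h using vD(2)[OF that] .
  qed (rule vD(1))
  show ?thesis by (rule finite_carrier)
qed

text \<open>The germs of the transformations form a faithful cocycle.\<close>

theorem corollary1p3:
  shows "\<not> (\<exists>\<Gamma>. subgroup \<Gamma> PC_Proj \<and> infinite \<Gamma> \<and> property_T (PC_Proj\<lparr>carrier := \<Gamma>\<rparr>))"
proof clarify
  fix \<Gamma> assume \<Gamma>: "subgroup \<Gamma> PC_Proj" "infinite \<Gamma>" "property_T (PC_Proj\<lparr>carrier := \<Gamma>\<rparr>)"
  let ?G = "PC_Proj\<lparr>carrier := \<Gamma>\<rparr>"
  have rep: "\<exists>f. PC_map f \<and> piecewise_projective f \<and> X = PC_rel `` {f}" if "X \<in> \<Gamma>" for X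
    using subgroup.mem_carrier[OF \<Gamma>(1) that] by (simp add: carrier_PC_Proj)
  have mult: "X \<otimes>\<^bsub>PC_Proj\<^esub> Y = X \<otimes>\<^bsub>PC\<^esub> Y" for X Y by (simp add: PC_Proj_def)
  have one: "\<one>\<^bsub>PC_Proj\<^esub> = PC_rel `` {id}" by (simp add: PC_Proj_def PC_one)
  have pid: "piecewise_projective id"
  proof -
    have "PC_rel `` {id} \<in> carrier PC_Proj" using subgroup.one_closed[OF \<Gamma>(1)] subgroup.mem_carrier[OF \<Gamma>(1)] one by metis
    then obtain f where "PC_map f" "piecewise_projective f" "PC_rel `` {id} = PC_rel `` {f}" by (auto simp: carrier_PC_Proj)
    then have "(f, id) \<in> PC_rel" using equiv_class_self[OF equiv_PC_rel, of id] PC_map_id by blast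
    then show ?thesis using piecewise_projective_cong[of f id] \<open>piecewise_projective f\<close> by (simp add: PC_rel_def)
  qed
  interpret projective_cocycle ?G class_germ
  proof
    show "property_T ?G" by (rule \<Gamma>(3))
    show "class_germ \<one>\<^bsub>?G\<^esub> p = 0" for p
      using class_germ_eq[OF PC_map_id pid] by (simp add: one germ_id)
    show "class_germ (X \<otimes>\<^bsub>?G\<^esub> Y) p = class_germ X (side_act (class_germ Y p) p) + class_germ Y p"
      if XY: "X \<in> carrier ?G" "Y \<in> carrier ?G" for X Y p
    proof -
      obtain f where f: "PC_map f" "piecewise_projective f" "X = PC_rel `` {f}" using rep XY by auto
      obtain g where g: "PC_map g" "piecewise_projective g" "Y = PC_rel `` {g}" using rep XY by auto
      have "X \<otimes>\<^bsub>?G\<^esub> Y = PC_rel `` {f \<circ> g}" using f g by (simp add: mult PC_mult)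
      then show ?thesis
        using f g class_germ_eq[OF PC_map_comp[OF f(1) g(1)] piecewise_projective_comp[OF f(2) g(2,1)]]
        by (simp add: class_germ_eq germ_comp)
    qed
    show "side_continuous (class_germ X)" "finite {y. class_germ X (Below y) \<noteq> class_germ X (Above y)}"
      if "X \<in> carrier ?G" for X
      using rep[of X] that class_germ_eq side_continuous_germ finite_germ_jumps by auto
    show "X = \<one>\<^bsub>?G\<^esub>" if X: "X \<in> carrier ?G" "\<And>p. class_germ X p = 0" for X
    proof -
      obtain f where f: "PC_map f" "piecewise_projective f" "X = PC_rel `` {f}" using rep X by auto
      have "\<forall>\<^sub>\<infinity>x. f x = x" using germ_zero_imp_id[OF f(2)] X(2) class_germ_eq[OF f(1,2)] f(3) by simp
      then have "PC_rel `` {f} = PC_rel `` {id}" using PC_class_eqI[OF f(1) PC_map_id] by simp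
      then show ?thesis using f(3) by (simp add: one)
    qed
  qed
  show False using finite_group \<Gamma>(2) by simp
qed

end
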